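(* Let $G$ be a finite solvable group and let $H$ be a subgroup of $\mathrm{Aut}(G)$. Suppose that there exists an $H$-invariant Carter subgroup $F$ of $G$ such that the semidirect product $FH$ is a Frobenius group with kernel $F$ (and complement $H$). Then: (a) $F_n(C_G(H)) = F_n(G)\cap C_G(H)$ for all $n\in\mathbb{N}$; (b) $h(G)\le h(C_G(H))+1$; in fact $G = F\,F_m(G)$, where $m = h(C_G(H))$.
   Context: A Carter subgroup of a finite group is a nilpotent self-normalizing subgroup. $C_G(H)$ denotes the subgroup of elements of $G$ fixed by every element of $H$. For a finite group $X$, $F_n(X)$ denotes the $n$-th term of the Fitting series: $F_0(X)=1$, $F_1(X)=F(X)$ is the Fitting subgroup, and $F_{n+1}(X)/F_n(X)=F(X/F_n(X))$. For a finite solvable group $X$, the Fitting height $h(X)$ is the least $n\ge 0$ with $F_n(X)=X$. (The letter $F$ standing alone denotes the given Carter subgroup.) *)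

theory Defs
  imports "HOL-Algebra.Solvable_Groups" "HOL-Algebra.Group_Action"
begin

primrec lower_central_series :: "('a, 'b) monoid_scheme \<Rightarrow> nat \<Rightarrow> 'a set" where
  "lower_central_series G 0 = carrier G"
| "lower_central_series G (Suc n) =
     generate G (\<Union>x \<in> lower_central_series G n. \<Union>y \<in> carrier G.
       {x \<otimes>\<^bsub>G\<^esub> y \<otimes>\<^bsub>G\<^esub> inv\<^bsub>G\<^esub> x \<otimes>\<^bsub>G\<^esub> inv\<^bsub>G\<^esub> y})"

definition nilpotent_group :: "('a, 'b) monoid_scheme \<Rightarrow> bool" where
  "nilpotent_group G \<longleftrightarrow> group G \<and> (\<exists>n. lower_central_series G n = {\<one>\<^bsub>G\<^esub>})"

definition Fitting :: "('a, 'b) monoid_scheme \<Rightarrow> 'a set" where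
  "Fitting G = generate G (\<Union>{N. N \<lhd> G \<and> nilpotent_group (G\<lparr>carrier := N\<rparr>)})"

text \<open>The terms of the Fitting series are subsets of \<^term>\<open>carrier G\<close>: the next term is the full
  preimage, under the projection of \<open>G\<close> onto its quotient by the current term, of the Fitting
  subgroup of that quotient.\<close>

primrec fitting_series :: "('a, 'b) monoid_scheme \<Rightarrow> nat \<Rightarrow> 'a set" where
  "fitting_series G 0 = {\<one>\<^bsub>G\<^esub>}"
| "fitting_series G (Suc n) =
     {x \<in> carrier G. fitting_series G n #>\<^bsub>G\<^esub> x \<in> Fitting (G Mod fitting_series G n)}"

text \<open>Meaningful only if the series reaches \<open>G\<close>, as it does for every finite solvable group.\<close>

definition fitting_height :: "('a, 'b) monoid_scheme \<Rightarrow> nat" where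
  "fitting_height G = (LEAST n. fitting_series G n = carrier G)"

definition carter_subgroup :: "'a set \<Rightarrow> ('a, 'b) monoid_scheme \<Rightarrow> bool" where
  "carter_subgroup F G \<longleftrightarrow>
     subgroup F G \<and> nilpotent_group (G\<lparr>carrier := F\<rparr>) \<and> normalizer G F = F"

definition fixed_points :: "('a, 'b) monoid_scheme \<Rightarrow> ('a \<Rightarrow> 'a) set \<Rightarrow> 'a set" where
  "fixed_points G H = {x \<in> carrier G. \<forall>h \<in> H. h x = x}"

definition invariant_under :: "('a \<Rightarrow> 'a) set \<Rightarrow> 'a set \<Rightarrow> bool" where
  "invariant_under H S \<longleftrightarrow> (\<forall>h \<in> H. h ` S = S)"

definition semidirect_product ::
    "('a, 'c) monoid_scheme \<Rightarrow> ('b, 'd) monoid_scheme \<Rightarrow> ('b \<Rightarrow> 'a \<Rightarrow> 'a) \<Rightarrow> ('a \<times> 'b) monoid" where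
  "semidirect_product N A \<phi> =
     \<lparr>carrier = carrier N \<times> carrier A,
      mult = (\<lambda>(x, a) (y, b). (x \<otimes>\<^bsub>N\<^esub> \<phi> a y, a \<otimes>\<^bsub>A\<^esub> b)),
      one = (\<one>\<^bsub>N\<^esub>, \<one>\<^bsub>A\<^esub>)\<rparr>"

text \<open>A group \<open>X\<close> is Frobenius with complement \<open>A\<close> if \<open>A\<close> is a nontrivial proper subgroup meeting each
  of its conjugates by elements outside \<open>A\<close> trivially; the kernel consists of the identity and the
  elements lying in no conjugate of \<open>A\<close>.\<close>

definition frobenius_group :: "('a, 'b) monoid_scheme \<Rightarrow> 'a set \<Rightarrow> 'a set \<Rightarrow> bool" where
  "frobenius_group X N A \<longleftrightarrow>
     group X \<and> subgroup A X \<and> A \<noteq> {\<one>\<^bsub>X\<^esub>} \<and> A \<noteq> carrier X \<and>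
     (\<forall>x \<in> carrier X - A. A \<inter> (x <#\<^bsub>X\<^esub> A #>\<^bsub>X\<^esub> inv\<^bsub>X\<^esub> x) = {\<one>\<^bsub>X\<^esub>}) \<and>
     N = {\<one>\<^bsub>X\<^esub>} \<union> (carrier X - (\<Union>x \<in> carrier X. x <#\<^bsub>X\<^esub> A #>\<^bsub>X\<^esub> inv\<^bsub>X\<^esub> x))"

text \<open>The semidirect product of an invariant subgroup \<open>F\<close> of \<open>G\<close> with a group \<open>H\<close> of automorphisms of
  \<open>G\<close>, the action being evaluation; the two factors embed as \<open>F \<times> 1\<close> and \<open>1 \<times> H\<close>.\<close>

definition auto_semidirect ::
    "('a, 'b) monoid_scheme \<Rightarrow> 'a set \<Rightarrow> ('a \<Rightarrow> 'a) set \<Rightarrow> ('a \<times> ('a \<Rightarrow> 'a)) monoid" where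
  "auto_semidirect G F H =
     semidirect_product (G\<lparr>carrier := F\<rparr>) (AutoGroup G\<lparr>carrier := H\<rparr>) (\<lambda>h x. h x)"

end

theory Submission
  imports Defs "HOL-Algebra.Sylow" "HOL-Algebra.Multiplicative_Group"
begin

text \<open>Identify \<open>G\<close> and \<open>H\<close> with subgroups of the semidirect product \<open>GH\<close>. The heart of the matter is
  \<open>F(C\<^sub>G(H)) = F(G) \<inter> C\<^sub>G(H)\<close>; everything else follows by passing to quotients, because fixed
  points of \<open>H\<close> lift through an invariant normal subgroup. For an abelian chief factor \<open>V\<close> of
  exponent \<open>r\<close> this lifting is the vanishing of \<open>H\<^sup>1(H, V)\<close>: if \<open>r\<close> does not divide the order of
  \<open>H\<close> one averages; otherwise \<open>r\<close> does not divide the order of \<open>F\<close>, the Carter property makes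
  \<open>C\<^sub>V(F)\<close> trivial, and the partition of the Frobenius group \<open>FH\<close> gives the cobounding element.

  For the main identity one shows, descending a chief series, that \<open>F(C\<^sub>G(H))\<close> centralises each chief
  factor \<open>V\<close>. Let \<open>L\<close> centralise all chief factors above \<open>V\<close>, so that \<open>L\<close> acts on \<open>V\<close> as a nilpotent
  \<open>r'\<close>-group. It is enough that an element of \<open>C\<^sub>L(H)\<close> trivial on \<open>C\<^sub>V(H)\<close> is trivial on \<open>V\<close>. If
  not, decompose \<open>V\<close> under a central elementary abelian \<open>p\<close>-subgroup \<open>A\<close> of the group induced by the
  \<open>F\<close>-conjugates of such elements; the blocks \<open>W B\<close> are indexed by hyperplanes \<open>B\<close> of \<open>A\<close>. On a
  block where these elements act nontrivially, the stabiliser in \<open>F\<close> and some \<open>1 \<noteq> h \<in> H\<close> centralise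
  \<open>A/B\<close>, and the elements vanish on the other blocks of the orbit. So an element of \<open>A - B\<close> can be
  localised to one block, and the product of its \<open>F\<close>-conjugates is centralised by \<open>F\<close> and by \<open>h\<close>
  modulo the kernel of the action on the orbit. Since \<open>F\<close> is a Carter subgroup and \<open>h\<close> has no fixed
  points in \<open>F\<close>, no such element exists.

  Part (b) holds because \<open>H\<close> acts without fixed points on \<open>G/F\<^sub>m(G)\<close>, which forces this quotient to
  be covered by \<open>F\<close>.

  Groups are additively written finite subsets of a type of class \<open>group_add\<close>, and quotients are
  realised by Cayley's theorem in a type of permutations, so that subgroups, conjugates and quotients
  need no records: \<open>cj\<close> is conjugation, \<open>cm\<close> the commutator, \<open>nm n x\<close> the \<open>n\<close>-fold sum,
  \<open>sgrp\<close> means subgroup and \<open>nmz A S\<close> that \<open>A\<close> normalises \<open>S\<close>.\<close>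

section \<open>Subgroups of a group\<close>

text \<open>A quotient lives in a new type of permutations, so an induction hypothesis about a group
  cannot be applied to its quotients. The inductions therefore run over normal subgroups of one
  fixed ambient group, and a step forms a single quotient, typically by the lower term of a chief
  factor. For the same reason the Fitting subgroup is handled as a set \<open>cen\<close> of
  elements centralising chief factors, a condition on elements of the group itself.

  The recurring device is the map from q to [q, h]. If h normalises a finite group Q and commutes
  with no nontrivial element of it, this map is a bijection of Q and of every h-invariant subgroup
  of Q. It gives the partition identity, preserves freeness in quotients, finds fixed points in
  orbits of F and forces stabilisers in F to centralise A/B.

  The orders of G and H are not assumed coprime, so averaging over H is available only for some
  primes; sums over F and over A take its place. The field of V may lack p-th roots of unity, so the
  blocks of A are cut out by traces and subgroups of index p instead of characters.\<close>

declare add_uminus_conv_diff [simp del] diff_conv_add_uminus [simp]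

lemmas gsimps = add.assoc minus_add

definition cj :: "'a::group_add \<Rightarrow> 'a \<Rightarrow> 'a" where "cj x y = x + y + - x"

definition cm :: "'a::group_add \<Rightarrow> 'a \<Rightarrow> 'a" where "cm x y = x + y + - x + - y"

definition sgrp :: "'a::group_add set \<Rightarrow> bool" where
  "sgrp S \<longleftrightarrow> 0 \<in> S \<and> (\<forall>x\<in>S. \<forall>y\<in>S. x + y \<in> S) \<and> (\<forall>x\<in>S. - x \<in> S)"

definition nmz :: "'a::group_add set \<Rightarrow> 'a set \<Rightarrow> bool" where
  "nmz A S \<longleftrightarrow> (\<forall>x\<in>A. \<forall>s\<in>S. cj x s \<in> S)"

definition homo :: "'a::group_add set \<Rightarrow> ('a \<Rightarrow> 'b::group_add) \<Rightarrow> bool" where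
  "homo S f \<longleftrightarrow> (\<forall>x\<in>S. \<forall>y\<in>S. f (x + y) = f x + f y)"

inductive_set gen :: "'a::group_add set \<Rightarrow> 'a set" for A where
  zero: "0 \<in> gen A"
| base: "a \<in> A \<Longrightarrow> a \<in> gen A"
| add: "x \<in> gen A \<Longrightarrow> y \<in> gen A \<Longrightarrow> x + y \<in> gen A"
| uminus: "x \<in> gen A \<Longrightarrow> - x \<in> gen A"

primrec nm :: "nat \<Rightarrow> 'a::group_add \<Rightarrow> 'a" where
  "nm 0 x = 0"
| "nm (Suc n) x = x + nm n x"

lemma sgrpI: "0 \<in> S \<Longrightarrow> (\<And>x y. x \<in> S \<Longrightarrow> y \<in> S \<Longrightarrow> x + y \<in> S) \<Longrightarrow> (\<And>x. x \<in> S \<Longrightarrow> - x \<in> S) \<Longrightarrow> sgrp S"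
  by (auto simp: sgrp_def)

lemma sgrp_zero: "sgrp S \<Longrightarrow> 0 \<in> S"
  and sgrp_add: "sgrp S \<Longrightarrow> x \<in> S \<Longrightarrow> y \<in> S \<Longrightarrow> x + y \<in> S"
  and sgrp_uminus: "sgrp S \<Longrightarrow> x \<in> S \<Longrightarrow> - x \<in> S"
  by (auto simp: sgrp_def)

lemmas sgrp_mem = sgrp_zero sgrp_add sgrp_uminus

lemma sgrp_uminus_iff: "sgrp S \<Longrightarrow> - x \<in> S \<longleftrightarrow> x \<in> S"
  by (metis minus_minus sgrp_uminus)

lemma sgrp_add_left: "sgrp S \<Longrightarrow> x \<in> S \<Longrightarrow> x + y \<in> S \<longleftrightarrow> y \<in> S"
  by (metis minus_add_cancel sgrp_add sgrp_uminus)

lemma sgrp_add_right: "sgrp S \<Longrightarrow> y \<in> S \<Longrightarrow> x + y \<in> S \<longleftrightarrow> x \<in> S"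
  using sgrp_add[of S "x + y" "- y"] by (auto simp: add.assoc sgrp_mem)

lemma sgrp_cj: "sgrp S \<Longrightarrow> x \<in> S \<Longrightarrow> y \<in> S \<Longrightarrow> cj x y \<in> S"
  by (simp add: cj_def sgrp_add sgrp_uminus)

lemma sgrp_cm: "sgrp S \<Longrightarrow> x \<in> S \<Longrightarrow> y \<in> S \<Longrightarrow> cm x y \<in> S"
  by (simp add: cm_def sgrp_add sgrp_uminus)

lemma sgrp_trivial [simp]: "sgrp {0}"
  by (simp add: sgrp_def)

lemma sgrp_Int: "sgrp S \<Longrightarrow> sgrp T \<Longrightarrow> sgrp (S \<inter> T)"
  by (auto simp: sgrp_def)

lemma cj_add: "cj x (y + z) = cj x y + cj x z"
  and cj_cj: "cj x (cj y z) = cj (x + y) z"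
  and cj_zero [simp]: "cj x 0 = 0"
  and cj_zero_left [simp]: "cj 0 y = y"
  and cj_uminus: "cj x (- y) = - cj x y"
  and cj_inverse [simp]: "cj (- x) (cj x y) = y" "cj x (cj (- x) y) = y"
  and cj_eq_zero [simp]: "cj x y = 0 \<longleftrightarrow> y = 0"
  and cj_eq_iff: "cj x y = z \<longleftrightarrow> y = cj (- x) z"
  and cj_inj [simp]: "cj x y = cj x z \<longleftrightarrow> y = z"
  for x y z :: "'a::group_add"
proof -
  show inv: "cj (- x) (cj x y) = y" "cj x (cj (- x) y) = y" for x y :: 'a by (simp_all add: cj_def gsimps)
  show "cj x 0 = 0" for x :: 'a by (simp add: cj_def)
  then show "cj x y = 0 \<longleftrightarrow> y = 0" by (metis inv(1))
  show "cj x y = z \<longleftrightarrow> y = cj (- x) z" "cj x y = cj x z \<longleftrightarrow> y = z" by (metis inv)+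
qed (simp_all add: cj_def gsimps)

lemma cm_cj: "cm x y = cj x y + - y"
  and cm_cj': "cm x y = x + cj y (- x)"
  and cj_cm: "cj x y = cm x y + y"
  and cm_uminus: "- cm x y = cm y x"
  and cj_distrib_cm: "cj z (cm x y) = cm (cj z x) (cj z y)"
  by (simp_all add: cm_def cj_def gsimps)

lemma cm_eq_zero: "cm x y = 0 \<longleftrightarrow> x + y = y + x"
proof
  assume "cm x y = 0"
  then have "x + y + - x + - y + y + x = 0 + y + x" by (simp add: cm_def)
  then show "x + y = y + x" by (simp add: add.assoc)
qed (simp add: cm_def add.assoc[symmetric], simp add: add.assoc)

lemma cj_eq_self: "cj x y = y \<longleftrightarrow> x + y = y + x"
proof -
  have "cj x y + - y + y = 0 + y \<longleftrightarrow> cj x y + - y = 0" by (rule add_right_cancel)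
  then show ?thesis using cm_eq_zero[of x y] by (simp add: cm_cj add.assoc)
qed

lemma cj_commute: "cj x y = y \<Longrightarrow> cj y x = x"
  by (simp add: cj_eq_self)

lemma nmzD: "nmz A S \<Longrightarrow> x \<in> A \<Longrightarrow> s \<in> S \<Longrightarrow> cj x s \<in> S"
  by (auto simp: nmz_def)

lemma nmz_cj_iff: "nmz A S \<Longrightarrow> sgrp A \<Longrightarrow> x \<in> A \<Longrightarrow> cj x s \<in> S \<longleftrightarrow> s \<in> S"
  by (metis cj_inverse(1) nmzD sgrp_uminus)

lemma nmz_mono: "nmz A S \<Longrightarrow> B \<subseteq> A \<Longrightarrow> nmz B S"
  by (auto simp: nmz_def)

lemma nmz_Int: "nmz A S \<Longrightarrow> nmz A T \<Longrightarrow> nmz A (S \<inter> T)"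
  by (auto simp: nmz_def)

lemma nmz_trivial [simp]: "nmz A {0}"
  by (simp add: nmz_def)

lemma nmz_self: "sgrp S \<Longrightarrow> nmz S S"
  by (simp add: nmz_def sgrp_cj)

lemma cm_in_normal: "sgrp N \<Longrightarrow> nmz A N \<Longrightarrow> x \<in> A \<Longrightarrow> y \<in> N \<Longrightarrow> cm x y \<in> N"
  by (simp add: cm_cj nmzD sgrp_add sgrp_uminus)

lemma cm_in_normal': "sgrp N \<Longrightarrow> nmz A N \<Longrightarrow> x \<in> A \<Longrightarrow> y \<in> N \<Longrightarrow> cm y x \<in> N"
  by (metis cm_in_normal cm_uminus sgrp_uminus)

lemma sgrp_gen: "sgrp (gen A)"
  by (auto intro: sgrpI gen.intros)

lemma gen_least: "sgrp S \<Longrightarrow> A \<subseteq> S \<Longrightarrow> gen A \<subseteq> S"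
proof
  fix x assume "sgrp S" "A \<subseteq> S" "x \<in> gen A"
  from this(3,1,2) show "x \<in> S"
    by (induct rule: gen.induct) (auto simp: sgrp_mem)
qed

lemma gen_mono: "A \<subseteq> B \<Longrightarrow> gen A \<subseteq> gen B"
  by (rule gen_least) (auto simp: sgrp_gen intro: gen.base)

lemma nmz_gen: assumes "nmz B A" shows "nmz B (gen A)"
  unfolding nmz_def
proof (intro ballI)
  fix x s assume x: "x \<in> B" and "s \<in> gen A"
  from this(2) show "cj x s \<in> gen A"
    using assms x
    by (induct rule: gen.induct) (auto simp: cj_add cj_uminus nmz_def intro: gen.intros)
qed

lemma homoD: "homo S f \<Longrightarrow> x \<in> S \<Longrightarrow> y \<in> S \<Longrightarrow> f (x + y) = f x + f y"
  by (auto simp: homo_def)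

lemma homo_mono: "homo S f \<Longrightarrow> T \<subseteq> S \<Longrightarrow> homo T f"
  by (auto simp: homo_def)

lemma homo_zero: "homo S f \<Longrightarrow> sgrp S \<Longrightarrow> f 0 = 0"
  by (metis add.right_neutral add_left_cancel homoD sgrp_zero)

lemma homo_uminus: "homo S f \<Longrightarrow> sgrp S \<Longrightarrow> x \<in> S \<Longrightarrow> f (- x) = - f x"
  by (rule minus_unique[symmetric]) (simp add: homoD[symmetric] homo_zero sgrp_uminus)

lemma homo_cj: "homo S f \<Longrightarrow> sgrp S \<Longrightarrow> x \<in> S \<Longrightarrow> y \<in> S \<Longrightarrow> f (cj x y) = cj (f x) (f y)"
  by (simp add: cj_def homoD homo_uminus sgrp_mem)

lemma homo_cm: "homo S f \<Longrightarrow> sgrp S \<Longrightarrow> x \<in> S \<Longrightarrow> y \<in> S \<Longrightarrow> f (cm x y) = cm (f x) (f y)"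
  by (simp add: cm_def homoD homo_uminus sgrp_mem)

lemma homo_nm: "homo S f \<Longrightarrow> sgrp S \<Longrightarrow> x \<in> S \<Longrightarrow> nm n x \<in> S \<and> f (nm n x) = nm n (f x)"
  by (induct n) (auto simp: homoD homo_zero sgrp_mem)

lemma homo_cjfun: "homo S (cj x)"
  by (simp add: homo_def cj_add)

lemma sgrp_image: "homo S f \<Longrightarrow> sgrp S \<Longrightarrow> T \<subseteq> S \<Longrightarrow> sgrp T \<Longrightarrow> sgrp (f ` T)"
  by (rule sgrpI)
     (auto simp: homoD[symmetric] homo_uminus[symmetric] subset_iff sgrp_mem intro!: imageI,
      metis homo_zero image_eqI sgrp_zero)

lemma sgrp_vimage: "homo S f \<Longrightarrow> sgrp S \<Longrightarrow> sgrp T \<Longrightarrow> sgrp {x \<in> S. f x \<in> T}"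
  by (rule sgrpI) (auto simp: sgrp_mem homoD homo_uminus homo_zero)

lemma nmz_image: "homo S f \<Longrightarrow> sgrp S \<Longrightarrow> T \<subseteq> S \<Longrightarrow> A \<subseteq> S \<Longrightarrow> nmz A T \<Longrightarrow> nmz (f ` A) (f ` T)"
  unfolding nmz_def by (auto simp: homo_cj[symmetric] subset_iff)

lemma nmz_vimage: "homo S f \<Longrightarrow> sgrp S \<Longrightarrow> U \<subseteq> S \<Longrightarrow> A \<subseteq> S \<Longrightarrow> nmz A U \<Longrightarrow> nmz (f ` A) T \<Longrightarrow> nmz A {x \<in> U. f x \<in> T}"
  unfolding nmz_def by (auto simp: homo_cj subset_iff)

lemma homo_eq_iff: "homo S f \<Longrightarrow> sgrp S \<Longrightarrow> x \<in> S \<Longrightarrow> y \<in> S \<Longrightarrow> f x = f y \<longleftrightarrow> f (- x + y) = 0"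
  by (simp add: homoD homo_uminus sgrp_mem) (metis eq_neg_iff_add_eq_0 minus_equation_iff minus_minus)

lemma homo_image_gen:
  assumes f: "homo S f" and S: "sgrp S" and A: "A \<subseteq> S"
  shows "f ` gen A = gen (f ` A)"
proof
  have gA: "gen A \<subseteq> S" by (rule gen_least[OF S A])
  show "f ` gen A \<subseteq> gen (f ` A)"
  proof clarify
    fix x assume "x \<in> gen A"
    then show "f x \<in> gen (f ` A)"
    proof (induct rule: gen.induct)
      case zero show ?case using homo_zero[OF f S] by (simp add: gen.zero)
    next case (add x y) then show ?case using homoD[OF f] gA by (metis gen.add subsetD)
    next case (uminus x) then show ?case using homo_uminus[OF f S] gA by (metis gen.uminus subsetD)
    qed (auto intro: gen.base)
  qed
  show "gen (f ` A) \<subseteq> f ` gen A"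
    by (rule gen_least) (auto intro: sgrp_image[OF f S gA sgrp_gen] gen.base)
qed

lemma nm_add: "nm (m + n) x = nm m x + nm n x"
  by (induct m) (simp_all add: add.assoc)

lemma nm_mult: "nm (m * n) x = nm m (nm n x)"
  by (induct m) (simp_all add: nm_add)

lemma nm_zero [simp]: "nm n 0 = 0"
  by (induct n) simp_all

lemma nm_in: "sgrp S \<Longrightarrow> x \<in> S \<Longrightarrow> nm n x \<in> S"
  by (induct n) (simp_all add: sgrp_mem)

lemma nm_cj: "nm n (cj x y) = cj x (nm n y)"
  by (induct n) (simp_all add: cj_add)

lemma commute_nm: assumes "x + y = y + (x::'a::group_add)" shows "nm n x + y = y + nm n x"
proof (induct n)
  case (Suc n)
  have "nm (Suc n) x + y = x + (y + nm n x)" using Suc by (simp add: add.assoc)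
  also have "\<dots> = (x + y) + nm n x" by (simp add: add.assoc)
  also have "\<dots> = y + nm (Suc n) x" by (simp only: assms nm.simps add.assoc)
  finally show ?case .
qed simp

lemma nm_commute_add: assumes "x + y = y + x" shows "nm n (x + y) = nm n x + nm n y"
proof (induct n)
  case (Suc n)
  have "y + nm n x = nm n x + y" using commute_nm[OF assms] by simp
  then have "y + (nm n x + nm n y) = nm n x + (y + nm n y)" by (metis add.assoc)
  then show ?case using Suc by (simp add: add.assoc)
qed simp

lemma nm_uminus: "nm n (- x) = - nm n x"
proof (induct n)
  case (Suc n)
  have "x + nm n x = nm n x + x" using commute_nm[of x x n] by simp
  then show ?case using Suc by (metis minus_add nm.simps(2))
qed simp

text \<open>Bezout: x is a difference of multiples of \<open>nm m x\<close> and
  \<open>nm n x\<close>. A general \<open>S\<close> also covers orders modulo a subgroup, such as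
  the kernel of an action.\<close>

lemma nm_coprime_mem:
  assumes S: "sgrp S" and m: "nm m x \<in> S" and n: "nm n x \<in> S" and c: "coprime m n"
  shows "x \<in> S"
proof (cases "m = 0")
  case True then show ?thesis using c n by simp
next
  case False
  then obtain a b where "a * m = b * n + gcd m n" using bezout_nat[of m n] by (metis mult.commute)
  then have "a * m = b * n + 1" using c by simp
  then have "nm (a * m) x = nm (b * n) x + x" using nm_add[of "b * n" 1 x] by simp
  then have "nm a (nm m x) = nm b (nm n x) + x" by (simp add: nm_mult)
  then show ?thesis using nm_in[OF S m, of a] nm_in[OF S n, of b] sgrp_add_left[OF S] by metis
qed

lemma nm_coprime_zero: "nm m x = 0 \<Longrightarrow> nm n x = 0 \<Longrightarrow> coprime m n \<Longrightarrow> x = 0"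
  using nm_coprime_mem[of "{0}"] by simp

text \<open>Passage to the record-based groups, from which Lagrange, Sylow and, for abelian
  subgroups, finite products are taken.\<close>

definition mon :: "'a::group_add set \<Rightarrow> 'a monoid" where
  "mon S = \<lparr>carrier = S, monoid.mult = (+), one = 0\<rparr>"

lemma mon_simps [simp]: "carrier (mon S) = S" "monoid.mult (mon S) = (+)" "one (mon S) = 0"
  by (simp_all add: mon_def)

lemma group_mon: "sgrp S \<Longrightarrow> group (mon S)"
  by (rule groupI) (auto simp: sgrp_mem add.assoc intro: left_minus)

lemma inv_mon: "sgrp S \<Longrightarrow> x \<in> S \<Longrightarrow> inv\<^bsub>mon S\<^esub> x = - x"
  using group.inv_equality[OF group_mon, of S "- x" x] by (simp add: sgrp_mem)

lemma pow_mon: "sgrp S \<Longrightarrow> x \<in> S \<Longrightarrow> x [^]\<^bsub>mon S\<^esub> n = nm n x"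
proof (induct n)
  case (Suc n)
  then show ?case
    using commute_nm[of x x n] by (simp add: monoid.nat_pow_Suc[OF group.is_monoid[OF group_mon]])
qed (simp add: nat_pow_def)

lemma subgroup_mon: "sgrp S \<Longrightarrow> subgroup T (mon S) \<longleftrightarrow> T \<subseteq> S \<and> sgrp T"
  by (auto simp: subgroup_def inv_mon sgrp_def subset_iff)

lemma card_subgroup_dvd: "finite S \<Longrightarrow> sgrp S \<Longrightarrow> sgrp T \<Longrightarrow> T \<subseteq> S \<Longrightarrow> card T dvd card S"
  using group.lagrange[OF group_mon, of S T] by (metis dvd_triv_right mon_simps(1) order_def subgroup_mon)

lemma nm_card: "finite S \<Longrightarrow> sgrp S \<Longrightarrow> x \<in> S \<Longrightarrow> nm (card S) x = 0"
  using group.pow_order_eq_1[OF group_mon, of S x] by (simp add: pow_mon order_def)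

lemma card_sgrp_pos: "finite S \<Longrightarrow> sgrp S \<Longrightarrow> card S > 0"
  using card_gt_0_iff sgrp_zero by blast

lemma sylow_set:
  assumes "finite S" "sgrp S" "prime (p::nat)" "p ^ a dvd card S"
  obtains T where "sgrp T" "T \<subseteq> S" "card T = p ^ a"
proof -
  obtain m where m: "card S = p ^ a * m" using assms by blast
  have "sylow_axioms (mon S) p a m" "group (mon S)"
    using assms m by (auto simp: sylow_axioms_def order_def group_mon)
  then have "\<exists>T. subgroup T (mon S) \<and> card T = p ^ a" by (intro sylow.sylow_thm) (simp add: sylow_eq)
  then show ?thesis using that subgroup_mon[OF assms(2)] by blast
qed

lemma cauchy_set:
  assumes "finite S" "sgrp S" "prime (p::nat)" "p dvd card S"
  obtains x where "x \<in> S" "x \<noteq> 0" "nm p x = 0"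
proof -
  obtain T where T: "sgrp T" "T \<subseteq> S" "card T = p ^ 1" using sylow_set[of S p 1] assms by auto
  have "card T > 1" using T(3) prime_gt_1_nat[OF assms(3)] by simp
  then have "\<not> T \<subseteq> {0}" using card_mono[of "{0::'a}" T] by auto
  then obtain x where "x \<in> T" "x \<noteq> 0" by blast
  moreover have "nm p x = 0" using nm_card[of T x] T assms \<open>x \<in> T\<close> finite_subset by auto
  ultimately show ?thesis using that T by blast
qed

lemma card_image_kernel:
  assumes f: "homo S f" and S: "sgrp S" "finite S"
  shows "card S = card (f ` S) * card {x \<in> S. f x = 0}"
proof -
  have fib: "card {x \<in> S. f x = y} = card {x \<in> S. f x = 0}" if "y \<in> f ` S" for y
  proof -
    obtain s where s: "s \<in> S" "y = f s" using \<open>y \<in> f ` S\<close> by blast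
    have "bij_betw ((+) s) {x \<in> S. f x = 0} {x \<in> S. f x = y}"
    proof (rule bij_betwI[where g = "(+) (- s)"])
      show "(+) s \<in> {x \<in> S. f x = 0} \<rightarrow> {x \<in> S. f x = y}" using s f S by (auto simp: homoD sgrp_mem)
      show "(+) (- s) \<in> {x \<in> S. f x = y} \<rightarrow> {x \<in> S. f x = 0}" using s f S by (auto simp: homoD sgrp_mem homo_uminus)
    qed auto
    from bij_betw_same_card[OF this] show ?thesis by simp
  qed
  have "card S = (\<Sum>y\<in>f ` S. card {x \<in> S. f x = y})"
    using sum.image_gen[OF S(2), of "\<lambda>_. 1::nat" f] by simp
  also have "\<dots> = (\<Sum>y\<in>f ` S. card {x \<in> S. f x = 0})" by (rule sum.cong) (auto simp: fib)
  finally show ?thesis by simp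
qed

text \<open>If q and q' have the same commutator with h, then \<open>- q' + q\<close> commutes with
  h; so the map is injective, and Q is finite. In particular every element of Q is a commutator with
  h, a finite analogue of Lang's theorem.\<close>

lemma fixed_point_free_bij:
  assumes Q: "sgrp Q" "finite Q" and h: "\<forall>q\<in>Q. cj h q \<in> Q" and fpf: "\<forall>q\<in>Q. h + q = q + h \<longrightarrow> q = 0"
  shows "bij_betw (\<lambda>q. cm q h) Q Q"
proof -
  have m: "cm q h \<in> Q" if "q \<in> Q" for q using that h Q by (simp add: cm_cj' cj_uminus sgrp_mem)
  have "inj_on (\<lambda>q. cm q h) Q"
  proof (rule inj_onI)
    fix q q' assume q: "q \<in> Q" "q' \<in> Q" and "cm q h = cm q' h"
    then have "q + h + - q = q' + h + - q'" by (simp add: cm_def)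
    then have "- q' + (q + h + - q) + q = - q' + (q' + h + - q') + q" by simp
    then have "(- q' + q) + h = h + (- q' + q)" by (simp add: gsimps)
    then have "- q' + q = 0" using fpf q Q by (simp add: sgrp_mem)
    then have "q' + (- q' + q) = q'" by simp
    then show "q = q'" by simp
  qed
  then show ?thesis using m Q(2) by (simp add: bij_betw_def endo_inj_surj image_subsetI)
qed

section \<open>Quotients and nilpotency\<close>

typedef 'a sym = "{f :: 'a \<Rightarrow> 'a. bij f}"
  by (rule exI[of _ id]) simp

setup_lifting type_definition_sym

instantiation sym :: (type) group_add
begin

lift_definition zero_sym :: "'a sym" is id by simp
lift_definition plus_sym :: "'a sym \<Rightarrow> 'a sym \<Rightarrow> 'a sym" is "(\<circ>)" by (rule bij_comp)
lift_definition uminus_sym :: "'a sym \<Rightarrow> 'a sym" is "inv_into UNIV" by (rule bij_imp_bij_inv)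
definition minus_sym :: "'a sym \<Rightarrow> 'a sym \<Rightarrow> 'a sym" where "minus_sym f g = f + - g"

instance
proof
  fix a b c :: "'a sym"
  show "a + b + c = a + (b + c)" by transfer (simp add: comp_assoc)
  show "0 + a = a" "a + 0 = a" by (transfer, simp)+
  show "- a + a = 0" by transfer (simp add: bij_is_inj)
  show "a + - b = a - b" by (simp add: minus_sym_def)
qed

end

text \<open>X acts by translation on the cosets of M. Off the set \<open>R\<close> of cosets the
  permutation is the identity, which makes it a bijection of the whole type of sets. As M is normal,
  the kernel of this action is exactly M.\<close>

lemma quotient_map:
  fixes X M :: "'a::group_add set"
  assumes X: "sgrp X" and M: "sgrp M" "M \<subseteq> X" "nmz X M"
  obtains \<pi> :: "'a \<Rightarrow> 'a set sym" where "homo X \<pi>" "\<And>x. x \<in> X \<Longrightarrow> \<pi> x = 0 \<longleftrightarrow> x \<in> M"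
proof -
  define R where "R = (\<lambda>y. (+) y ` M) ` X"
  define f where "f x C = (if C \<in> R then (+) x ` C else C)" for x C
  have R: "(+) x ` C \<in> R" if x: "x \<in> X" and C: "C \<in> R" for x C
  proof -
    obtain y where "y \<in> X" "C = (+) y ` M" using C unfolding R_def by blast
    then have "(+) x ` C = (+) (x + y) ` M" by (simp add: image_image add.assoc)
    then show ?thesis using that \<open>y \<in> X\<close> X by (simp add: R_def sgrp_add)
  qed
  have ff: "f x (f y C) = f (x + y) C" if "x \<in> X" "y \<in> X" for x y C
    using R[OF that(2)] that by (auto simp: f_def image_image add.assoc)
  have f0: "f 0 C = C" for C by (simp add: f_def)
  have bij: "bij (f x)" if "x \<in> X" for x
  proof (rule o_bij)
    show "f (- x) \<circ> f x = id" "f x \<circ> f (- x) = id"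
      using that X by (auto simp: fun_eq_iff ff sgrp_mem f0)
  qed
  define \<pi> where "\<pi> x = Abs_sym (f x)" for x
  have rep: "Rep_sym (\<pi> x) = f x" if "x \<in> X" for x
    using bij[OF that] by (simp add: \<pi>_def Abs_sym_inverse)
  have "homo X \<pi>"
    unfolding homo_def
  proof (intro ballI)
    fix x y assume "x \<in> X" "y \<in> X"
    then have "Rep_sym (\<pi> (x + y)) = Rep_sym (\<pi> x + \<pi> y)"
      using X by (auto simp: rep sgrp_add plus_sym.rep_eq ff)
    then show "\<pi> (x + y) = \<pi> x + \<pi> y" by (simp add: Rep_sym_inject)
  qed
  moreover have "\<pi> x = 0 \<longleftrightarrow> x \<in> M" if "x \<in> X" for x
  proof
    assume "\<pi> x = 0"
    then have "f x = id" using rep[OF that] by (simp add: zero_sym.rep_eq)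
    moreover have "M \<in> R" using sgrp_zero[OF X] by (force simp: R_def)
    ultimately have "(+) x ` M = M" by (metis f_def id_apply)
    then have "x + 0 \<in> M" using sgrp_zero[OF M(1)] by blast
    then show "x \<in> M" by simp
  next
    assume x: "x \<in> M"
    have "(+) x ` C = C" if C: "C \<in> R" for C
    proof -
      obtain y where y: "y \<in> X" "C = (+) y ` M" using C unfolding R_def by blast
      have cx: "cj (- y) z \<in> M" if "z \<in> M" for z using that M(3) y(1) X by (simp add: nmzD sgrp_uminus)
      have e: "z + (y + m) = y + (cj (- y) z + m)" for z m by (simp add: cj_def gsimps)
      have "z + (y + m) \<in> C" if "z \<in> M" "m \<in> M" for z m
        using cx[OF that(1)] that M(1) y(2) e by (metis imageI sgrp_add)
      then have 1: "(+) z ` C \<subseteq> C" if "z \<in> M" for z using that y by auto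
      have "C = (+) x ` (+) (- x) ` C" by (simp add: image_image)
      also have "\<dots> \<subseteq> (+) x ` C" using 1[of "- x"] x M(1) by (intro image_mono) (simp add: sgrp_mem)
      finally show ?thesis using 1[OF x] by blast
    qed
    then have "f x = id" by (auto simp: f_def fun_eq_iff)
    then show "\<pi> x = 0" using rep[OF that] by (metis Rep_sym_inject zero_sym.rep_eq)
  qed
  ultimately show thesis by (rule that)
qed

text \<open>A stabiliser contains \<open>E\<close>, so every orbit length divides
  \<open>r ^ k\<close>, and it is 1 only at fixed points. With \<open>E\<close> in the statement,
  the count for an r-group is available for an action that merely factors through one.\<close>

lemma card_non_fixed_dvd:
  fixes act :: "'g::group_add \<Rightarrow> 'b \<Rightarrow> 'b"
  assumes P: "sgrp P" "finite P" and E: "sgrp E" "E \<subseteq> P" and r: "prime (r::nat)"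
    and card: "card P = r ^ k * card E"
    and Om: "finite \<Omega>" "\<And>x b. x \<in> P \<Longrightarrow> b \<in> \<Omega> \<Longrightarrow> act x b \<in> \<Omega>"
    and act: "\<And>x y b. x \<in> P \<Longrightarrow> y \<in> P \<Longrightarrow> b \<in> \<Omega> \<Longrightarrow> act (x + y) b = act x (act y b)"
      "\<And>x b. x \<in> E \<Longrightarrow> b \<in> \<Omega> \<Longrightarrow> act x b = b"
  shows "r dvd card (\<Omega> - {b \<in> \<Omega>. \<forall>x\<in>P. act x b = b})"
proof -
  define orb where "orb b = (\<lambda>x. act x b) ` P" for b
  define Fix where "Fix = {b \<in> \<Omega>. \<forall>x\<in>P. act x b = b}"
  have act0: "act 0 b = b" if "b \<in> \<Omega>" for b using act(2) sgrp_zero[OF E(1)] that by blast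
  have actm: "act (- x) (act x b) = b" "act x (act (- x) b) = b" if "x \<in> P" "b \<in> \<Omega>" for x b
    using act(1)[of "- x" x b] act(1)[of x "- x" b] that act0 P by (auto simp: sgrp_mem)
  have orb_dvd: "r dvd card (orb b)" if b: "b \<in> \<Omega> - Fix" for b
  proof -
    have bO: "b \<in> \<Omega>" using b by blast
    define St where "St = {x \<in> P. act x b = b}"
    have St: "sgrp St"
    proof (rule sgrpI)
      show "0 \<in> St" using act0 bO P by (simp add: St_def sgrp_mem)
      show "x + y \<in> St" if "x \<in> St" "y \<in> St" for x y using that act bO P by (simp add: St_def sgrp_mem)
      show "- x \<in> St" if "x \<in> St" for x using that actm(1)[of x b] bO P by (simp add: St_def sgrp_mem)
    qed
    have fib: "card {x \<in> P. act x b = c} = card St" if c: "c \<in> orb b" for c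
    proof -
      obtain s where s: "s \<in> P" "c = act s b" using c orb_def by auto
      have "bij_betw ((+) s) St {x \<in> P. act x b = c}"
      proof (rule bij_betwI[where g = "(+) (- s)"])
        show "(+) s \<in> St \<rightarrow> {x \<in> P. act x b = c}" using s P act(1) bO by (auto simp: St_def sgrp_mem)
        show "(+) (- s) \<in> {x \<in> P. act x b = c} \<rightarrow> St" using s P act(1) bO actm by (auto simp: St_def sgrp_mem)
      qed auto
      from bij_betw_same_card[OF this] show ?thesis by simp
    qed
    have "card P = (\<Sum>c\<in>orb b. card {x \<in> P. act x b = c})"
      using sum.image_gen[OF P(2), of "\<lambda>_. 1::nat" "\<lambda>x. act x b"] by (simp add: orb_def)
    also have "\<dots> = (\<Sum>c\<in>orb b. card St)" by (rule sum.cong) (auto simp: fib)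
    finally have cP: "card P = card (orb b) * card St" by simp
    have "E \<subseteq> St" using E act bO by (auto simp: St_def)
    moreover have "finite St" using P by (simp add: St_def)
    ultimately obtain s where s: "card St = card E * s" using card_subgroup_dvd[OF _ St E(1)] by blast
    have "card E > 0" using card_sgrp_pos[OF finite_subset[OF E(2) P(2)] E(1)] .
    then have "card (orb b) * s = r ^ k" using cP s card by (simp add: ac_simps)
    then have "card (orb b) dvd r ^ k" by (metis dvd_triv_left)
    then obtain j where j: "card (orb b) = r ^ j" using divides_primepow_nat[OF r] by blast
    have "j \<noteq> 0"
    proof
      assume "j = 0"
      then have "card (orb b) = 1" using j by simp
      then obtain c where c: "orb b = {c}" using card_1_singletonE by blast
      have "b \<in> orb b" using act0[OF bO] sgrp_zero[OF P(1)] by (force simp: orb_def)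
      then have "\<forall>x\<in>P. act x b = b" using c by (auto simp: orb_def)
      then show False using b by (simp add: Fix_def)
    qed
    then show ?thesis using j by simp
  qed
  have U: "\<Union> (orb ` (\<Omega> - Fix)) = \<Omega> - Fix"
  proof
    show "\<Omega> - Fix \<subseteq> \<Union> (orb ` (\<Omega> - Fix))"
      using act0 sgrp_zero[OF P(1)] by (force simp: orb_def)
    show "\<Union> (orb ` (\<Omega> - Fix)) \<subseteq> \<Omega> - Fix"
    proof
      fix c assume "c \<in> \<Union> (orb ` (\<Omega> - Fix))"
      then obtain x b where b: "b \<in> \<Omega>" "b \<notin> Fix" "x \<in> P" "c = act x b" by (auto simp: orb_def)
      have "c \<notin> Fix"
      proof
        assume "c \<in> Fix"
        then have "act (- x) c = c" using b P by (simp add: Fix_def sgrp_mem)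
        then have "b = c" using actm(1)[of x b] b by simp
        then show False using \<open>c \<in> Fix\<close> b by simp
      qed
      then show "c \<in> \<Omega> - Fix" using b Om by simp
    qed
  qed
  have eq: "orb b = orb c" if "b \<in> \<Omega>" and c: "c \<in> orb b" for b c
  proof -
    obtain y where y: "y \<in> P" "c = act y b" using c orb_def by auto
    have "act x c \<in> orb b" if "x \<in> P" for x
      using that y act(1)[of x y b] \<open>b \<in> \<Omega>\<close> P unfolding orb_def by (metis imageI sgrp_add)
    moreover have "act x b \<in> orb c" if "x \<in> P" for x
    proof -
      have xy: "x + - y \<in> P" using that y(1) P by (simp add: sgrp_mem)
      have "act (x + - y + y) b = act (x + - y) c" using act(1)[OF xy y(1) \<open>b \<in> \<Omega>\<close>] y(2) by (simp only:)
      then have "act x b = act (x + - y) c" by (simp only: add.assoc left_minus add.right_neutral)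
      moreover note xy
      ultimately show ?thesis unfolding orb_def by (rule image_eqI)
    qed
    ultimately show ?thesis unfolding orb_def by blast
  qed
  have "r dvd card (\<Union> (orb ` (\<Omega> - Fix)))"
  proof (rule dvd_partition)
    show "finite (\<Union> (orb ` (\<Omega> - Fix)))" unfolding U using Om by simp
    show "\<forall>c\<in>orb ` (\<Omega> - Fix). r dvd card c" using orb_dvd by blast
    show "\<forall>c1\<in>orb ` (\<Omega> - Fix). \<forall>c2\<in>orb ` (\<Omega> - Fix). c1 \<noteq> c2 \<longrightarrow> c1 \<inter> c2 = {}"
    proof (intro ballI impI)
      fix c1 c2 assume "c1 \<in> orb ` (\<Omega> - Fix)" "c2 \<in> orb ` (\<Omega> - Fix)" "c1 \<noteq> c2"
      moreover have "orb b1 = orb b2" if "b1 \<in> \<Omega>" "b2 \<in> \<Omega>" "c \<in> orb b1" "c \<in> orb b2" for b1 b2 c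
        using eq[OF that(1,3)] eq[OF that(2,4)] by simp
      ultimately show "c1 \<inter> c2 = {}" by blast
    qed
  qed
  then show ?thesis unfolding U by (simp add: Fix_def)
qed

section \<open>Nilpotent groups: elements of coprime order and Hall subgroups\<close>

primrec lcs :: "'a::group_add set \<Rightarrow> nat \<Rightarrow> 'a set" where
  "lcs S 0 = S"
| "lcs S (Suc n) = gen {cm x y | x y. x \<in> lcs S n \<and> y \<in> S}"

definition nil :: "'a::group_add set \<Rightarrow> bool" where
  "nil S \<longleftrightarrow> (\<exists>n. lcs S n = {0})"

lemma sgrp_lcs: "sgrp S \<Longrightarrow> sgrp (lcs S n)"
  by (cases n) (simp_all add: sgrp_gen)

lemma cm_lcs: "x \<in> lcs S n \<Longrightarrow> y \<in> S \<Longrightarrow> cm x y \<in> lcs S (Suc n)"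
  by (auto intro: gen.base)

lemma nmz_lcs: "nmz X S \<Longrightarrow> nmz X (lcs S n)"
proof (induct n)
  case (Suc n)
  show ?case
    unfolding lcs.simps by (rule nmz_gen) (use Suc in \<open>fastforce simp: nmz_def cj_distrib_cm\<close>)
qed simp

lemma lcs_Suc_subset: "sgrp S \<Longrightarrow> lcs S (Suc n) \<subseteq> lcs S n"
  unfolding lcs.simps using nmz_lcs[OF nmz_self, of S n]
  by (intro gen_least) (auto simp: sgrp_lcs intro: cm_in_normal')

lemma lcs_antimono: "sgrp S \<Longrightarrow> m \<le> n \<Longrightarrow> lcs S n \<subseteq> lcs S m"
  by (rule lift_Suc_antimono_le[of "lcs S"]) (auto dest: lcs_Suc_subset simp del: lcs.simps)

lemma lcs_subset: "sgrp S \<Longrightarrow> lcs S n \<subseteq> S"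
  using lcs_antimono[of S 0 n] by simp

lemma lcs_mono: "S \<subseteq> T \<Longrightarrow> lcs S n \<subseteq> lcs T n"
proof (induct n)
  case (Suc n)
  then show ?case unfolding lcs.simps by (intro gen_mono) blast
qed simp

lemma homo_lcs: "homo S f \<Longrightarrow> sgrp S \<Longrightarrow> f ` lcs S n = lcs (f ` S) n"
proof (induct n)
  case (Suc n)
  have "f ` {cm x y | x y. x \<in> lcs S n \<and> y \<in> S} = {cm x y | x y. x \<in> f ` lcs S n \<and> y \<in> f ` S}"
    using homo_cm[OF Suc(2,3)] lcs_subset[OF Suc(3), of n] by (auto simp: subset_iff image_iff; metis)
  moreover have "{cm x y | x y. x \<in> lcs S n \<and> y \<in> S} \<subseteq> S"
    using lcs_subset[OF Suc(3), of n] sgrp_cm[OF Suc(3)] by blast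
  ultimately show ?case
    using homo_image_gen[OF Suc(2,3), of "{cm x y | x y. x \<in> lcs S n \<and> y \<in> S}"] Suc by simp
qed simp

lemma nil_subgroup: "nil S \<Longrightarrow> sgrp T \<Longrightarrow> T \<subseteq> S \<Longrightarrow> nil T"
  unfolding nil_def using lcs_mono sgrp_lcs sgrp_zero by (metis subset_singletonD empty_iff)

lemma nil_image: "nil S \<Longrightarrow> homo S f \<Longrightarrow> sgrp S \<Longrightarrow> nil (f ` S)"
  unfolding nil_def by (metis homo_lcs homo_zero image_empty image_insert)

lemma nil_image_iff:
  assumes "homo S f" "sgrp S"
  shows "nil (f ` S) \<longleftrightarrow> (\<exists>n. lcs S n \<subseteq> {x \<in> S. f x = 0})"
proof -
  have "lcs (f ` S) n = {0} \<longleftrightarrow> lcs S n \<subseteq> {x \<in> S. f x = 0}" for n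
    using lcs_subset[OF assms(2), of n] sgrp_zero[OF sgrp_lcs[OF assms(2), of n]] homo_zero[OF assms]
    unfolding homo_lcs[OF assms, symmetric] by (auto simp: image_iff)
  then show ?thesis by (simp add: nil_def)
qed

lemma cm_nm:
  assumes "cm x y + x = x + cm x y" "cm x y + y = y + cm x y"
  shows "cm (nm k x) y = nm k (cm x y)"
proof (induct k)
  case 0 then show ?case by (simp add: cm_def)
next
  case (Suc k)
  have "cm (x + nm k x) y = cj x (cm (nm k x) y) + cm x y" by (simp add: cm_def cj_def gsimps)
  also have "cj x (cm (nm k x) y) = nm k (cm x y)"
    using Suc commute_nm[OF assms(1)] by (simp add: cj_eq_self)
  also have "nm k (cm x y) + cm x y = cm x y + nm k (cm x y)" by (rule commute_nm) simp
  finally show ?case by simp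
qed

text \<open>Descent along the lower central series: modulo the next term [x, y] is central, so by
  \<open>cm_nm\<close> both a and b annihilate it, and coprimality puts it into that term.
  Nilpotency ends the descent at 0.\<close>

lemma nil_coprime_commute:
  assumes S: "sgrp S" "nil S" and x: "x \<in> S" "nm a x = 0" and y: "y \<in> S" "nm b y = 0" and ab: "coprime a b"
  shows "x + y = y + x"
proof -
  have "cm x y \<in> lcs S n" for n
  proof (induct n)
    case 0 then show ?case using x y S by (simp add: sgrp_cm)
  next
    case (Suc n)
    obtain \<pi> :: "'a \<Rightarrow> 'a set sym" where pi: "homo S \<pi>" "\<And>x. x \<in> S \<Longrightarrow> \<pi> x = 0 \<longleftrightarrow> x \<in> lcs S (Suc n)"
      using quotient_map[of S "lcs S (Suc n)"] S nmz_lcs[OF nmz_self[OF S(1)]] sgrp_lcs lcs_subset by metis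
    let ?c = "cm x y"
    have c: "?c \<in> S" using x y S by (simp add: sgrp_cm)
    have com: "cm (\<pi> x) (\<pi> y) + \<pi> z = \<pi> z + cm (\<pi> x) (\<pi> y)" if "z \<in> S" for z
    proof -
      have "\<pi> (cm ?c z) = 0" using pi(2)[of "cm ?c z"] cm_lcs[OF Suc that] S c that sgrp_cm by blast
      then show ?thesis using homo_cm[OF pi(1) S(1)] c that x y by (simp add: cm_eq_zero[symmetric])
    qed
    have "nm a (cm (\<pi> x) (\<pi> y)) = cm (nm a (\<pi> x)) (\<pi> y)" using cm_nm com x y by metis
    also have "nm a (\<pi> x) = 0" using homo_nm[OF pi(1) S(1) x(1), of a] homo_zero[OF pi(1) S(1)] x by simp
    finally have 1: "nm a (cm (\<pi> x) (\<pi> y)) = 0" by (simp add: cm_def)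
    have "cm (\<pi> y) (\<pi> x) + \<pi> z = \<pi> z + cm (\<pi> y) (\<pi> x)" if "z \<in> S" for z
      using com[OF that] cj_uminus[of "\<pi> z" "cm (\<pi> x) (\<pi> y)"] cj_eq_self[of "\<pi> z"] by (metis cm_uminus)
    then have "nm b (cm (\<pi> y) (\<pi> x)) = cm (nm b (\<pi> y)) (\<pi> x)" using cm_nm x y by metis
    also have "nm b (\<pi> y) = 0" using homo_nm[OF pi(1) S(1) y(1), of b] homo_zero[OF pi(1) S(1)] y by simp
    finally have "nm b (- cm (\<pi> x) (\<pi> y)) = 0" by (simp add: cm_def gsimps)
    then have "nm b (cm (\<pi> x) (\<pi> y)) = 0" by (simp add: nm_uminus)
    from nm_coprime_zero[OF 1 this ab] have "\<pi> ?c = 0" using homo_cm[OF pi(1) S(1)] x y by simp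
    then show ?case using pi(2)[OF c] by blast
  qed
  moreover obtain n where "lcs S n = {0}" using S by (auto simp: nil_def)
  ultimately have "cm x y = 0" by blast
  then show ?thesis by (simp add: cm_eq_zero)
qed

definition splus :: "'a::group_add set \<Rightarrow> 'a set \<Rightarrow> 'a set" where
  "splus A B = {a + b | a b. a \<in> A \<and> b \<in> B}"

lemma sgrp_splus: assumes "sgrp A" "sgrp B" "nmz A B" shows "sgrp (splus A B)"
proof (rule sgrpI)
  show "0 \<in> splus A B" using assms by (force simp: splus_def dest: sgrp_zero)
  fix x assume "x \<in> splus A B"
  then obtain a b where x: "x = a + b" "a \<in> A" "b \<in> B" by (auto simp: splus_def)
  have "- x = - a + cj a (- b)" using x by (simp add: cj_def gsimps)
  moreover have "cj a (- b) \<in> B" using x assms by (simp add: sgrp_mem nmzD)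
  ultimately show "- x \<in> splus A B" using x assms unfolding splus_def by (blast intro: sgrp_uminus)
  fix y assume "y \<in> splus A B"
  then obtain c d where y: "y = c + d" "c \<in> A" "d \<in> B" by (auto simp: splus_def)
  have "x + y = (a + c) + (cj (- c) b + d)" using x y by (simp add: cj_def gsimps)
  moreover have "cj (- c) b + d \<in> B" using x y assms by (simp add: nmzD sgrp_mem)
  ultimately show "x + y \<in> splus A B" using x y assms unfolding splus_def by (blast intro: sgrp_add)
qed

lemma nmz_splus: "nmz X A \<Longrightarrow> nmz X B \<Longrightarrow> nmz X (splus A B)"
  unfolding nmz_def splus_def by (force simp: cj_add)

lemma splus_left: "sgrp B \<Longrightarrow> A \<subseteq> splus A B" and splus_right: "sgrp A \<Longrightarrow> B \<subseteq> splus A B"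
  unfolding splus_def by (force dest: sgrp_zero)+

lemma splus_subset: "sgrp S \<Longrightarrow> A \<subseteq> S \<Longrightarrow> B \<subseteq> S \<Longrightarrow> splus A B \<subseteq> S"
  by (auto simp: splus_def subset_iff sgrp_add)

lemma card_splus_coprime:
  assumes A: "sgrp A" "finite A" and B: "sgrp B" "finite B" and c: "coprime (card A) (card B)"
  shows "card (splus A B) = card A * card B"
proof -
  have z: "x = 0" if "x \<in> A" "x \<in> B" for x
    using nm_coprime_zero[OF nm_card[OF A(2,1) that(1)] nm_card[OF B(2,1) that(2)] c] .
  have "inj_on (\<lambda>(a, b). a + b) (A \<times> B)"
  proof (rule inj_onI, clarify)
    fix a b a' b' assume ab: "a \<in> A" "b \<in> B" "a' \<in> A" "b' \<in> B" and "a + b = a' + b'"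
    then have "- a' + (a + b) + - b = - a' + (a' + b') + - b" by simp
    then have e: "- a' + a = b' + - b" by (simp add: gsimps)
    then have "- a' + a = 0" using z ab A B by (metis sgrp_add sgrp_uminus)
    then have "a' + (- a' + a) = a'" "b' + - b + b = b" using e by simp_all
    then show "a = a' \<and> b = b'" by (simp add: add.assoc)
  qed
  moreover have "splus A B = (\<lambda>(a, b). a + b) ` (A \<times> B)" by (auto simp: splus_def)
  ultimately show ?thesis using A B by (simp add: card_image card_cartesian_product)
qed

text \<open>Subgroups of coprime orders commute elementwise, so one Sylow subgroup after the other
  can be added and the sum remains a subgroup.\<close>

lemma nil_hall_set:
  assumes S: "sgrp S" "finite S" "nil S" and "finite \<pi>" "\<And>p. p \<in> \<pi> \<Longrightarrow> prime (p::nat)"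
  shows "\<exists>Q. sgrp Q \<and> Q \<subseteq> S \<and> card Q = (\<Prod>p\<in>\<pi>. p ^ multiplicity p (card S))"
  using assms(4,5)
proof (induct rule: finite_induct)
  case empty
  have "sgrp {0::'a}" "{0} \<subseteq> S" using S by (auto simp: sgrp_mem)
  then show ?case by force
next
  case (insert p \<pi>)
  then obtain Q where Q: "sgrp Q" "Q \<subseteq> S" "card Q = (\<Prod>p\<in>\<pi>. p ^ multiplicity p (card S))" by auto
  obtain P where P: "sgrp P" "P \<subseteq> S" "card P = p ^ multiplicity p (card S)"
    by (rule sylow_set[OF S(2,1), of p "multiplicity p (card S)"]) (use insert multiplicity_dvd in auto)
  have fin: "finite P" "finite Q" using P Q S finite_subset by auto
  have cop: "coprime (card P) (card Q)"
    unfolding P(3) Q(3) using insert by (intro prod_coprime_right) (auto intro!: primes_coprime)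
  have "nmz P Q"
    unfolding nmz_def
  proof (intro ballI)
    fix x q assume "x \<in> P" "q \<in> Q"
    then have "x + q = q + x"
      using nil_coprime_commute[OF S(1,3), of x "card P" q "card Q"] P Q fin cop nm_card by blast
    then show "cj x q \<in> Q" using \<open>q \<in> Q\<close> cj_eq_self[of x q] by simp
  qed
  then have "sgrp (splus P Q)" using P Q by (simp add: sgrp_splus)
  moreover have "splus P Q \<subseteq> S" using splus_subset P Q S by metis
  moreover have "card (splus P Q) = (\<Prod>p\<in>insert p \<pi>. p ^ multiplicity p (card S))"
    using card_splus_coprime[OF P(1) fin(1) Q(1) fin(2) cop] P Q insert by simp
  ultimately show ?case by blast
qed

text \<open>Q is the r'-part and P the r-part. Describing both by torsion makes them invariant under
  everything that normalises S, by \<open>nmz_torsion\<close>.\<close>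

lemma nil_hall:
  assumes S: "sgrp S" "finite S" "nil S" and r: "prime (r::nat)"
  obtains Q P k where "sgrp Q" "Q \<subseteq> S" "sgrp P" "P \<subseteq> S" "card P = r ^ k" "coprime r (card Q)"
    "card S = r ^ k * card Q" "Q = {x \<in> S. nm (card Q) x = 0}" "P = {x \<in> S. nm (r ^ k) x = 0}" "S = splus Q P"
proof -
  let ?m = "\<lambda>p. p ^ multiplicity p (card S)"
  have pos: "card S > 0" using card_sgrp_pos S by blast
  obtain Q where Q: "sgrp Q" "Q \<subseteq> S" "card Q = (\<Prod>p\<in>prime_factors (card S) - {r}. ?m p)"
    using nil_hall_set[OF S, of "prime_factors (card S) - {r}"] by auto
  obtain P where P: "sgrp P" "P \<subseteq> S" "card P = ?m r"
    by (rule sylow_set[OF S(2,1) r, of "multiplicity r (card S)"]) (auto simp: multiplicity_dvd)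
  have fin: "finite P" "finite Q" using P Q S finite_subset by auto
  have copr: "coprime r (card Q)"
    unfolding Q(3) using r by (intro prod_coprime_right) (auto intro!: primes_coprime)
  then have cop: "coprime (card Q) (card P)" unfolding P(3) by (simp add: coprime_commute)
  have cS: "card S = ?m r * card Q"
  proof (cases "r \<in> prime_factors (card S)")
    case True
    then show ?thesis using prime_factorization_nat[of "card S"] pos
      by (simp add: Q(3) prod.remove[OF _ True])
  next
    case False
    then have "multiplicity r (card S) = 0" using r pos by (simp add: prime_factors_multiplicity)
    then show ?thesis using prime_factorization_nat[of "card S"] pos False by (simp add: Q(3))
  qed
  have com: "q + p = p + q" if "q \<in> Q" "p \<in> P" for p q
    using nil_coprime_commute[OF S(1,3), of q "card Q" p "card P"] P Q fin cop nm_card that by blast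
  have sp: "splus Q P = S"
  proof (rule card_subset_eq[OF S(2)])
    show "splus Q P \<subseteq> S" using splus_subset P Q S by metis
    show "card (splus Q P) = card S"
      using card_splus_coprime[OF Q(1) fin(2) P(1) fin(1) cop] cS P(3) by (simp add: mult.commute)
  qed
  have Qeq: "Q = {x \<in> S. nm (card Q) x = 0}"
  proof
    show "Q \<subseteq> {x \<in> S. nm (card Q) x = 0}" using nm_card fin Q by blast
    show "{x \<in> S. nm (card Q) x = 0} \<subseteq> Q"
    proof clarify
      fix x assume "x \<in> S" and 0: "nm (card Q) x = 0"
      then obtain q p where x: "x = q + p" "q \<in> Q" "p \<in> P" using sp by (auto simp: splus_def)
      have "nm (card Q) p = 0"
        using 0 nm_commute_add[OF com[OF x(2,3)], of "card Q"] nm_card[OF fin(2) Q(1) x(2)] x by simp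
      then have "p = 0" using nm_coprime_zero[OF _ nm_card[OF fin(1) P(1) x(3)] cop] by blast
      then show "x \<in> Q" using x by simp
    qed
  qed
  have Peq: "P = {x \<in> S. nm (card P) x = 0}"
  proof
    show "P \<subseteq> {x \<in> S. nm (card P) x = 0}" using nm_card fin P by blast
    show "{x \<in> S. nm (card P) x = 0} \<subseteq> P"
    proof clarify
      fix x assume "x \<in> S" and 0: "nm (card P) x = 0"
      then obtain q p where x: "x = q + p" "q \<in> Q" "p \<in> P" using sp by (auto simp: splus_def)
      have "nm (card P) q = 0"
        using 0 nm_commute_add[OF com[OF x(2,3)], of "card P"] nm_card[OF fin(1) P(1) x(3)] x by simp
      then have "q = 0" using nm_coprime_zero[OF nm_card[OF fin(2) Q(1) x(2)] _ cop] by blast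
      then show "x \<in> P" using x by simp
    qed
  qed
  show thesis by (rule that[OF Q(1,2) P copr cS Qeq Peq[unfolded P(3)] sp[symmetric]])
qed

section \<open>Chief factors and the Fitting subgroup\<close>

definition chief :: "'a::group_add set \<Rightarrow> 'a set \<Rightarrow> 'a set \<Rightarrow> bool" where
  "chief X M N \<longleftrightarrow> sgrp M \<and> sgrp N \<and> M \<subset> N \<and> nmz X M \<and> nmz X N \<and>
     (\<forall>K. sgrp K \<and> nmz X K \<and> M \<subseteq> K \<and> K \<subseteq> N \<longrightarrow> K = M \<or> K = N)"

text \<open>The chief factors are those of the ambient X, which also contains H, so for normal G the
  set is X-invariant. With X = G it is the preimage of the Fitting subgroup of G/T.\<close>

definition cen :: "'a::group_add set \<Rightarrow> 'a set \<Rightarrow> 'a set \<Rightarrow> 'a set" where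
  "cen X G T = {y \<in> G. \<forall>M N. chief X M N \<and> T \<subseteq> M \<and> N \<subseteq> G \<longrightarrow> (\<forall>z\<in>N. cm y z \<in> M)}"

definition Fit :: "'a::group_add set \<Rightarrow> 'a set" where
  "Fit S = gen (\<Union>{N. sgrp N \<and> N \<subseteq> S \<and> nmz S N \<and> nil N})"

text \<open>M is chosen maximal, so the factor found is at the top of N; this suits inductions that
  descend on N.\<close>

lemma exists_chief:
  assumes "finite N" "sgrp N" "nmz X N" "sgrp T" "nmz X T" "T \<subset> N"
  obtains M where "T \<subseteq> M" "chief X M N"
proof -
  let ?A = "{M. sgrp M \<and> nmz X M \<and> T \<subseteq> M \<and> M \<subset> N}"
  have "finite ?A" by (rule finite_subset[of _ "Pow N"]) (use assms in auto)
  moreover have "T \<in> ?A" using assms by blast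
  ultimately obtain M where M: "M \<in> ?A" "\<And>K. K \<in> ?A \<Longrightarrow> M \<subseteq> K \<Longrightarrow> M = K"
    using finite_has_maximal2[of ?A T] by auto
  have "K = M \<or> K = N" if "sgrp K" "nmz X K" "M \<subseteq> K" "K \<subseteq> N" for K
    using M(2)[of K] M(1) that by blast
  then have "chief X M N" using M(1) assms by (auto simp: chief_def)
  then show thesis using that M by blast
qed

lemma cm_add_left: "cm (x + y) z = cj x (cm y z) + cm x z"
  and cm_add_right: "cm x (y + z) = cm x y + cj y (cm x z)"
  and cm_uminus_left: "cm (- x) z = - cj (- x) (cm x z)"
  by (simp_all add: cm_def cj_def gsimps)

lemma chiefD:
  assumes "chief X M N"
  shows "sgrp M" "sgrp N" "M \<subset> N" "M \<subseteq> N" "nmz X M" "nmz X N"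
    "\<And>K. sgrp K \<Longrightarrow> nmz X K \<Longrightarrow> M \<subseteq> K \<Longrightarrow> K \<subseteq> N \<Longrightarrow> K = M \<or> K = N"
  using assms by (auto simp: chief_def)

lemma chiefI:
  "sgrp M \<Longrightarrow> sgrp N \<Longrightarrow> M \<subset> N \<Longrightarrow> nmz X M \<Longrightarrow> nmz X N \<Longrightarrow>
    (\<And>K. sgrp K \<Longrightarrow> nmz X K \<Longrightarrow> M \<subseteq> K \<Longrightarrow> K \<subseteq> N \<Longrightarrow> K = M \<or> K = N) \<Longrightarrow> chief X M N"
  by (simp add: chief_def)

lemma cenD: "y \<in> cen X G T \<Longrightarrow> chief X M N \<Longrightarrow> T \<subseteq> M \<Longrightarrow> N \<subseteq> G \<Longrightarrow> z \<in> N \<Longrightarrow> cm y z \<in> M"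
  by (auto simp: cen_def)

lemma cenI: "y \<in> G \<Longrightarrow> (\<And>M N z. chief X M N \<Longrightarrow> T \<subseteq> M \<Longrightarrow> N \<subseteq> G \<Longrightarrow> z \<in> N \<Longrightarrow> cm y z \<in> M) \<Longrightarrow> y \<in> cen X G T"
  by (auto simp: cen_def)

lemma cen_subset: "cen X G T \<subseteq> G"
  by (auto simp: cen_def)

lemma sgrp_cen: assumes G: "sgrp G" "G \<subseteq> X" shows "sgrp (cen X G T)"
proof (rule sgrpI)
  show "0 \<in> cen X G T" using G by (auto intro!: cenI dest: chiefD simp: sgrp_zero cm_def)
  show "x + y \<in> cen X G T" if x: "x \<in> cen X G T" and y: "y \<in> cen X G T" for x y
  proof (rule cenI)
    have xy: "x \<in> G" "y \<in> G" using x y cen_subset by blast+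
    then show "x + y \<in> G" using G by (simp add: sgrp_add)
    fix M N z assume c: "chief X M N" "T \<subseteq> M" "N \<subseteq> G" "z \<in> N"
    have "cj x (cm y z) \<in> M" using nmzD[OF chiefD(5)[OF c(1)]] cenD[OF y c] xy G by blast
    then show "cm (x + y) z \<in> M" using cenD[OF x c] chiefD(1)[OF c(1)] by (simp add: cm_add_left sgrp_add)
  qed
  show "- x \<in> cen X G T" if x: "x \<in> cen X G T" for x
  proof (rule cenI)
    have xG: "x \<in> G" using x cen_subset by blast
    then show xG': "- x \<in> G" using G by (simp add: sgrp_uminus)
    fix M N z assume c: "chief X M N" "T \<subseteq> M" "N \<subseteq> G" "z \<in> N"
    have "cj (- x) (cm x z) \<in> M" using nmzD[OF chiefD(5)[OF c(1)]] cenD[OF x c] xG' G by blast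
    then show "cm (- x) z \<in> M" using chiefD(1)[OF c(1)] by (simp add: cm_uminus_left sgrp_uminus)
  qed
qed

lemma nmz_cen: assumes "sgrp X" "nmz X G" shows "nmz X (cen X G T)"
  unfolding nmz_def
proof (intro ballI)
  fix x y assume x: "x \<in> X" and y: "y \<in> cen X G T"
  have "cm (cj x y) z \<in> M" if c: "chief X M N" "T \<subseteq> M" "N \<subseteq> G" and z: "z \<in> N" for M N z
  proof -
    have "cj (- x) z \<in> N" using nmzD[OF chiefD(6)[OF c(1)]] z x assms by (simp add: sgrp_uminus)
    then have "cm y (cj (- x) z) \<in> M" using cenD[OF y c] by blast
    then have "cj x (cm y (cj (- x) z)) \<in> M" using nmzD[OF chiefD(5)[OF c(1)] x] by blast
    then show ?thesis by (simp add: cj_distrib_cm)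
  qed
  moreover have "cj x y \<in> G" using nmzD[OF assms(2) x] y cen_subset by blast
  ultimately show "cj x y \<in> cen X G T" by (rule cenI[rotated])
qed

text \<open>If a term of the lower central series lies in N, the next one lies in M for a chief
  factor N/M, because \<open>cen X G T\<close> centralises it. The order of N drops until T is
  reached; thus \<open>cen X G T\<close> is nilpotent modulo T.\<close>

lemma lcs_cen_descend:
  assumes G: "sgrp G" "finite G" "G \<subseteq> X" and T: "sgrp T" "nmz X T"
  shows "sgrp N \<Longrightarrow> nmz X N \<Longrightarrow> T \<subseteq> N \<Longrightarrow> N \<subseteq> G \<Longrightarrow> lcs (cen X G T) i \<subseteq> N \<Longrightarrow> \<exists>j. lcs (cen X G T) j \<subseteq> T"
proof (induct "card N" arbitrary: N i rule: less_induct)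
  case less
  note N = less.prems
  show ?case
  proof (cases "N = T")
    case False
    have fin: "finite N" using finite_subset[OF N(4) G(2)] .
    obtain M where M: "T \<subseteq> M" "chief X M N" using exists_chief[OF fin N(1,2) T] N(3) False by blast
    have "cm x y \<in> M" if "x \<in> lcs (cen X G T) i" "y \<in> cen X G T" for x y
      using cenD[OF that(2) M(2,1) N(4)] N(5) that(1) sgrp_uminus[OF chiefD(1)[OF M(2)]] cm_uminus[of y x]
      by (metis subsetD)
    then have "lcs (cen X G T) (Suc i) \<subseteq> M"
      unfolding lcs.simps by (intro gen_least[OF chiefD(1)[OF M(2)]]) blast
    then show ?thesis
      using less.hyps[OF psubset_card_mono[OF fin chiefD(3)[OF M(2)]] chiefD(1,5)[OF M(2)] M(1)]
        chiefD(4)[OF M(2)] N(4) by blast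
  qed (use N in blast)
qed

lemma lcs_cen:
  assumes "sgrp G" "finite G" "G \<subseteq> X" "nmz X G" "sgrp T" "nmz X T" "T \<subseteq> G"
  shows "\<exists>j. lcs (cen X G T) j \<subseteq> T"
  by (rule lcs_cen_descend[OF assms(1-3,5,6) assms(1,4,7) order_refl, of 0])
     (auto simp: cen_def)

text \<open>Let K be normal and nilpotent. If K meets N inside M, then [K, N] lies in this
  intersection. Otherwise the last term of the lower central series of K that meets N outside M
  covers N/M by irreducibility, and commutation with K sends it into the next term, hence into
  M.\<close>

lemma Fit_subset_cen:
  assumes S: "sgrp S"
  shows "Fit S \<subseteq> cen S S {0}"
  unfolding Fit_def
proof (rule gen_least[OF sgrp_cen[OF S order_refl]], clarify)
  fix K x assume K: "sgrp K" "K \<subseteq> S" "nmz S K" "nil K" and x: "x \<in> K"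
  have "cm x z \<in> M" if c: "chief S M N" and NS: "N \<subseteq> S" and z: "z \<in> N" for M N z
  proof (cases "K \<inter> N \<subseteq> M")
    case True
    have M: "sgrp N" "nmz S N" using c by (auto simp: chief_def)
    have "cm x z \<in> N" using cm_in_normal[OF M _ z] x K by blast
    moreover have "cm x z \<in> K" using cm_in_normal'[OF K(1,3) _ x] NS z by blast
    ultimately show ?thesis using True by blast
  next
    case False
    have M: "sgrp M" "nmz S M" "sgrp N" "nmz S N" "M \<subset> N" using c by (auto simp: chief_def)
    obtain n where n: "lcs K n = {0}" using K by (auto simp: nil_def)
    have "lcs K n \<inter> N \<subseteq> M" using n sgrp_zero[OF M(1)] by auto
    moreover have "\<not> lcs K 0 \<inter> N \<subseteq> M" using False by simp
    ultimately obtain j where j: "\<not> lcs K j \<inter> N \<subseteq> M" "lcs K (Suc j) \<inter> N \<subseteq> M"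
      using nat_induct[of "\<lambda>j. \<not> lcs K j \<inter> N \<subseteq> M" n] by blast
    let ?D = "splus (lcs K j \<inter> N) M"
    have nD: "nmz S (lcs K j \<inter> N)" using nmz_lcs[OF K(3)] M(4) by (rule nmz_Int)
    have KS: "lcs K j \<subseteq> S" using lcs_subset[OF K(1)] K(2) by blast
    have sI: "sgrp (lcs K j \<inter> N)" by (rule sgrp_Int[OF sgrp_lcs[OF K(1)] M(3)])
    have sD: "sgrp ?D" by (rule sgrp_splus[OF sI M(1)]) (use KS in \<open>auto intro: nmz_mono[OF M(2)]\<close>)
    have "M \<subseteq> ?D" by (rule splus_right[OF sI])
    moreover have "?D \<subseteq> N" using M by (intro splus_subset) auto
    ultimately have "?D = M \<or> ?D = N"
      using c sD nmz_splus[OF nD M(2)] unfolding chief_def by blast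
    moreover have "?D \<noteq> M" using splus_left[OF M(1), of "lcs K j \<inter> N"] j(1) by blast
    ultimately have "z \<in> ?D" using z by blast
    then obtain d m where d: "z = d + m" "d \<in> lcs K j" "d \<in> N" "m \<in> M" by (auto simp: splus_def)
    have "cm d x \<in> N" using cm_in_normal'[OF M(3,4) _ d(3)] x K by blast
    then have "cm d x \<in> M" using cm_lcs[OF d(2) x] j(2) by blast
    then have "cm x d \<in> M" using sgrp_uminus[OF M(1)] cm_uminus by metis
    moreover have "cj d (cm x m) \<in> M" 
      by (rule nmzD[OF M(2)], use d KS in blast, rule cm_in_normal[OF M(1,2)]) (use x K d in blast)+
    ultimately show ?thesis using d(1) M(1) by (simp add: cm_add_right sgrp_add)
  qed
  then show "x \<in> cen S S {0}" using x K by (auto simp: cen_def)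
qed

lemma nil_cen: "sgrp S \<Longrightarrow> finite S \<Longrightarrow> nil (cen S S {0})"
proof -
  assume S: "sgrp S" "finite S"
  then obtain j where "lcs (cen S S {0}) j \<subseteq> {0}"
    using lcs_cen[of S S "{0}"] nmz_self[of S] sgrp_zero[of S] by auto
  then show ?thesis using sgrp_zero[OF sgrp_lcs[OF sgrp_cen[OF S(1) order_refl]]] unfolding nil_def by blast
qed

lemma nil_normal_subset_Fit: "sgrp N \<Longrightarrow> N \<subseteq> S \<Longrightarrow> nmz S N \<Longrightarrow> nil N \<Longrightarrow> N \<subseteq> Fit S"
  unfolding Fit_def by (auto intro: gen.base)

lemma Fit_eq_cen:
  assumes "sgrp S" "finite S"
  shows "Fit S = cen S S {0}"
  using Fit_subset_cen[OF assms(1)]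
    nil_normal_subset_Fit[OF sgrp_cen[OF assms(1) order_refl] cen_subset
      nmz_cen[OF assms(1) nmz_self[OF assms(1)]] nil_cen[OF assms]]
  by (rule subset_antisym)

lemma Fit_props:
  assumes "sgrp S" "finite S"
  shows "sgrp (Fit S)" "Fit S \<subseteq> S" "nil (Fit S)"
  unfolding Fit_eq_cen[OF assms] using sgrp_cen[OF assms(1) order_refl] nil_cen[OF assms] cen_subset by blast+

lemma nmz_Fit:
  assumes X: "sgrp X" and G: "nmz X G"
  shows "nmz X (Fit G)"
  unfolding Fit_def
proof (rule nmz_gen, unfold nmz_def[of X], intro ballI)
  fix x s assume x: "x \<in> X" and "s \<in> \<Union>{N. sgrp N \<and> N \<subseteq> G \<and> nmz G N \<and> nil N}"
  then obtain N where N: "s \<in> N" "sgrp N" "N \<subseteq> G" "nmz G N" "nil N" by blast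
  have "nmz G (cj x ` N)"
    unfolding nmz_def
  proof clarify
    fix g n assume g: "g \<in> G" "n \<in> N"
    have "cj (cj (- x) g) n \<in> N" using N g G x X by (auto simp: nmzD sgrp_uminus)
    then have "cj x (cj (cj (- x) g) n) \<in> cj x ` N" by blast
    then show "cj g (cj x n) \<in> cj x ` N" by (simp add: cj_cj cj_def gsimps)
  qed
  moreover have "sgrp (cj x ` N)" by (rule sgrp_image[OF homo_cjfun N(2) order_refl N(2)])
  moreover have "cj x ` N \<subseteq> G" using N G x by (auto simp: nmzD)
  moreover have "nil (cj x ` N)" by (rule nil_image[OF N(5) homo_cjfun N(2)])
  ultimately show "cj x s \<in> \<Union>{N. sgrp N \<and> N \<subseteq> G \<and> nmz G N \<and> nil N}" using N by blast
qed

lemma chief_image: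
  assumes f: "homo X f" and X: "sgrp X" and c: "chief X M N" and N: "N \<subseteq> X"
    and ker: "\<And>x. x \<in> X \<Longrightarrow> f x = 0 \<Longrightarrow> x \<in> M"
  shows "chief (f ` X) (f ` M) (f ` N)"
proof -
  have M: "sgrp M" "nmz X M" "sgrp N" "nmz X N" "M \<subset> N" "M \<subseteq> X" using c N by (auto simp: chief_def)
  have pre: "x \<in> M" if "x \<in> X" "f x \<in> f ` M" for x
  proof -
    obtain m where m: "m \<in> M" "f x = f m" using \<open>f x \<in> f ` M\<close> by blast
    then have "f (- m + x) = 0" using homo_eq_iff[OF f X, of m x] that M by auto
    then have "- m + x \<in> M" using ker that m M X by (auto simp: sgrp_mem subset_iff)
    then show ?thesis using sgrp_add_left[OF M(1), of "- m" x] m M(1) by (simp add: sgrp_uminus)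
  qed
  have "K = f ` M \<or> K = f ` N" if K: "sgrp K" "nmz (f ` X) K" "f ` M \<subseteq> K" "K \<subseteq> f ` N" for K
  proof -
    let ?K = "{x \<in> N. f x \<in> K}"
    have "sgrp ?K" by (rule sgrp_vimage[OF homo_mono[OF f N] M(3) K(1)])
    moreover have "nmz X ?K" by (rule nmz_vimage[OF f X N order_refl M(4) K(2)])
    moreover have "M \<subseteq> ?K" using M K by auto
    ultimately have "?K = M \<or> ?K = N" using c unfolding chief_def by blast
    moreover have "f ` ?K = K" using K by auto
    ultimately show ?thesis by metis
  qed
  moreover have "f ` M \<subset> f ` N" using M pre N by blast
  moreover have "sgrp (f ` M)" "sgrp (f ` N)" "nmz (f ` X) (f ` M)" "nmz (f ` X) (f ` N)"
    using sgrp_image[OF f X] nmz_image[OF f X _ order_refl] M N by auto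
  ultimately show ?thesis by (intro chiefI)
qed

lemma chief_vimage:
  assumes f: "homo X f" and X: "sgrp X" and G: "sgrp G" "G \<subseteq> X" "nmz X G" and c: "chief (f ` X) M N"
    and N: "N \<subseteq> f ` G" and ker: "\<And>x. x \<in> X \<Longrightarrow> f x = 0 \<Longrightarrow> x \<in> G"
  shows "chief X {x \<in> G. f x \<in> M} {x \<in> G. f x \<in> N}"
proof -
  have M: "sgrp M" "nmz (f ` X) M" "sgrp N" "nmz (f ` X) N" "M \<subset> N" using c by (auto simp: chief_def)
  have "K = {x \<in> G. f x \<in> M} \<or> K = {x \<in> G. f x \<in> N}"
    if K: "sgrp K" "nmz X K" "{x \<in> G. f x \<in> M} \<subseteq> K" "K \<subseteq> {x \<in> G. f x \<in> N}" for K
  proof -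
    have KX: "K \<subseteq> X" using K G by auto
    have "M \<subseteq> f ` K" using K(3) M(5) N by blast
    moreover have "f ` K \<subseteq> N" using K by auto
    moreover have "sgrp (f ` K)" by (rule sgrp_image[OF f X KX K(1)])
    moreover have "nmz (f ` X) (f ` K)" by (rule nmz_image[OF f X KX order_refl K(2)])
    ultimately have "f ` K = M \<or> f ` K = N" using c unfolding chief_def by blast
    moreover have "x \<in> K" if "x \<in> G" "f x \<in> f ` K" for x
    proof -
      obtain k where k: "k \<in> K" "f x = f k" using \<open>f x \<in> f ` K\<close> by blast
      then have "f (- k + x) = 0" using homo_eq_iff[OF f X, of k x] that KX G by auto
      moreover have "- k + x \<in> G" using k K(4) that G(1) by (auto simp: sgrp_mem subset_iff)
      ultimately have "- k + x \<in> K" using K(3) sgrp_zero[OF M(1)] by auto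
      then show ?thesis using sgrp_add_left[OF K(1), of "- k" x] k K(1) by (simp add: sgrp_uminus)
    qed
    ultimately show ?thesis using K(4) by blast
  qed
  moreover have "{x \<in> G. f x \<in> M} \<subset> {x \<in> G. f x \<in> N}" using M(5) N by blast
  moreover have "sgrp {x \<in> G. f x \<in> M}" "sgrp {x \<in> G. f x \<in> N}"
    using sgrp_vimage[OF homo_mono[OF f G(2)] G(1)] M by auto
  moreover have "nmz X {x \<in> G. f x \<in> M}" "nmz X {x \<in> G. f x \<in> N}"
    using nmz_vimage[OF f X G(2) order_refl G(3)] M by auto
  ultimately show ?thesis by (intro chiefI)
qed

text \<open>Chief factors above the kernel T correspond to the chief factors of the image, so
  centralising them is the same condition on both sides.\<close>

lemma cen_image:
  assumes f: "homo X f" and X: "sgrp X" and G: "sgrp G" "G \<subseteq> X" "nmz X G"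
    and T: "T \<subseteq> G" and ker: "\<And>x. x \<in> X \<Longrightarrow> f x = 0 \<longleftrightarrow> x \<in> T" and x: "x \<in> G"
  shows "x \<in> cen X G T \<longleftrightarrow> f x \<in> cen (f ` X) (f ` G) {0}"
proof
  assume L: "x \<in> cen X G T"
  have "cm (f x) z \<in> M" if c: "chief (f ` X) M N" "N \<subseteq> f ` G" "z \<in> N" for M N z
  proof -
    have "f t \<in> M" if "t \<in> T" for t
      using ker[of t] that T G(2) sgrp_zero[OF chiefD(1)[OF c(1)]] by auto
    then have "T \<subseteq> {x \<in> G. f x \<in> M}" using T by auto
    then have *: "\<forall>z\<in>{x \<in> G. f x \<in> N}. cm x z \<in> {x \<in> G. f x \<in> M}"
      using chief_vimage[OF f X G c(1,2)] L ker T unfolding cen_def by blast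
    obtain y where y: "y \<in> G" "z = f y" using c by blast
    then have "f (cm x y) \<in> M" using * c by blast
    moreover have "f (cm x y) = cm (f x) (f y)" using homo_cm[OF f X] x y G by blast
    ultimately show ?thesis using y by simp
  qed
  then show "f x \<in> cen (f ` X) (f ` G) {0}" using x by (auto simp: cen_def)
next
  assume R: "f x \<in> cen (f ` X) (f ` G) {0}"
  have "cm x z \<in> M" if c: "chief X M N" "T \<subseteq> M" "N \<subseteq> G" "z \<in> N" for M N z
  proof -
    have M: "sgrp M" "M \<subset> N" using c(1) by (auto simp: chief_def)
    have NX: "N \<subseteq> X" using c G by blast
    have "chief (f ` X) (f ` M) (f ` N)" using chief_image[OF f X c(1) NX] ker c(2) by blast
    moreover have "{0} \<subseteq> f ` M" using homo_zero[OF f X] sgrp_zero[OF M(1)] by force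
    ultimately have "cm (f x) (f z) \<in> f ` M" using R c(3,4) unfolding cen_def by blast
    moreover have "f (cm x z) = cm (f x) (f z)" using homo_cm[OF f X] x G c by blast
    ultimately have "f (cm x z) \<in> f ` M" by simp
    then obtain m where m: "m \<in> M" "f (cm x z) = f m" by blast
    have cX: "cm x z \<in> X" using x G c X by (auto intro!: sgrp_cm)
    have mX: "m \<in> X" using m M NX by blast
    have "f (- m + cm x z) = 0" using homo_eq_iff[OF f X mX cX] m by simp
    then have "- m + cm x z \<in> T" using ker[of "- m + cm x z"] X mX cX by (simp add: sgrp_mem)
    then show ?thesis using c(2) sgrp_add_left[OF M(1), of "- m"] m M(1) by (auto simp: sgrp_uminus)
  qed
  then show "x \<in> cen X G T" using x by (auto simp: cen_def)
qed

text \<open>Self-normalisation is stated with an inclusion of the conjugate in F; for finite F the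
  conjugate then equals F.\<close>

definition carter :: "'a::group_add set \<Rightarrow> 'a set \<Rightarrow> bool" where
  "carter G F \<longleftrightarrow> sgrp F \<and> F \<subseteq> G \<and> nil F \<and> (\<forall>g\<in>G. (\<forall>f\<in>F. cj g f \<in> F) \<longrightarrow> g \<in> F)"

text \<open>For finite groups this is solvability: no nontrivial subgroup is perfect.\<close>

definition solv :: "'a::group_add set \<Rightarrow> bool" where
  "solv G \<longleftrightarrow> (\<forall>N. sgrp N \<and> N \<subseteq> G \<and> N \<subseteq> gen {cm x y | x y. x \<in> N \<and> y \<in> N} \<longrightarrow> N = {0})"

lemma solv_subset: "solv G \<Longrightarrow> S \<subseteq> G \<Longrightarrow> solv S"
  unfolding solv_def by blast

text \<open>Above a perfect subgroup N of the image choose a minimal subgroup K mapping onto N. The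
  commutator subgroup of K also maps onto N, so minimality makes K perfect, and K is
  trivial.\<close>

lemma solv_image:
  assumes G: "solv G" "sgrp G" "finite G" and f: "homo G f"
  shows "solv (f ` G)"
  unfolding solv_def
proof (intro allI impI, elim conjE)
  fix N assume N: "sgrp N" "N \<subseteq> f ` G" "N \<subseteq> gen {cm x y | x y. x \<in> N \<and> y \<in> N}"
  let ?A = "{K. sgrp K \<and> K \<subseteq> G \<and> f ` K = N}"
  have "finite ?A" by (rule finite_subset[of _ "Pow G"]) (use G in auto)
  moreover have "{x \<in> G. f x \<in> N} \<in> ?A" using sgrp_vimage[OF f G(2) N(1)] N(2) by auto
  then have "?A \<noteq> {}" by blast
  ultimately have "\<exists>K\<in>?A. \<forall>L\<in>?A. L \<subseteq> K \<longrightarrow> K = L" by (rule finite_has_minimal)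
  then obtain K where K: "K \<in> ?A" "\<forall>L\<in>?A. L \<subseteq> K \<longrightarrow> K = L" by blast
  let ?C = "{cm x y | x y. x \<in> K \<and> y \<in> K}"
  have C: "?C \<subseteq> K" using K by (auto simp: sgrp_cm)
  have gK: "gen ?C \<subseteq> K" using gen_least[OF _ C] K by blast
  have "f ` ?C = {cm x y | x y. x \<in> N \<and> y \<in> N}"
  proof -
    have N': "N = f ` K" using K(1) by blast
    have KG: "K \<subseteq> G" using K(1) by blast
    have fc: "f (cm x y) = cm (f x) (f y)" if "x \<in> K" "y \<in> K" for x y
      using homo_cm[OF f G(2) subsetD[OF KG] subsetD[OF KG]] that .
    show ?thesis
    proof (intro equalityI subsetI)
      fix z assume "z \<in> f ` ?C"
      then obtain x y where "x \<in> K" "y \<in> K" "z = f (cm x y)" by blast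
      then show "z \<in> {cm x y | x y. x \<in> N \<and> y \<in> N}" using fc N' by blast
    next
      fix z assume "z \<in> {cm x y | x y. x \<in> N \<and> y \<in> N}"
      then obtain x y where "x \<in> K" "y \<in> K" "z = cm (f x) (f y)" unfolding N' by blast
      then have "cm x y \<in> ?C" "z = f (cm x y)" using fc by auto
      then show "z \<in> f ` ?C" by (rule rev_image_eqI)
    qed
  qed
  moreover have "?C \<subseteq> G" using C K(1) by blast
  ultimately have "f ` gen ?C = gen {cm x y | x y. x \<in> N \<and> y \<in> N}"
    using homo_image_gen[OF f G(2), of ?C] by simp
  moreover have "gen {cm x y | x y. x \<in> N \<and> y \<in> N} \<subseteq> N"
    by (rule gen_least[OF N(1)]) (auto simp: sgrp_cm N(1))
  moreover have "gen ?C \<subseteq> G" using gK K(1) by blast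
  ultimately have "gen ?C \<in> ?A" using N(3) sgrp_gen[of ?C] by simp
  then have "K = gen ?C" using K(2) gK by blast
  then have "K = {0}" using G(1) K(1) unfolding solv_def by blast
  then show "N = {0}" using K homo_zero[OF f G(2)] by auto
qed

text \<open>The subgroup generated by the commutators of V is X-invariant and, by solvability, not
  V; so it is trivial. The r-torsion is then an invariant subgroup, nontrivial by Cauchy's theorem
  when r divides the order of V.\<close>

lemma minimal_normal_solv:
  assumes X: "sgrp X" "finite X" and c: "chief X {0} V" and V: "V \<subseteq> X" "solv V"
  obtains r where "prime (r::nat)" "\<And>v. v \<in> V \<Longrightarrow> nm r v = 0" "\<And>v w. v \<in> V \<Longrightarrow> w \<in> V \<Longrightarrow> v + w = w + v"
proof -
  have sV: "sgrp V" "nmz X V" "V \<noteq> {0}" using c by (auto simp: chief_def)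
  have fin: "finite V" using X V finite_subset by blast
  have minim: "K = {0} \<or> K = V" if "sgrp K" "nmz X K" "K \<subseteq> V" for K
    using c that sgrp_zero[OF that(1)] unfolding chief_def by blast
  let ?C = "{cm x y | x y. x \<in> V \<and> y \<in> V}"
  have "nmz X ?C" unfolding nmz_def using sV(2) by (fastforce simp: cj_distrib_cm nmzD)
  then have "gen ?C = {0} \<or> gen ?C = V"
    by (intro minim sgrp_gen nmz_gen gen_least[OF sV(1)]) (auto simp: sgrp_cm sV)
  then have "gen ?C = {0}" using V(2) sV unfolding solv_def by blast
  then have "cm v w = 0" if "v \<in> V" "w \<in> V" for v w using that gen.base[of "cm v w" ?C] by auto
  then have ab: "v + w = w + v" if "v \<in> V" "w \<in> V" for v w using that by (simp add: cm_eq_zero)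
  have "\<not> V \<subseteq> {0}" using sV sgrp_zero by blast
  then have "card V \<noteq> 1" using sgrp_zero[OF sV(1)] by (auto simp: card_1_singleton_iff)
  then obtain r where r: "prime r" "r dvd card V" using prime_factor_nat by blast
  obtain x where x: "x \<in> V" "x \<noteq> 0" "nm r x = 0" using cauchy_set[OF fin sV(1) r] by blast
  let ?K = "{v \<in> V. nm r v = 0}"
  have "?K = {0} \<or> ?K = V"
  proof (rule minim)
    show "sgrp ?K" using sV(1) by (auto intro!: sgrpI simp: sgrp_mem nm_uminus nm_commute_add ab)
    show "nmz X ?K" using sV(2) by (auto simp: nmz_def nm_cj)
  qed auto
  then have "?K = V" using x by blast
  then show thesis using that[OF r(1)] ab by blast
qed

section \<open>Cocycles on abelian groups\<close>

lemma (in comm_monoid) finprod_swap: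
  assumes "finite A" "finite B" "\<And>a b. a \<in> A \<Longrightarrow> b \<in> B \<Longrightarrow> f a b \<in> carrier G"
  shows "(\<Otimes>a\<in>A. \<Otimes>b\<in>B. f a b) = (\<Otimes>b\<in>B. \<Otimes>a\<in>A. f a b)"
  using assms(1,3)
proof (induct A rule: finite_induct)
  case (insert a A)
  have 1: "(\<lambda>a. \<Otimes>b\<in>B. f a b) \<in> A \<rightarrow> carrier G" "(\<Otimes>b\<in>B. f a b) \<in> carrier G"
    using insert by (auto intro!: finprod_closed)
  have "(\<Otimes>b\<in>B. \<Otimes>a\<in>insert a A. f a b) = (\<Otimes>b\<in>B. f a b \<otimes> (\<Otimes>a\<in>A. f a b))"
    using insert by (intro finprod_cong') (auto intro!: finprod_closed)
  also have "\<dots> = (\<Otimes>b\<in>B. f a b) \<otimes> (\<Otimes>b\<in>B. \<Otimes>a\<in>A. f a b)"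
    using insert by (intro finprod_multf) (auto intro!: finprod_closed)
  also have "\<dots> = (\<Otimes>b\<in>B. f a b) \<otimes> (\<Otimes>a\<in>A. \<Otimes>b\<in>B. f a b)" using insert by simp
  also have "\<dots> = (\<Otimes>a\<in>insert a A. \<Otimes>b\<in>B. f a b)" using insert 1 by simp
  finally show ?case by simp
qed simp

lemma (in comm_monoid) finprod_bij:
  assumes "bij_betw p A B" "\<And>b. b \<in> B \<Longrightarrow> f b \<in> carrier G"
  shows "(\<Otimes>a\<in>A. f (p a)) = (\<Otimes>b\<in>B. f b)"
  using finprod_reindex[of f p A] assms by (auto simp: bij_betw_def)

lemma (in comm_group) finprod_inv:
  assumes "\<And>a. a \<in> A \<Longrightarrow> f a \<in> carrier G"
  shows "(\<Otimes>a\<in>A. inv f a) = inv (\<Otimes>a\<in>A. f a)"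
  using assms
proof (induct A rule: infinite_finite_induct)
  case (insert a A)
  then show ?case by (simp add: Pi_def inv_mult)
qed simp_all

lemma sgrp_translate_bij: "sgrp S \<Longrightarrow> h \<in> S \<Longrightarrow> bij_betw ((+) h) S S" "sgrp S \<Longrightarrow> h \<in> S \<Longrightarrow> bij_betw (\<lambda>x. x + h) S S"
  by (rule bij_betwI[where g = "(+) (- h)"]; auto simp: sgrp_mem)
     (rule bij_betwI[where g = "\<lambda>x. x + - h"]; auto simp: sgrp_mem add.assoc)

text \<open>V has a carrier and is written multiplicatively, so that sums over an acting set become
  finite products; the acting group stays additive. The instances used are normal abelian subgroups
  under conjugation.\<close>

locale abelian_action = comm_group V for V (structure) +
  fixes Y :: "'g::group_add set" and \<phi> :: "'g \<Rightarrow> 'a \<Rightarrow> 'a"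
  assumes Y: "sgrp Y" "finite Y"
    and finV: "finite (carrier V)"
    and act_closed [simp, intro]: "y \<in> Y \<Longrightarrow> v \<in> carrier V \<Longrightarrow> \<phi> y v \<in> carrier V"
    and act_mult: "y \<in> Y \<Longrightarrow> v \<in> carrier V \<Longrightarrow> w \<in> carrier V \<Longrightarrow> \<phi> y (v \<otimes> w) = \<phi> y v \<otimes> \<phi> y w"
    and act_add: "x \<in> Y \<Longrightarrow> y \<in> Y \<Longrightarrow> v \<in> carrier V \<Longrightarrow> \<phi> (x + y) v = \<phi> x (\<phi> y v)"
    and act_zero [simp]: "v \<in> carrier V \<Longrightarrow> \<phi> 0 v = v"
begin

lemma act_one [simp]: "y \<in> Y \<Longrightarrow> \<phi> y \<one> = \<one>"
  using act_mult[of y \<one> \<one>] act_closed[of y \<one>] by (metis l_cancel_one' one_closed r_one)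

lemma act_inv: "y \<in> Y \<Longrightarrow> v \<in> carrier V \<Longrightarrow> \<phi> y (inv v) = inv \<phi> y v"
  by (metis act_closed act_mult act_one inv_closed inv_equality l_inv)

lemma act_pow: "y \<in> Y \<Longrightarrow> v \<in> carrier V \<Longrightarrow> \<phi> y (v [^] (n::nat)) = \<phi> y v [^] n"
  by (induct n) (simp_all add: act_mult)

lemma act_uminus [simp]:
  assumes "y \<in> Y" "v \<in> carrier V"
  shows "\<phi> (- y) (\<phi> y v) = v" "\<phi> y (\<phi> (- y) v) = v"
  using act_add[of "- y" y v] act_add[of y "- y" v] assms Y by (auto simp: sgrp_mem)

lemma act_cj: "x \<in> Y \<Longrightarrow> y \<in> Y \<Longrightarrow> v \<in> carrier V \<Longrightarrow> \<phi> (cj x y) v = \<phi> x (\<phi> y (\<phi> (- x) v))"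
  using Y by (simp add: cj_def act_add sgrp_mem)

lemma act_cj': "x \<in> Y \<Longrightarrow> y \<in> Y \<Longrightarrow> v \<in> carrier V \<Longrightarrow> \<phi> (cj x y) (\<phi> x v) = \<phi> x (\<phi> y v)"
  by (simp add: act_cj)

lemma act_finprod:
  assumes "y \<in> Y" "\<And>a. a \<in> A \<Longrightarrow> f a \<in> carrier V"
  shows "\<phi> y (\<Otimes>a\<in>A. f a) = (\<Otimes>a\<in>A. \<phi> y (f a))"
  using assms(2)
proof (induct A rule: infinite_finite_induct)
  case (insert a A)
  then show ?case using assms(1) by (simp add: Pi_def act_mult)
qed (use assms in simp_all)

text \<open>The action of the group ring element that is the sum over S. For a subgroup S this is
  the norm, whose values are fixed by S.\<close>

definition N :: "'g set \<Rightarrow> 'a \<Rightarrow> 'a" where "N S v = (\<Otimes>s\<in>S. \<phi> s v)"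

lemma N_closed [simp, intro]: "S \<subseteq> Y \<Longrightarrow> v \<in> carrier V \<Longrightarrow> N S v \<in> carrier V"
  unfolding N_def by (intro finprod_closed) auto

lemma N_mult:
  assumes "S \<subseteq> Y" "v \<in> carrier V" "w \<in> carrier V"
  shows "N S (v \<otimes> w) = N S v \<otimes> N S w"
proof -
  have "N S (v \<otimes> w) = (\<Otimes>s\<in>S. \<phi> s v \<otimes> \<phi> s w)"
    unfolding N_def using assms by (intro finprod_cong') (auto simp: act_mult subset_iff)
  also have "\<dots> = N S v \<otimes> N S w"
    unfolding N_def using assms by (intro finprod_multf) auto
  finally show ?thesis .
qed

lemma N_one [simp]: "S \<subseteq> Y \<Longrightarrow> N S \<one> = \<one>"
  unfolding N_def by (rule finprod_one_eqI) auto

lemma N_inv: "S \<subseteq> Y \<Longrightarrow> v \<in> carrier V \<Longrightarrow> N S (inv v) = inv N S v"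
  unfolding N_def by (subst finprod_inv[symmetric]) (auto intro!: finprod_cong' simp: act_inv subset_iff)

lemma N_finprod:
  assumes "S \<subseteq> Y" "\<And>a. a \<in> A \<Longrightarrow> f a \<in> carrier V"
  shows "N S (\<Otimes>a\<in>A. f a) = (\<Otimes>a\<in>A. N S (f a))"
  using assms(2)
proof (induct A rule: infinite_finite_induct)
  case (insert a A)
  then show ?case using assms(1) by (simp add: Pi_def N_mult)
qed (use assms in simp_all)

lemma act_N:
  assumes "sgrp S" "S \<subseteq> Y" "s \<in> S" "v \<in> carrier V"
  shows "\<phi> s (N S v) = N S v"
proof -
  have "\<phi> s (N S v) = (\<Otimes>x\<in>S. \<phi> s (\<phi> x v))" unfolding N_def using assms by (intro act_finprod) auto
  also have "\<dots> = (\<Otimes>x\<in>S. \<phi> (s + x) v)"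
    using assms Y by (intro finprod_cong') (auto simp: act_add subset_iff sgrp_mem)
  also have "\<dots> = N S v"
    using finprod_bij[OF sgrp_translate_bij(1)[of S s], of "\<lambda>x. \<phi> x v"] assms by (auto simp: N_def)
  finally show ?thesis .
qed

lemma N_act:
  assumes "sgrp S" "S \<subseteq> Y" "s \<in> S" "v \<in> carrier V"
  shows "N S (\<phi> s v) = N S v"
proof -
  have "N S (\<phi> s v) = (\<Otimes>x\<in>S. \<phi> (x + s) v)"
    unfolding N_def using assms Y by (intro finprod_cong') (auto simp: act_add subset_iff sgrp_mem)
  also have "\<dots> = N S v"
    using finprod_bij[OF sgrp_translate_bij(2)[of S s], of "\<lambda>x. \<phi> x v"] assms by (auto simp: N_def)
  finally show ?thesis .
qed

text \<open>Stated as absence of n-torsion; as V is finite, the n-th power map is then bijective and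
  n-th roots exist.\<close>

definition divisible_by :: "nat \<Rightarrow> bool" where
  "divisible_by n \<longleftrightarrow> (\<forall>v\<in>carrier V. v [^] n = \<one> \<longrightarrow> v = \<one>)"

lemma divisible_inj: "divisible_by n \<Longrightarrow> v \<in> carrier V \<Longrightarrow> w \<in> carrier V \<Longrightarrow> v [^] n = w [^] n \<Longrightarrow> v = w"
proof -
  assume d: "divisible_by n" and v: "v \<in> carrier V" "w \<in> carrier V" "v [^] n = w [^] n"
  have "(v \<otimes> inv w) [^] n = \<one>" using v by (simp add: nat_pow_distrib nat_pow_inv)
  then have "v \<otimes> inv w = \<one>" using d v by (simp add: divisible_by_def)
  then show "v = w" using v by (metis inv_equality inv_inv inv_closed)
qed

lemma divisible_surj:
  assumes "divisible_by n" "v \<in> carrier V"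
  obtains w where "w \<in> carrier V" "w [^] n = v"
proof -
  have "(\<lambda>w. w [^] n) ` carrier V = carrier V"
    by (rule endo_inj_surj[OF finV]) (auto intro!: inj_onI dest: divisible_inj[OF assms(1)])
  then show thesis using that assms(2) by (metis imageE)
qed

definition fix_set :: "'g set \<Rightarrow> 'a set" where
  "fix_set S = {v \<in> carrier V. \<forall>s\<in>S. \<phi> s v = v}"

definition cocycle :: "'g set \<Rightarrow> ('g \<Rightarrow> 'a) \<Rightarrow> bool" where
  "cocycle S c \<longleftrightarrow> (\<forall>x\<in>S. c x \<in> carrier V) \<and> (\<forall>x\<in>S. \<forall>y\<in>S. c (x + y) = c x \<otimes> \<phi> x (c y))"

text \<open>Averaging: multiplying the cocycle identity over its second argument gives
  \<open>c q [^] card Q = v \<otimes> inv \<phi> q v\<close> for the product \<open>v\<close> of all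
  values, and a root of \<open>v\<close> of exponent \<open>card Q\<close> cobounds.\<close>

lemma cocycle_coprime:
  assumes Q: "sgrp Q" "Q \<subseteq> Y" and c: "cocycle Q c" and d: "divisible_by (card Q)"
  obtains w where "w \<in> carrier V" "\<And>q. q \<in> Q \<Longrightarrow> c q = w \<otimes> inv \<phi> q w"
proof -
  have cc: "c x \<in> carrier V" if "x \<in> Q" for x using c that by (simp add: cocycle_def)
  define v where "v = (\<Otimes>x\<in>Q. c x)"
  have v: "v \<in> carrier V" unfolding v_def using cc by (intro finprod_closed) auto
  have e: "v = c q [^] card Q \<otimes> \<phi> q v" if q: "q \<in> Q" for q
  proof -
    have "v = (\<Otimes>x\<in>Q. c (q + x))"
      using finprod_bij[OF sgrp_translate_bij(1)[OF Q(1) q], of c] cc by (simp add: v_def)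
    also have "\<dots> = (\<Otimes>x\<in>Q. c q \<otimes> \<phi> q (c x))"
      using c q Q cc by (intro finprod_cong') (auto simp: cocycle_def subset_iff)
    also have "\<dots> = (\<Otimes>x\<in>Q. c q) \<otimes> (\<Otimes>x\<in>Q. \<phi> q (c x))"
      using q cc Q by (intro finprod_multf) auto
    also have "\<dots> = c q [^] card Q \<otimes> \<phi> q v"
      unfolding v_def using q cc Q by (subst act_finprod) (auto simp: finprod_const)
    finally show ?thesis .
  qed
  obtain w where w: "w \<in> carrier V" "w [^] card Q = v" using divisible_surj[OF d v] by blast
  have "c q = w \<otimes> inv \<phi> q w" if q: "q \<in> Q" for q
  proof (rule divisible_inj[OF d])
    have qY: "q \<in> Y" using q Q by blast
    show "c q \<in> carrier V" "w \<otimes> inv \<phi> q w \<in> carrier V" using cc q qY w by auto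
    have "(w \<otimes> inv \<phi> q w) [^] card Q = v \<otimes> inv \<phi> q v"
      using w qY by (simp add: nat_pow_distrib nat_pow_inv act_pow[symmetric])
    also have "\<dots> = c q [^] card Q"
      using e[OF q] v qY cc[OF q] by (metis act_closed inv_solve_right' nat_pow_closed)
    finally show "c q [^] card Q = (w \<otimes> inv \<phi> q w) [^] card Q" by simp
  qed
  then show thesis using that w by blast
qed

definition frob :: "'g set \<Rightarrow> 'g set \<Rightarrow> bool" where
  "frob Q H \<longleftrightarrow> sgrp Q \<and> sgrp H \<and> Q \<subseteq> Y \<and> H \<subseteq> Y \<and> nmz H Q \<and>
     (\<forall>h\<in>H. h \<noteq> 0 \<longrightarrow> (\<forall>q\<in>Q. h + q = q + h \<longrightarrow> q = 0))"

text \<open>The partition of a Frobenius group into its kernel and the nontrivial elements of the conjugates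
  of its complement, summed up in the group ring.\<close>

lemma frobenius_partition:
  assumes fr: "frob Q H" and v: "v \<in> carrier V"
  shows "(\<Otimes>q\<in>Q. \<phi> q (N H (\<phi> (- q) v))) \<otimes> N Q v = v [^] card Q \<otimes> N Q (N H v)"
proof -
  have QH: "sgrp Q" "sgrp H" "Q \<subseteq> Y" "H \<subseteq> Y" "nmz H Q"
    and fpf: "\<And>h q. h \<in> H \<Longrightarrow> h \<noteq> 0 \<Longrightarrow> q \<in> Q \<Longrightarrow> h + q = q + h \<Longrightarrow> q = 0"
    using fr by (auto simp: frob_def)
  have fin: "finite Q" "finite H" using QH Y finite_subset by auto
  have mem: "q \<in> Y" "h \<in> Y" "- q \<in> Y" "cj q h \<in> Y" if "q \<in> Q" "h \<in> H" for q h
    using that QH Y by (auto simp: sgrp_mem sgrp_cj subset_iff)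
  \<comment> \<open>The conjugate of h by q is [q, h] + h, and q to [q, h] permutes Q; so the
    conjugates run exactly once through the coset Q + h.\<close>
  have in_h: "(\<Otimes>q\<in>Q. \<phi> (cj q h) v) = N Q (\<phi> h v)" if h: "h \<in> H" "h \<noteq> 0" for h
  proof -
    have "bij_betw (\<lambda>q. cm q h) Q Q"
      by (rule fixed_point_free_bij) (use QH fin fpf h in \<open>auto simp: nmzD\<close>)
    from finprod_bij[OF this, of "\<lambda>q. \<phi> q (\<phi> h v)"] have "(\<Otimes>q\<in>Q. \<phi> (cm q h) (\<phi> h v)) = N Q (\<phi> h v)"
      using h v QH by (auto simp: N_def)
    moreover have "(\<Otimes>q\<in>Q. \<phi> (cm q h) (\<phi> h v)) = (\<Otimes>q\<in>Q. \<phi> (cj q h) v)"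
    proof (rule finprod_cong')
      show "\<phi> (cm q h) (\<phi> h v) = \<phi> (cj q h) v" if "q \<in> Q" for q
      proof -
        have "cm q h \<in> Y" using Y mem[OF that h(1)] by (simp add: sgrp_cm)
        then have "\<phi> (cm q h + h) v = \<phi> (cm q h) (\<phi> h v)" using mem[OF that h(1)] v by (intro act_add)
        then show ?thesis by (simp add: cj_cm)
      qed
    qed (use mem h v in auto)
    ultimately show ?thesis by simp
  qed
  have "(\<Otimes>q\<in>Q. \<phi> q (N H (\<phi> (- q) v))) = (\<Otimes>q\<in>Q. \<Otimes>h\<in>H. \<phi> (cj q h) v)"
  proof (rule finprod_cong')
    show "\<phi> q (N H (\<phi> (- q) v)) = (\<Otimes>h\<in>H. \<phi> (cj q h) v)" if "q \<in> Q" for q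
    proof -
      have qY: "q \<in> Y" "- q \<in> Y" using that QH Y by (auto simp: sgrp_mem)
      have "\<phi> q (N H (\<phi> (- q) v)) = (\<Otimes>h\<in>H. \<phi> q (\<phi> h (\<phi> (- q) v)))"
        unfolding N_def using qY QH v by (intro act_finprod) auto
      also have "\<dots> = (\<Otimes>h\<in>H. \<phi> (cj q h) v)"
        using qY QH v mem that by (intro finprod_cong') (auto simp: act_cj)
      finally show ?thesis .
    qed
  qed (use mem v in \<open>auto intro!: finprod_closed\<close>)
  also have "\<dots> = (\<Otimes>h\<in>H. \<Otimes>q\<in>Q. \<phi> (cj q h) v)"
    using fin mem v by (intro finprod_swap) auto
  also have "\<dots> = (\<Otimes>h\<in>insert 0 (H - {0}). \<Otimes>q\<in>Q. \<phi> (cj q h) v)"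
    using sgrp_zero[OF QH(2)] by (simp add: insert_absorb)
  also have "\<dots> = (\<Otimes>q\<in>Q. \<phi> (cj q 0) v) \<otimes> (\<Otimes>h\<in>H - {0}. \<Otimes>q\<in>Q. \<phi> (cj q h) v)"
    using fin mem v sgrp_zero[OF QH(2)] by (intro finprod_insert) (auto intro!: finprod_closed)
  also have "(\<Otimes>q\<in>Q. \<phi> (cj q 0) v) = v [^] card Q" using v by (simp add: finprod_const)
  also have "(\<Otimes>h\<in>H - {0}. \<Otimes>q\<in>Q. \<phi> (cj q h) v) = (\<Otimes>h\<in>H - {0}. N Q (\<phi> h v))"
    using in_h QH v by (intro finprod_cong') (auto simp: subset_iff)
  finally have 1: "(\<Otimes>q\<in>Q. \<phi> q (N H (\<phi> (- q) v))) = v [^] card Q \<otimes> (\<Otimes>h\<in>H - {0}. N Q (\<phi> h v))" .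
  have "N Q (N H v) = (\<Otimes>h\<in>H. N Q (\<phi> h v))"
    using N_finprod[of Q H "\<lambda>h. \<phi> h v"] QH v by (auto simp: N_def[of H])
  also have "\<dots> = (\<Otimes>h\<in>insert 0 (H - {0}). N Q (\<phi> h v))"
    using sgrp_zero[OF QH(2)] by (simp add: insert_absorb)
  also have "\<dots> = N Q (\<phi> 0 v) \<otimes> (\<Otimes>h\<in>H - {0}. N Q (\<phi> h v))"
    using fin QH v sgrp_zero[OF QH(2)] by (intro finprod_insert) auto
  finally have 2: "N Q (N H v) = N Q v \<otimes> (\<Otimes>h\<in>H - {0}. N Q (\<phi> h v))" using v by simp
  have 3: "(\<Otimes>h\<in>H - {0}. N Q (\<phi> h v)) \<in> carrier V" using QH v by (intro finprod_closed) auto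
  show ?thesis unfolding 1 2 using 3 v QH by (simp add: m_ac)
qed

text \<open>Norms over F vanish, so the partition identity writes \<open>u [^] card F\<close> as a
  product of operators \<open>om f u\<close> over f in F. H permutes these operators as it permutes
  F, freely outside 0, so the contribution of each orbit behaves like a cocycle in an induced module
  and is cobounded explicitly. A root of exponent \<open>card F\<close> finishes the proof.\<close>

lemma cocycle_frobenius:
  assumes fr: "frob F H" and C: "fix_set F \<subseteq> {\<one>}" and d: "divisible_by (card F)" and c: "cocycle H \<delta>"
  obtains w where "w \<in> carrier V" "\<And>h. h \<in> H \<Longrightarrow> \<delta> h = w \<otimes> inv \<phi> h w"
proof -
  have FH: "sgrp F" "sgrp H" "F \<subseteq> Y" "H \<subseteq> Y" "nmz H F"
    and fpf: "\<And>h q. h \<in> H \<Longrightarrow> h \<noteq> 0 \<Longrightarrow> q \<in> F \<Longrightarrow> h + q = q + h \<Longrightarrow> q = 0"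
    using fr by (auto simp: frob_def)
  have fin: "finite F" "finite H" using FH Y finite_subset by auto
  have memF: "f \<in> Y" "- f \<in> Y" if "f \<in> F" for f using that FH by (auto simp: sgrp_mem)
  have memH: "h \<in> Y" "- h \<in> Y" if "h \<in> H" for h using that FH by (auto simp: sgrp_mem)
  have \<delta>: "\<delta> h \<in> carrier V" if "h \<in> H" for h using c that by (simp add: cocycle_def)
  have NF: "N F v = \<one>" if "v \<in> carrier V" for v
    using C act_N[of F _ v] FH that by (auto simp: fix_set_def)
  \<comment> \<open>Removing \<open>u\<close> makes \<open>om 0\<close> trivial. The corrections
    multiply to \<open>N F (N H u)\<close>, which is trivial as well, so the product over F is still
    \<open>u [^] card F\<close>.\<close>
  define om where "om f u = \<phi> f (N H (\<phi> (- f) u \<otimes> inv u))" for f u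
  have om_cl: "om f u \<in> carrier V" if "f \<in> F" "u \<in> carrier V" for f u
    using that memF FH by (simp add: om_def)
  have om_mult: "om f (u \<otimes> w) = om f u \<otimes> om f w" if "f \<in> F" "u \<in> carrier V" "w \<in> carrier V" for f u w
  proof -
    have "\<phi> (- f) (u \<otimes> w) \<otimes> inv (u \<otimes> w) = (\<phi> (- f) u \<otimes> inv u) \<otimes> (\<phi> (- f) w \<otimes> inv w)"
      using that memF by (simp add: act_mult inv_mult m_ac)
    then show ?thesis using that memF FH by (simp add: om_def N_mult act_mult)
  qed
  have om_inv: "om f (inv u) = inv om f u" if "f \<in> F" "u \<in> carrier V" for f u
    using om_mult[OF that(1) _ that(2), of "inv u"] om_cl[OF that(1)] that memF FH
    by (metis inv_closed inv_equality l_inv om_def act_one N_one inv_one r_one one_closed)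
  have om_act: "\<phi> k (om f u) = om (cj k f) (\<phi> k u)" if "k \<in> H" "f \<in> F" "u \<in> carrier V" for k f u
  proof -
    have kf: "cj k f \<in> F" using that FH by (simp add: nmzD)
    have e1: "- cj k f = cj k (- f)" by (simp add: cj_uminus)
    have "\<phi> (- cj k f) (\<phi> k u) \<otimes> inv \<phi> k u = \<phi> k (\<phi> (- f) u \<otimes> inv u)"
      unfolding e1 using that memF memH by (simp add: act_cj' act_mult act_inv)
    then have "om (cj k f) (\<phi> k u) = \<phi> (cj k f) (N H (\<phi> (- f) u \<otimes> inv u))"
      using N_act[OF FH(2,4) that(1)] that memF by (simp add: om_def)
    also have "\<dots> = \<phi> k (\<phi> f (\<phi> (- k) (N H (\<phi> (- f) u \<otimes> inv u))))"
      using that memF memH FH by (intro act_cj) auto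
    also have "\<phi> (- k) (N H (\<phi> (- f) u \<otimes> inv u)) = N H (\<phi> (- f) u \<otimes> inv u)"
      using that memF FH by (intro act_N) (auto simp: sgrp_mem)
    finally show ?thesis by (simp add: om_def)
  qed
  have om_sum: "(\<Otimes>f\<in>F. om f u) = u [^] card F" if u: "u \<in> carrier V" for u
  proof -
    have 1: "om f u = \<phi> f (N H (\<phi> (- f) u)) \<otimes> inv \<phi> f (N H u)" if "f \<in> F" for f
      using that memF FH u by (simp add: om_def N_mult N_inv act_mult act_inv)
    have "(\<Otimes>f\<in>F. om f u) = (\<Otimes>f\<in>F. \<phi> f (N H (\<phi> (- f) u)) \<otimes> inv \<phi> f (N H u))"
      using 1 memF FH u by (intro finprod_cong') auto
    also have "\<dots> = (\<Otimes>f\<in>F. \<phi> f (N H (\<phi> (- f) u))) \<otimes> (\<Otimes>f\<in>F. inv \<phi> f (N H u))"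
      using memF FH u by (intro finprod_multf) auto
    also have "(\<Otimes>f\<in>F. inv \<phi> f (N H u)) = inv N F (N H u)"
      unfolding N_def[of F] using memF FH u by (intro finprod_inv) auto
    also have "(\<Otimes>f\<in>F. \<phi> f (N H (\<phi> (- f) u))) = u [^] card F"
      using frobenius_partition[OF fr u] NF u FH finprod_closed[of "\<lambda>f. \<phi> f (N H (\<phi> (- f) u))" F] memF by auto
    finally show ?thesis using NF FH u by simp
  qed
  \<comment> \<open>The contribution of every H-invariant subset of F - {0} is cobounded, by
    removing one regular orbit \<open>B\<close> at a time.\<close>
  have P: "\<exists>v\<in>carrier V. \<forall>h\<in>H. v \<otimes> inv \<phi> h v = (\<Otimes>f\<in>U. om f (\<delta> h))" if "U \<subseteq> F - {0}" "nmz H U" for U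
    using that
  proof (induct "card U" arbitrary: U rule: less_induct)
    case less
    note U = less.prems
    show ?case
    proof (cases "U = {}")
      case True then show ?thesis using memH by (intro bexI[of _ \<one>]) auto
    next
      case False
      then obtain f where f: "f \<in> U" by blast
      then have fF: "f \<in> F" "f \<noteq> 0" using U by auto
      define B where "B = (\<lambda>k. cj k f) ` H"
      have inj: "inj_on (\<lambda>k. cj k f) H"
      proof (rule inj_onI)
        fix k l assume kl: "k \<in> H" "l \<in> H" "cj k f = cj l f"
        then have "cj (- l + k) f = f" by (simp add: cj_cj[symmetric])
        then have "(- l + k) + f = f + (- l + k)" by (simp add: cj_eq_self)
        moreover have "- l + k \<in> H" using kl FH by (simp add: sgrp_mem)
        ultimately have "- l + k = 0" using fpf fF by blast
        then have "l + (- l + k) = l" by simp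
        then show "k = l" by simp
      qed
      have BU: "B \<subseteq> U" using U(2) f by (auto simp: B_def nmzD)
      have finU: "finite U" using U fin finite_subset by blast
      have cjF: "cj k f \<in> F" if "k \<in> H" for k using that FH fF by (simp add: nmzD)
      have "nmz H (U - B)"
        unfolding nmz_def
      proof (intro ballI DiffI)
        fix h u assume h: "h \<in> H" and u: "u \<in> U - B"
        then show "cj h u \<in> U" using U(2) by (auto simp: nmzD)
        show "cj h u \<notin> B"
        proof
          assume "cj h u \<in> B"
          then obtain k where k: "k \<in> H" "cj h u = cj k f" by (auto simp: B_def)
          then have "u = cj (- h + k) f" by (simp add: cj_eq_iff[of h] cj_cj)
          then have "u \<in> B" using k h FH by (auto simp: B_def sgrp_mem)
          then show False using u by blast
        qed
      qed
      moreover have "card (U - B) < card U"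
        using f finU sgrp_zero[OF FH(2)] by (intro psubset_card_mono) (force simp: B_def)+
      ultimately obtain v1 where v1: "v1 \<in> carrier V" "\<forall>h\<in>H. v1 \<otimes> inv \<phi> h v1 = (\<Otimes>f\<in>U - B. om f (\<delta> h))"
        using less.hyps[of "U - B"] U(1) by blast
      \<comment> \<open>A formula of Shapiro type: after the shift from \<open>k\<close> to
        \<open>h + k\<close>, the cocycle identity splits \<open>v2\<close> into the contribution of
        the orbit and \<open>\<phi> h v2\<close>.\<close>
      define v2 where "v2 = (\<Otimes>k\<in>H. om (cj k f) (\<delta> k))"
      have v2: "v2 \<in> carrier V" unfolding v2_def using om_cl cjF \<delta> by (intro finprod_closed) auto
      have 2: "v2 \<otimes> inv \<phi> h v2 = (\<Otimes>f\<in>B. om f (\<delta> h))" if h: "h \<in> H" for h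
      proof -
        let ?g = "\<lambda>k. om (cj (h + k) f) (\<delta> (h + k))" and ?i = "\<lambda>k. om (cj (h + k) f) (\<delta> h)"
        have hk: "h + k \<in> H" if "k \<in> H" for k using h that FH by (simp add: sgrp_mem)
        have B: "(\<Otimes>k\<in>H. ?i k) = (\<Otimes>f\<in>B. om f (\<delta> h))"
        proof -
          have "(\<Otimes>k\<in>H. ?i k) = (\<Otimes>k\<in>H. om (cj k f) (\<delta> h))"
            using finprod_bij[OF sgrp_translate_bij(1)[OF FH(2) h], of "\<lambda>k. om (cj k f) (\<delta> h)"] om_cl cjF \<delta> h by simp
          also have "\<dots> = (\<Otimes>f\<in>B. om f (\<delta> h))"
            unfolding B_def using inj om_cl cjF \<delta> h by (subst finprod_reindex) auto
          finally show ?thesis .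
        qed
        have "v2 = (\<Otimes>k\<in>H. ?g k)"
          using finprod_bij[OF sgrp_translate_bij(1)[OF FH(2) h], of "\<lambda>k. om (cj k f) (\<delta> k)"] om_cl cjF \<delta>
          by (simp add: v2_def)
        also have "\<dots> = (\<Otimes>k\<in>H. ?i k \<otimes> \<phi> h (om (cj k f) (\<delta> k)))"
        proof (rule finprod_cong')
          fix k assume k: "k \<in> H"
          have "\<phi> h (om (cj k f) (\<delta> k)) = om (cj (h + k) f) (\<phi> h (\<delta> k))"
            using om_act[OF h cjF[OF k] \<delta>[OF k]] by (simp add: cj_cj)
          then show "?g k = ?i k \<otimes> \<phi> h (om (cj k f) (\<delta> k))"
            using c h k om_mult[OF cjF[OF hk[OF k]] \<delta>[OF h], of "\<phi> h (\<delta> k)"] memH \<delta> by (simp add: cocycle_def)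
        qed (use om_cl cjF \<delta> h hk memH in auto)
        also have "\<dots> = (\<Otimes>k\<in>H. ?i k) \<otimes> (\<Otimes>k\<in>H. \<phi> h (om (cj k f) (\<delta> k)))"
          using om_cl cjF \<delta> h hk memH by (intro finprod_multf) auto
        also have "(\<Otimes>k\<in>H. \<phi> h (om (cj k f) (\<delta> k))) = \<phi> h v2"
          unfolding v2_def using om_cl cjF \<delta> h memH by (intro act_finprod[symmetric]) auto
        finally have "v2 = (\<Otimes>f\<in>B. om f (\<delta> h)) \<otimes> \<phi> h v2" using B by simp
        moreover have "(\<Otimes>f\<in>B. om f (\<delta> h)) \<in> carrier V"
          using BU U om_cl \<delta> h by (intro finprod_closed) auto
        ultimately show ?thesis using v2 h memH by (metis act_closed inv_solve_right')
      qed
      have "(v1 \<otimes> v2) \<otimes> inv \<phi> h (v1 \<otimes> v2) = (\<Otimes>f\<in>U. om f (\<delta> h))" if h: "h \<in> H" for h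
      proof -
        have "(v1 \<otimes> v2) \<otimes> inv \<phi> h (v1 \<otimes> v2) = (v1 \<otimes> inv \<phi> h v1) \<otimes> (v2 \<otimes> inv \<phi> h v2)"
          using v1(1) v2 h memH by (simp add: act_mult inv_mult m_ac)
        also have "\<dots> = (\<Otimes>f\<in>U - B. om f (\<delta> h)) \<otimes> (\<Otimes>f\<in>B. om f (\<delta> h))" using v1 2 h by simp
        also have "\<dots> = (\<Otimes>f\<in>(U - B) \<union> B. om f (\<delta> h))"
          using BU U om_cl \<delta> h finU finite_subset[OF BU] by (intro finprod_Un_disjoint[symmetric]) auto
        also have "(U - B) \<union> B = U" using BU by blast
        finally show ?thesis .
      qed
      then show ?thesis using v1 v2 by (intro bexI[of _ "v1 \<otimes> v2"]) auto
    qed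
  qed
  have "nmz H (F - {0})" using FH by (auto simp: nmz_def)
  then obtain v where v: "v \<in> carrier V" "\<forall>h\<in>H. v \<otimes> inv \<phi> h v = (\<Otimes>f\<in>F - {0}. om f (\<delta> h))"
    using P[of "F - {0}"] by blast
  have vh: "v \<otimes> inv \<phi> h v = \<delta> h [^] card F" if h: "h \<in> H" for h
  proof -
    have "(\<Otimes>f\<in>insert 0 (F - {0}). om f (\<delta> h)) = om 0 (\<delta> h) \<otimes> (\<Otimes>f\<in>F - {0}. om f (\<delta> h))"
      using fin om_cl \<delta> h sgrp_zero[OF FH(1)] by (intro finprod_insert) auto
    moreover have "om 0 (\<delta> h) = \<one>" using \<delta>[OF h] FH by (simp add: om_def)
    moreover have "insert 0 (F - {0}) = F" using sgrp_zero[OF FH(1)] by blast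
    moreover have "(\<Otimes>f\<in>F - {0}. om f (\<delta> h)) \<in> carrier V" using om_cl \<delta> h by (intro finprod_closed) auto
    ultimately show ?thesis using v om_sum[OF \<delta>[OF h]] h by simp
  qed
  obtain w where w: "w \<in> carrier V" "w [^] card F = v" using divisible_surj[OF d v(1)] by blast
  have "\<delta> h = w \<otimes> inv \<phi> h w" if h: "h \<in> H" for h
  proof (rule divisible_inj[OF d])
    show "\<delta> h \<in> carrier V" "w \<otimes> inv \<phi> h w \<in> carrier V" using \<delta> h memH w by auto
    show "\<delta> h [^] card F = (w \<otimes> inv \<phi> h w) [^] card F"
      using w vh[OF h] memH[OF h] by (simp add: nat_pow_distrib nat_pow_inv act_pow[symmetric])
  qed
  then show thesis using that w by blast
qed

end

section \<open>Elements centralising the fixed points of \<open>H\<close>\<close>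

text \<open>Counting. On an orbit with nontrivial stabilisers, the nontrivial elements fixing a
  point of it number |H| - |orbit|, which is at least |H|/2. For two such orbits these sets are
  disjoint and would exceed the |H| - 1 nontrivial elements. So there is one orbit, every nontrivial
  element fixes a point of it, and the same count gives it length 1.\<close>

lemma unique_fixed_point_common:
  fixes act :: "'g::group_add \<Rightarrow> 'b \<Rightarrow> 'b"
  assumes H: "sgrp H" "finite H"
    and act: "\<And>x y b. x \<in> H \<Longrightarrow> y \<in> H \<Longrightarrow> b \<in> I \<Longrightarrow> act (x + y) b = act x (act y b)"
      "\<And>b. b \<in> I \<Longrightarrow> act 0 b = b" "\<And>x b. x \<in> H \<Longrightarrow> b \<in> I \<Longrightarrow> act x b \<in> I"
    and ex: "\<And>k. k \<in> H \<Longrightarrow> k \<noteq> 0 \<Longrightarrow> \<exists>b\<in>I. act k b = b"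
    and un: "\<And>k b c. k \<in> H \<Longrightarrow> k \<noteq> 0 \<Longrightarrow> b \<in> I \<Longrightarrow> c \<in> I \<Longrightarrow> act k b = b \<Longrightarrow> act k c = c \<Longrightarrow> b = c"
    and i: "i \<in> I" "h \<in> H" "h \<noteq> 0" "act h i = i"
    and j: "j \<in> I" "k \<in> H" "k \<noteq> 0" "act k j = j"
  shows "i = j"
proof -
  define orb where "orb b = (\<lambda>x. act x b) ` H" for b
  define St where "St b = {x \<in> H. act x b = b}" for b
  define A where "A b = (\<Union>c\<in>orb b. St c - {0})" for b
  have actm: "act (- x) (act x b) = b" "act x (act (- x) b) = b" if "x \<in> H" "b \<in> I" for x b
    using act(1)[of "- x" x b] act(1)[of x "- x" b] that act(2) H by (auto simp: sgrp_mem)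
  have finorb: "finite (orb b)" for b using H by (simp add: orb_def)
  have orbI: "orb b \<subseteq> I" if "b \<in> I" for b using act(3) that by (auto simp: orb_def)
  have St0: "0 \<in> St b" if "b \<in> I" for b using act(2) that H by (simp add: St_def sgrp_mem)
  have cardSt: "card {x \<in> H. act x b = c} = card (St b)" "card (St c) = card (St b)" if b: "b \<in> I" and c: "c \<in> orb b" for b c
  proof -
    obtain s where s: "s \<in> H" "c = act s b" using c orb_def by auto
    have sb: "act (x + s) b = act x c" if "x \<in> H" for x using act(1)[OF that s(1) b] s by simp
    have cI: "c \<in> I" using orbI b c by blast
    have "bij_betw ((+) s) (St b) {x \<in> H. act x b = c}"
    proof (rule bij_betwI[where g = "(+) (- s)"])
      show "(+) s \<in> St b \<rightarrow> {x \<in> H. act x b = c}" using s H act(1) b by (auto simp: St_def sgrp_mem)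
      show "(+) (- s) \<in> {x \<in> H. act x b = c} \<rightarrow> St b" using s H act(1) b actm by (auto simp: St_def sgrp_mem)
    qed auto
    from bij_betw_same_card[OF this] show 1: "card {x \<in> H. act x b = c} = card (St b)" by simp
    have "bij_betw (\<lambda>x. x + s) (St c) {x \<in> H. act x b = c}"
    proof (rule bij_betwI[where g = "\<lambda>x. x + - s"])
      show "(\<lambda>x. x + s) \<in> St c \<rightarrow> {x \<in> H. act x b = c}" using sb s H by (auto simp: St_def sgrp_mem)
      show "(\<lambda>x. x + - s) \<in> {x \<in> H. act x b = c} \<rightarrow> St c"
      proof clarify
        fix x assume x: "x \<in> H" "c = act x b"
        have "x + - s \<in> H" using x s H by (simp add: sgrp_mem)
        moreover from sb[OF this] have "act (x + - s) c = c" using x by (simp add: add.assoc)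
        ultimately show "x + - s \<in> St (act x b)" using x by (simp add: St_def)
      qed
    qed (auto simp: add.assoc)
    from bij_betw_same_card[OF this] show "card (St c) = card (St b)" using 1 by simp
  qed
  have cH: "card H = card (orb b) * card (St b)" if b: "b \<in> I" for b
  proof -
    have "card H = (\<Sum>c\<in>orb b. card {x \<in> H. act x b = c})"
      using sum.image_gen[OF H(2), of "\<lambda>_. 1::nat" "\<lambda>x. act x b"] by (simp add: orb_def)
    also have "\<dots> = (\<Sum>c\<in>orb b. card (St b))" using cardSt b by (intro sum.cong) auto
    finally show ?thesis by simp
  qed
  have disj: "b = c" if "b \<in> I" "c \<in> I" "x \<in> St b - {0}" "x \<in> St c - {0}" for b c x
    using un[of x b c] that by (auto simp: St_def)
  have cA: "card (A b) + card (orb b) = card H" if b: "b \<in> I" for b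
  proof -
    have "card (A b) = (\<Sum>c\<in>orb b. card (St c - {0}))"
      unfolding A_def
    proof (rule card_UN_disjoint)
      show "\<forall>c\<in>orb b. \<forall>d\<in>orb b. c \<noteq> d \<longrightarrow> (St c - {0}) \<inter> (St d - {0}) = {}" using disj orbI[OF b] by blast
    qed (use finorb H in \<open>auto simp: St_def\<close>)
    also have "\<dots> = (\<Sum>c\<in>orb b. card (St b) - 1)"
      using cardSt(2)[OF b] St0 orbI[OF b] by (intro sum.cong) (auto simp: subset_iff)
    also have "\<dots> = card (orb b) * (card (St b) - 1)" by simp
    finally have "card (A b) = card (orb b) * (card (St b) - 1)" .
    moreover have "card (St b) > 0" using St0[OF b] H card_gt_0_iff[of "St b"] by (auto simp: St_def)
    ultimately show ?thesis using cH[OF b] by (cases "card (St b)") auto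
  qed
  have big: "2 * card (orb b) \<le> card H" if b: "b \<in> I" and x: "x \<in> H" "x \<noteq> 0" "act x b = b" for b x
  proof -
    have "{0, x} \<subseteq> St b" using St0[OF b] x by (auto simp: St_def)
    then have "card {0, x} \<le> card (St b)" using H by (intro card_mono) (auto simp: St_def)
    then have "2 \<le> card (St b)" using x by simp
    then show ?thesis using cH[OF b] by (metis mult.commute mult_le_mono2)
  qed
  have sub: "A b \<subseteq> H - {0}" for b by (auto simp: A_def St_def)
  have fH: "finite (H - {0})" using H by simp
  have cH0: "card (H - {0}) + 1 = card H" using card_Suc_Diff1[OF H(2) sgrp_zero[OF H(1)]] by simp
  have same: "c \<in> orb b" if "b \<in> I" "x \<in> H" "x \<noteq> 0" "act x b = b" "c \<in> I" "y \<in> H" "y \<noteq> 0" "act y c = c" for b c x y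
  proof (rule ccontr)
    assume nc: "c \<notin> orb b"
    have "orb b \<inter> orb c = {}"
    proof (rule ccontr)
      assume "orb b \<inter> orb c \<noteq> {}"
      then obtain s t where st: "s \<in> H" "t \<in> H" "act s b = act t c" by (auto simp: orb_def)
      have "act (- t + s) b = c" using act(1)[of "- t" s b] st that actm H by (simp add: sgrp_mem)
      moreover have "- t + s \<in> H" using st H by (simp add: sgrp_mem)
      ultimately show False using nc by (auto simp: orb_def)
    qed
    then have "A b \<inter> A c = {}" using disj orbI[OF that(1)] orbI[OF that(5)] unfolding A_def by blast
    moreover have fin: "finite (A b)" "finite (A c)" using sub fH finite_subset by blast+
    ultimately have "card (A b) + card (A c) = card (A b \<union> A c)" by (simp add: card_Un_disjoint)
    also have "\<dots> \<le> card (H - {0})" using sub fH by (intro card_mono) auto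
    finally show False using cA[OF that(1)] cA[OF that(5)] big[OF that(1-4)] big[OF that(5-8)] cH0 by linarith
  qed
  have "H - {0} \<subseteq> A i"
  proof
    fix x assume x: "x \<in> H - {0}"
    then obtain b where b: "b \<in> I" "act x b = b" using ex by blast
    then have "b \<in> orb i" using same[OF i b(1)] x by blast
    then show "x \<in> A i" using x b by (auto simp: A_def St_def)
  qed
  then have "A i = H - {0}" using sub by blast
  then have "card (orb i) = 1" using cA[OF i(1)] cH0 by simp
  moreover have "i \<in> orb i" using act(2)[OF i(1)] sgrp_zero[OF H(1)] by (force simp: orb_def)
  moreover have "j \<in> orb i" using same[OF i j] .
  ultimately show ?thesis by (metis card_1_singletonE singletonD)
qed

text \<open>\<open>H0\<close> is the stabiliser in H of the F-orbit \<open>I\<close> of b. Each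
  nontrivial element of \<open>H0\<close> fixes exactly one point of \<open>I\<close>: bijectivity
  of the commutator map on F gives existence, on a stabiliser in F uniqueness. Then
  \<open>unique_fixed_point_common\<close> applies.\<close>

lemma frobenius_orbit_fixed_point:
  fixes act :: "'g::group_add \<Rightarrow> 'b \<Rightarrow> 'b"
  assumes F: "sgrp F" "finite F" and H: "sgrp H" "finite H" and n: "nmz H F"
    and fpf: "\<And>h f. h \<in> H \<Longrightarrow> h \<noteq> 0 \<Longrightarrow> f \<in> F \<Longrightarrow> h + f = f + h \<Longrightarrow> f = 0"
    and act: "\<And>x y b. act (x + y) b = act x (act y b)" "\<And>b. act 0 b = b"
    and h: "h \<in> H" "h \<noteq> 0" "act h b = b" and f: "f \<in> F"
    and k: "k \<in> H" "k \<noteq> 0" "act k (act f b) = act f b"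
  shows "act f b = b"
proof -
  have actm: "act (- x) (act x c) = c" "act x (act (- x) c) = c" for x c
    using act(1)[of "- x" x c] act(1)[of x "- x" c] act(2) by auto
  define I where "I = (\<lambda>f. act f b) ` F"
  define H0 where "H0 = {k \<in> H. act k b \<in> I}"
  have kf: "act k (act f c) = act (cj k f) (act k c)" for k f c
    by (simp add: act(1)[symmetric] cj_def add.assoc)
  have cjF: "cj k f \<in> F" if "k \<in> H" "f \<in> F" for k f using n that by (simp add: nmzD)
  have FI: "act f c \<in> I" if "f \<in> F" "c \<in> I" for f c
    using that F unfolding I_def by (auto simp: act(1)[symmetric] intro!: imageI sgrp_add)
  have H0I: "act k c \<in> I" if "k \<in> H0" "c \<in> I" for k c
  proof -
    obtain g where g: "g \<in> F" "c = act g b" using \<open>c \<in> I\<close> by (auto simp: I_def)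
    then have "act k c = act (cj k g) (act k b)" using kf[of k g b] by (simp only:)
    then show ?thesis using FI[OF cjF] g that by (simp add: H0_def)
  qed
  have bI: "b \<in> I" using act(2)[of b] sgrp_zero[OF F(1)] by (force simp: I_def)
  have H0: "sgrp H0"
  proof (rule sgrpI)
    show "0 \<in> H0" using bI H by (simp add: H0_def act(2) sgrp_mem)
    show "x + y \<in> H0" if "x \<in> H0" "y \<in> H0" for x y
      using H0I[OF that(1), of "act y b"] that H by (auto simp: H0_def act(1) sgrp_mem)
    show "- x \<in> H0" if "x \<in> H0" for x
    proof -
      have x: "x \<in> H" "- x \<in> H" using that H by (auto simp: H0_def sgrp_mem)
      obtain g where g: "g \<in> F" "act x b = act g b" using \<open>x \<in> H0\<close> by (auto simp: H0_def I_def)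
      then have "b = act (- x) (act g b)" using actm by metis
      then have "b = act (cj (- x) g) (act (- x) b)" using kf by metis
      then have "act (- cj (- x) g) b = act (- x) b" using actm by metis
      moreover have "- cj (- x) g \<in> F" using cjF[OF x(2) g(1)] F by (simp add: sgrp_mem)
      ultimately have "act (- x) b \<in> I" unfolding I_def by (intro image_eqI[of _ _ "- cj (- x) g"]) auto
      then show ?thesis using x by (simp add: H0_def)
    qed
  qed
  have hk: "h \<in> H0" "k \<in> H0"
  proof -
    show "h \<in> H0" using h bI by (simp add: H0_def)
    have "act f b = act (cj k f) (act k b)" using k kf by metis
    then have "act (- cj k f) (act f b) = act k b" using actm by metis
    then have "act (- cj k f + f) b = act k b" using act(1) by metis
    moreover have "- cj k f + f \<in> F" using cjF[OF k(1) f] F f by (simp add: sgrp_mem)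
    ultimately have "act k b \<in> I" unfolding I_def by (intro image_eqI[of _ _ "- cj k f + f"]) auto
    then show "k \<in> H0" using k by (simp add: H0_def)
  qed
  have lang: "bij_betw (\<lambda>q. cm q k) Q Q" if "k \<in> H0" "k \<noteq> 0" "sgrp Q" "Q \<subseteq> F" "\<And>q. q \<in> Q \<Longrightarrow> cj k q \<in> Q" for Q k
    by (rule fixed_point_free_bij) (use that fpf F finite_subset in \<open>auto simp: H0_def\<close>)
  have ex: "\<exists>c\<in>I. act k c = c" if kk: "k \<in> H0" "k \<noteq> 0" for k
  proof -
    have kH: "k \<in> H" using kk by (simp add: H0_def)
    obtain g where g: "g \<in> F" "act k b = act g b" using kk by (auto simp: H0_def I_def)
    \<comment> \<open>The element \<open>- g + k\<close> fixes \<open>b\<close>. Writing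
      \<open>- g\<close> as a commutator [q, k] turns it into a conjugate of \<open>k\<close>, so
      \<open>k\<close> fixes a translate of \<open>b\<close>.\<close>
    have "- g \<in> (\<lambda>q. cm q k) ` F"
      using bij_betw_imp_surj_on[OF lang[OF kk F(1) order_refl]] cjF kH g F by (simp add: sgrp_mem)
    then obtain q where q: "q \<in> F" "- g = cm q k" by blast
    have "act (- g + k) b = b" using act(1)[of "- g" k b] g actm by metis
    then have "act (cj q k) b = b" using q by (simp add: cj_cm)
    then have "act q (act k (act (- q) b)) = b" by (simp add: cj_def act(1))
    then have "act k (act (- q) b) = act (- q) b" using actm by metis
    moreover have "act (- q) b \<in> I" using q F by (auto simp: I_def sgrp_mem)
    ultimately show ?thesis by blast
  qed
  have un: "c = d" if kk: "k \<in> H0" "k \<noteq> 0" and cd: "c \<in> I" "d \<in> I" "act k c = c" "act k d = d" for k c d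
  proof -
    have kH: "k \<in> H" using kk by (simp add: H0_def)
    obtain q1 q2 where q12: "q1 \<in> F" "q2 \<in> F" "c = act q1 b" "d = act q2 b" using cd by (auto simp: I_def)
    define q where "q = q2 + - q1"
    have q: "q \<in> F" "d = act q c" using q12 F actm by (auto simp: q_def sgrp_mem act(1))
    \<comment> \<open>Both \<open>k\<close> and its conjugate by \<open>- q\<close> fix
      \<open>c\<close>, so [- q, k] lies in the stabiliser of \<open>c\<close>. Surjectivity of the
      commutator map there and injectivity on F put \<open>- q\<close> into this stabiliser.\<close>
    let ?S = "{g \<in> F. act g c = c}"
    have S: "sgrp ?S"
    proof (rule sgrpI)
      show "- x \<in> ?S" if "x \<in> ?S" for x using that actm(1)[of x c] F by (simp add: sgrp_mem)
    qed (use F act in \<open>auto simp: sgrp_mem\<close>)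
    have cS: "cj k g \<in> ?S" if "g \<in> ?S" for g
      using that kf[of k g c] cd cjF kH by simp
    have "act (cj (- q) k) c = c"
      using q cd(4) actm by (simp add: cj_def act(1))
    then have "act (cm (- q) k) c = c"
      using cd(3) by (metis cm_cj act(1) actm(1))
    moreover have cmF: "cm (- q) k \<in> F" using q cjF[OF kH] F by (simp add: cm_cj' cj_uminus sgrp_mem)
    ultimately have "cm (- q) k \<in> (\<lambda>q. cm q k) ` ?S"
      using bij_betw_imp_surj_on[OF lang[OF kk S]] cS by auto
    then obtain s where s: "s \<in> ?S" "cm (- q) k = cm s k" by blast
    have "- q = s"
      using bij_betw_imp_inj_on[OF lang[OF kk F(1) order_refl]] cjF kH s q F
      by (simp add: inj_on_def sgrp_mem)
    then have "act (- q) c = c" using s by simp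
    then show "c = d" using q actm by metis
  qed
  have "b = act f b"
  proof (rule unique_fixed_point_common[where H = H0 and I = I and act = act and h = h and k = k])
    show "\<exists>c\<in>I. act k c = c" if "k \<in> H0" "k \<noteq> 0" for k using ex that .
    show "c = d" if "k \<in> H0" "k \<noteq> 0" "c \<in> I" "d \<in> I" "act k c = c" "act k d = d" for k c d
      using un that .
    show "sgrp H0" "finite H0" using H0 H by (auto simp: H0_def)
    show "b \<in> I" "h \<in> H0" "h \<noteq> 0" "act h b = b" "act f b \<in> I" "k \<in> H0" "k \<noteq> 0" "act k (act f b) = act f b"
      using bI hk h k f by (auto simp: I_def)
  qed (use act H0I in auto)
  then show ?thesis by simp
qed

section \<open>Blocks of V under a central elementary abelian p-group\<close>

lemma cj_image: "cj x ` cj y ` B = cj (x + y) ` B" "cj 0 ` B = B"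
  by (simp_all add: image_image cj_cj)

lemma cj_image_mem: "cj x y \<in> cj x ` B \<longleftrightarrow> y \<in> B"
  by (auto simp: image_iff)

lemma cj_mem_image: "y \<in> cj x ` B \<longleftrightarrow> cj (- x) y \<in> B"
  by (auto simp: image_iff) (metis cj_inverse(2))

lemma (in comm_monoid) finprod_fibers:
  assumes "finite A" "\<And>a. a \<in> A \<Longrightarrow> f a \<in> carrier G"
  shows "(\<Otimes>b\<in>g ` A. \<Otimes>a\<in>{a \<in> A. g a = b}. f a) = (\<Otimes>a\<in>A. f a)"
proof -
  have "(\<Otimes>a\<in>\<Union>((\<lambda>b. {a \<in> A. g a = b}) ` g ` A). f a) = (\<Otimes>b\<in>g ` A. \<Otimes>a\<in>{a \<in> A. g a = b}. f a)"
    by (rule finprod_UN_disjoint) (use assms in \<open>auto simp: pairwise_def disjnt_def\<close>)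
  moreover have "\<Union>((\<lambda>b. {a \<in> A. g a = b}) ` g ` A) = A" by blast
  ultimately show ?thesis by simp
qed

text \<open>The assumption \<open>star\<close> is what remains of the Carter property of \<open>F\<close>: modulo \<open>S\<close>, an element
  centralised by \<open>F\<close> lies in \<open>F\<close>, where \<open>h\<close> has no fixed points.\<close>

locale frobenius_core = abelian_action V Y \<phi> for V (structure) and Y :: "'g::group_add set" and \<phi> +
  fixes R F H K :: "'g set" and p :: nat and a0 :: 'g
  assumes R: "sgrp R" "R \<subseteq> Y" and F: "sgrp F" "F \<subseteq> Y" and H: "sgrp H" "H \<subseteq> Y"
    and nR: "nmz F R" "nmz H R" and nF: "nmz H F"
    and fpf: "\<And>h f. h \<in> H \<Longrightarrow> h \<noteq> 0 \<Longrightarrow> f \<in> F \<Longrightarrow> h + f = f + h \<Longrightarrow> f = 0"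
    and KR: "K \<subseteq> R" and KH: "\<And>x h. x \<in> K \<Longrightarrow> h \<in> H \<Longrightarrow> x + h = h + x"
    and Kfix: "\<And>x v. x \<in> K \<Longrightarrow> v \<in> fix_set H \<Longrightarrow> \<phi> x v = v"
    and Rgen: "R \<subseteq> gen ({cj f x | f x. f \<in> F \<and> x \<in> K} \<union> {x \<in> R. \<forall>v\<in>carrier V. \<phi> x v = v})"
    and p: "prime p" "divisible_by p"
    and star: "\<And>S h z. sgrp S \<Longrightarrow> S \<subseteq> R \<Longrightarrow> nmz R S \<Longrightarrow> nmz F S \<Longrightarrow> h \<in> H \<Longrightarrow> h \<noteq> 0 \<Longrightarrow> nmz {h} S \<Longrightarrow>
      z \<in> R \<Longrightarrow> (\<And>f. f \<in> F \<Longrightarrow> cm f z \<in> S) \<Longrightarrow> cm h z \<in> S \<Longrightarrow> z \<in> S"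
    and a0: "a0 \<in> R" "\<And>y v. y \<in> R \<Longrightarrow> v \<in> carrier V \<Longrightarrow> \<phi> a0 (\<phi> y v) = \<phi> y (\<phi> a0 v)"
      "\<And>v. v \<in> carrier V \<Longrightarrow> \<phi> (nm p a0) v = v" "\<exists>v\<in>carrier V. \<phi> a0 v \<noteq> v"
begin

definition E :: "'g set" where "E = {x \<in> R. \<forall>v\<in>carrier V. \<phi> x v = v}"

text \<open>Modulo the kernel \<open>E\<close> these are the central elements of order dividing p.
  Both conditions are imposed on the action on V, so R/E is never formed.\<close>

definition A :: "'g set" where
  "A = {a \<in> R. (\<forall>y\<in>R. \<forall>v\<in>carrier V. \<phi> a (\<phi> y v) = \<phi> y (\<phi> a v)) \<and> (\<forall>v\<in>carrier V. \<phi> (nm p a) v = v)}"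

lemma RY: "x \<in> R \<Longrightarrow> x \<in> Y" and FY: "x \<in> F \<Longrightarrow> x \<in> Y" and HY: "x \<in> H \<Longrightarrow> x \<in> Y"
  using R F H by auto

lemma Ym: "x \<in> Y \<Longrightarrow> - x \<in> Y" "x \<in> Y \<Longrightarrow> y \<in> Y \<Longrightarrow> x + y \<in> Y" "0 \<in> Y" "x \<in> Y \<Longrightarrow> y \<in> Y \<Longrightarrow> cj x y \<in> Y"
  "x \<in> Y \<Longrightarrow> y \<in> Y \<Longrightarrow> cm x y \<in> Y" "x \<in> Y \<Longrightarrow> nm n x \<in> Y"
  using Y by (auto simp: sgrp_mem sgrp_cj sgrp_cm nm_in)

lemma A_R: "a \<in> A \<Longrightarrow> a \<in> R" and A_Y: "a \<in> A \<Longrightarrow> a \<in> Y"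
  and A_comm: "a \<in> A \<Longrightarrow> y \<in> R \<Longrightarrow> v \<in> carrier V \<Longrightarrow> \<phi> a (\<phi> y v) = \<phi> y (\<phi> a v)"
  and A_p: "a \<in> A \<Longrightarrow> v \<in> carrier V \<Longrightarrow> \<phi> (nm p a) v = v"
  using RY by (auto simp: A_def)

lemma p_pos: "p > 0"
  using p prime_gt_0_nat by blast

lemma act_nm_add:
  assumes "a \<in> Y" "b \<in> Y" "\<And>v. v \<in> carrier V \<Longrightarrow> \<phi> a (\<phi> b v) = \<phi> b (\<phi> a v)" "v \<in> carrier V"
  shows "\<phi> (nm n (a + b)) v = \<phi> (nm n a) (\<phi> (nm n b) v)"
  using assms(4)
proof (induct n arbitrary: v)
  case (Suc n)
  have c: "\<phi> (nm n a) (\<phi> b v) = \<phi> b (\<phi> (nm n a) v)" if "v \<in> carrier V" for v n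
    using that by (induct n arbitrary: v) (simp_all add: act_add assms Ym)
  have "\<phi> (nm (Suc n) (a + b)) v = \<phi> a (\<phi> b (\<phi> (nm n a) (\<phi> (nm n b) v)))"
    using Suc assms by (simp add: act_add Ym)
  also have "\<dots> = \<phi> (nm (Suc n) a) (\<phi> (nm (Suc n) b) v)"
    using Suc assms c by (simp add: act_add Ym)
  finally show ?case .
qed simp

lemma A_sgrp: "sgrp A"
proof (rule sgrpI)
  show "0 \<in> A" using R by (auto simp: A_def sgrp_mem RY)
  show "x + y \<in> A" if xy: "x \<in> A" "y \<in> A" for x y
  proof -
    have Y': "x \<in> Y" "y \<in> Y" "x + y \<in> R" using xy A_Y A_R R by (auto simp: sgrp_mem)
    have "\<phi> (x + y) (\<phi> z v) = \<phi> z (\<phi> (x + y) v)" if "z \<in> R" "v \<in> carrier V" for z v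
      using that Y' RY A_comm[OF xy(1) that(1)] A_comm[OF xy(2) that(1)] by (simp add: act_add)
    moreover have "\<phi> (nm p (x + y)) v = v" if "v \<in> carrier V" for v
      using act_nm_add[OF Y'(1,2) A_comm[OF xy(1) A_R[OF xy(2)]] that, of p] A_p xy that by simp
    ultimately show ?thesis using Y' by (simp add: A_def)
  qed
  show "- x \<in> A" if x: "x \<in> A" for x
  proof -
    have xR: "x \<in> R" "- x \<in> R" using x A_R R by (auto simp: sgrp_mem)
    have "\<phi> (- x) (\<phi> y v) = \<phi> y (\<phi> (- x) v)" if "y \<in> R" "v \<in> carrier V" for y v
    proof -
      have "\<phi> x (\<phi> y (\<phi> (- x) v)) = \<phi> y v" using A_comm[OF x that(1), of "\<phi> (- x) v"] that xR RY by simp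
      then have "\<phi> (- x) (\<phi> x (\<phi> y (\<phi> (- x) v))) = \<phi> (- x) (\<phi> y v)" by simp
      then show ?thesis using that xR RY by simp
    qed
    moreover have "\<phi> (nm p (- x)) v = v" if "v \<in> carrier V" for v
      using act_uminus(1)[of "nm p x" v] A_p[OF x that] that A_Y[OF x] by (simp add: nm_uminus Ym)
    ultimately show ?thesis using xR by (auto simp: A_def)
  qed
qed

lemma A_cj:
  assumes x: "x \<in> F \<or> x \<in> H \<or> x \<in> R" and a: "a \<in> A"
  shows "cj x a \<in> A"
proof -
  have xY: "x \<in> Y" "- x \<in> Y" using x F H R Y by (auto simp: sgrp_mem)
  have nx: "cj x y \<in> R" "cj (- x) y \<in> R" if "y \<in> R" for y
    using x that nR R F H by (auto simp: nmzD sgrp_mem sgrp_cj)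
  have aY: "a \<in> Y" using a A_Y by blast
  have "\<phi> (cj x a) (\<phi> y v) = \<phi> y (\<phi> (cj x a) v)" if y: "y \<in> R" and v: "v \<in> carrier V" for y v
  proof -
    let ?y = "cj (- x) y" and ?v = "\<phi> (- x) v"
    have yY: "?y \<in> Y" "?y \<in> R" using nx[OF y] RY by auto
    have e: "\<phi> y v = \<phi> x (\<phi> ?y ?v)" using act_cj[of x ?y v] xY yY v by simp
    have "\<phi> (cj x a) (\<phi> y v) = \<phi> x (\<phi> a (\<phi> ?y ?v))" unfolding e using xY yY v aY by (simp add: act_cj)
    also have "\<dots> = \<phi> x (\<phi> ?y (\<phi> a ?v))" using A_comm[OF a yY(2), of ?v] xY v by simp
    also have "\<dots> = \<phi> y (\<phi> (cj x a) v)"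
      using act_cj[of x ?y "\<phi> x (\<phi> a ?v)"] xY yY v aY by (simp add: act_cj)
    finally show ?thesis .
  qed
  moreover have "\<phi> (nm p (cj x a)) v = v" if "v \<in> carrier V" for v
    using A_p[OF a, of "\<phi> (- x) v"] that xY aY by (simp add: nm_cj act_cj Ym)
  ultimately show ?thesis using nx A_R[OF a] by (auto simp: A_def)
qed

lemma E_A: "E \<subseteq> A"
proof
  fix x assume x: "x \<in> E"
  then have "x \<in> R" "\<And>v. v \<in> carrier V \<Longrightarrow> \<phi> x v = v" by (auto simp: E_def)
  moreover have "\<phi> (nm n x) v = v" if "v \<in> carrier V" for v n
    using that calculation RY by (induct n) (simp_all add: act_add Ym)
  ultimately show "x \<in> A" by (auto simp: A_def RY)
qed

lemma E_cj: "x \<in> F \<or> x \<in> H \<or> x \<in> R \<Longrightarrow> e \<in> E \<Longrightarrow> cj x e \<in> E"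
  using nR R F H by (auto simp: E_def nmzD sgrp_cj act_cj RY FY HY Ym)

lemma E_sgrp: "sgrp E"
proof (rule sgrpI)
  show "- x \<in> E" if "x \<in> E" for x
  proof -
    have xR: "x \<in> R" "- x \<in> R" using that R by (auto simp: E_def sgrp_mem)
    moreover have "\<phi> (- x) v = v" if "v \<in> carrier V" for v
      using act_uminus(1)[OF RY[OF xR(1)] that] \<open>x \<in> E\<close> that by (simp add: E_def)
    ultimately show ?thesis by (simp add: E_def)
  qed
qed (use R RY in \<open>auto simp: E_def sgrp_mem act_add\<close>)

lemma cm_A_E: "a \<in> A \<Longrightarrow> b \<in> A \<Longrightarrow> cm a b \<in> E"
proof -
  assume ab: "a \<in> A" "b \<in> A"
  have Y': "a \<in> Y" "b \<in> Y" "cm a b \<in> R" using ab A_Y A_R R by (auto simp: sgrp_cm)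
  have "\<phi> (cm a b) v = v" if "v \<in> carrier V" for v
  proof -
    let ?v = "\<phi> (- a) (\<phi> (- b) v)"
    have "\<phi> (cm a b) v = \<phi> a (\<phi> b ?v)" using Y' that by (simp add: cm_def act_add Ym)
    also have "\<dots> = \<phi> b (\<phi> a ?v)" using A_comm[OF ab(1) A_R[OF ab(2)], of ?v] Y' that by (simp add: Ym)
    finally show ?thesis using Y' that by (simp add: Ym)
  qed
  then show "cm a b \<in> E" using Y' by (simp add: E_def)
qed

lemma act_nm_mod: assumes "a \<in> A" "v \<in> carrier V" shows "\<phi> (nm (n mod p) a) v = \<phi> (nm n a) v"
proof -
  have aY: "a \<in> Y" using A_Y assms by blast
  have 1: "\<phi> (nm (p * k) a) v = v" if "v \<in> carrier V" for k v
  proof (induct k)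
    case (Suc k)
    have "\<phi> (nm (p * Suc k) a) v = \<phi> (nm p a) (\<phi> (nm (p * k) a) v)"
      using aY that by (simp add: nm_add act_add Ym)
    then show ?case using Suc A_p assms that by simp
  qed (use that in simp)
  have "\<phi> (nm n a) v = \<phi> (nm (p * (n div p) + n mod p) a) v" by simp
  also have "\<dots> = \<phi> (nm (p * (n div p)) a) (\<phi> (nm (n mod p) a) v)"
    unfolding nm_add using aY assms by (intro act_add) (auto simp: Ym)
  also have "\<dots> = \<phi> (nm (n mod p) a) v" using 1 aY assms by (simp add: Ym)
  finally show ?thesis by simp
qed

text \<open>The trace over the cyclic group induced by \<open>a\<close>. It is the p-th power on
  vectors fixed by \<open>a\<close>, and for \<open>a\<close> in \<open>A\<close> its values are
  fixed by \<open>a\<close>; hence its vanishing on a block excludes nontrivial fixed vectors of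
  \<open>a\<close> there, without any appeal to roots of unity.\<close>

definition T :: "'g \<Rightarrow> 'a \<Rightarrow> 'a" where "T a v = (\<Otimes>i\<in>{..<p}. \<phi> (nm i a) v)"

lemma T_closed [simp, intro]: "a \<in> Y \<Longrightarrow> v \<in> carrier V \<Longrightarrow> T a v \<in> carrier V"
  unfolding T_def by (intro finprod_closed) (auto simp: Ym)

lemma T_mult:
  assumes "a \<in> Y" "v \<in> carrier V" "w \<in> carrier V" shows "T a (v \<otimes> w) = T a v \<otimes> T a w"
proof -
  have "T a (v \<otimes> w) = (\<Otimes>i\<in>{..<p}. \<phi> (nm i a) v \<otimes> \<phi> (nm i a) w)"
    unfolding T_def using assms by (intro finprod_cong') (auto simp: act_mult Ym)
  also have "\<dots> = T a v \<otimes> T a w" unfolding T_def using assms by (intro finprod_multf) (auto simp: Ym)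
  finally show ?thesis .
qed

lemma T_one [simp]: "a \<in> Y \<Longrightarrow> T a \<one> = \<one>"
  unfolding T_def by (rule finprod_one_eqI) (simp add: Ym)

lemma T_inv: "a \<in> Y \<Longrightarrow> v \<in> carrier V \<Longrightarrow> T a (inv v) = inv T a v"
  using T_mult[of a "inv v" v] by (metis T_closed T_one inv_closed inv_equality l_inv)

lemma T_finprod:
  assumes "a \<in> Y" "\<And>s. s \<in> S \<Longrightarrow> f s \<in> carrier V"
  shows "T a (\<Otimes>s\<in>S. f s) = (\<Otimes>s\<in>S. T a (f s))"
  using assms(2)
proof (induct S rule: infinite_finite_induct)
  case (insert x S)
  then show ?case using assms(1) by (simp add: Pi_def T_mult)
qed (use assms in simp_all)

lemma T_act: assumes "x \<in> Y" "a \<in> Y" "v \<in> carrier V" shows "\<phi> x (T a v) = T (cj x a) (\<phi> x v)"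
proof -
  have "\<phi> x (T a v) = (\<Otimes>i\<in>{..<p}. \<phi> x (\<phi> (nm i a) v))"
    unfolding T_def using assms by (intro act_finprod) (auto simp: Ym)
  also have "\<dots> = T (cj x a) (\<phi> x v)"
    unfolding T_def using assms by (intro finprod_cong') (auto simp: nm_cj act_cj' Ym)
  finally show ?thesis .
qed

lemma T_comm: assumes "y \<in> R" "a \<in> A" "v \<in> carrier V" shows "\<phi> y (T a v) = T a (\<phi> y v)"
proof -
  have "\<phi> y (T a v) = (\<Otimes>i\<in>{..<p}. \<phi> y (\<phi> (nm i a) v))"
    unfolding T_def using assms RY A_Y by (intro act_finprod) (auto simp: Ym)
  also have "\<dots> = T a (\<phi> y v)"
    unfolding T_def using assms RY A_Y A_comm[OF nm_in[OF A_sgrp assms(2)]]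
    by (intro finprod_cong') (auto simp: Ym)
  finally show ?thesis .
qed

lemma T_fixed: "a \<in> Y \<Longrightarrow> v \<in> carrier V \<Longrightarrow> \<phi> a v = v \<Longrightarrow> T a v = v [^] p"
proof -
  assume a: "a \<in> Y" "v \<in> carrier V" "\<phi> a v = v"
  then have "\<phi> (nm i a) v = v" for i by (induct i) (simp_all add: act_add Ym)
  then show "T a v = v [^] p" using a by (simp add: T_def finprod_const)
qed

lemma act_T: assumes "a \<in> A" "v \<in> carrier V" shows "\<phi> a (T a v) = T a v"
proof -
  have aY: "a \<in> Y" using A_Y assms by blast
  obtain q where q: "p = Suc q" using p_pos by (metis gr0_implies_Suc)
  have "\<phi> a (T a v) = (\<Otimes>i\<in>{..<Suc q}. \<phi> (nm (Suc i) a) v)"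
    unfolding T_def q[symmetric] using assms aY by (subst act_finprod) (auto intro!: finprod_cong' simp: act_add Ym)
  also have "\<dots> = (\<Otimes>i\<in>{..<q}. \<phi> (nm (Suc i) a) v) \<otimes> \<phi> (nm (Suc q) a) v"
    using assms aY unfolding lessThan_Suc by (subst finprod_insert) (auto simp: Ym m_comm)
  also have "\<phi> (nm (Suc q) a) v = v" using A_p assms q by metis
  also have "(\<Otimes>i\<in>{..<q}. \<phi> (nm (Suc i) a) v) = (\<Otimes>i\<in>Suc ` {..<q}. \<phi> (nm i a) v)"
    using assms aY by (subst finprod_reindex) (auto simp: Ym)
  also have "\<dots> \<otimes> v = (\<Otimes>i\<in>insert 0 (Suc ` {..<q}). \<phi> (nm i a) v)"
    using assms aY by (subst finprod_insert) (auto simp: Ym m_comm)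
  also have "insert 0 (Suc ` {..<q}) = {..<p}" unfolding q by (auto simp: image_iff less_Suc_eq_0_disj)
  finally show ?thesis by (simp add: T_def)
qed

text \<open>\<open>HB B\<close> says that \<open>B\<close> has index \<open>p\<close> in \<open>A\<close>, a group acting on \<open>V\<close> as an elementary abelian
  \<open>p\<close>-group; \<open>W B\<close> is the sum of the eigenspaces of \<open>A\<close> whose kernel is \<open>B\<close>.\<close>

definition HB :: "'g set \<Rightarrow> bool" where
  "HB B \<longleftrightarrow> sgrp B \<and> E \<subseteq> B \<and> B \<subset> A \<and> (\<forall>a\<in>A - B. \<forall>b\<in>A. \<exists>i. nm i a + b \<in> B)"

definition W :: "'g set \<Rightarrow> 'a set" where
  "W B = {v \<in> carrier V. (\<forall>b\<in>B. \<phi> b v = v) \<and> (\<forall>a\<in>A - B. T a v = \<one>)}"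

lemma HBD: "HB B \<Longrightarrow> sgrp B" "HB B \<Longrightarrow> E \<subseteq> B" "HB B \<Longrightarrow> B \<subseteq> A" "HB B \<Longrightarrow> b \<in> B \<Longrightarrow> b \<in> A"
  by (auto simp: HB_def)

lemma HB_ex: "HB B \<Longrightarrow> \<exists>a. a \<in> A \<and> a \<notin> B"
  by (auto simp: HB_def)

lemma WV: "v \<in> W B \<Longrightarrow> v \<in> carrier V" and WB: "v \<in> W B \<Longrightarrow> b \<in> B \<Longrightarrow> \<phi> b v = v"
  and WT: "v \<in> W B \<Longrightarrow> a \<in> A \<Longrightarrow> a \<notin> B \<Longrightarrow> T a v = \<one>"
  by (auto simp: W_def)

lemma W_fpf: "a \<in> A \<Longrightarrow> a \<notin> B \<Longrightarrow> v \<in> W B \<Longrightarrow> \<phi> a v = v \<Longrightarrow> v = \<one>"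
  using T_fixed[of a v] WT[of v B a] WV[of v B] A_Y[of a] p(2) by (simp add: divisible_by_def)

lemma W_mult: "HB B \<Longrightarrow> v \<in> W B \<Longrightarrow> w \<in> W B \<Longrightarrow> v \<otimes> w \<in> W B"
  using A_Y HBD by (auto simp: W_def act_mult T_mult subset_iff)

lemma W_inv: "HB B \<Longrightarrow> v \<in> W B \<Longrightarrow> inv v \<in> W B"
  using A_Y HBD by (auto simp: W_def act_inv T_inv subset_iff)

lemma W_one: "HB B \<Longrightarrow> \<one> \<in> W B"
  using A_Y HBD by (auto simp: W_def subset_iff)

lemma W_finprod: "HB B \<Longrightarrow> (\<And>s. s \<in> S \<Longrightarrow> f s \<in> W B) \<Longrightarrow> (\<Otimes>s\<in>S. f s) \<in> W B"
proof (induct S rule: infinite_finite_induct)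
  case (insert x S)
  then have "f x \<in> carrier V" "f \<in> S \<rightarrow> carrier V" using WV by blast+
  then show ?case using insert W_mult by simp
qed (simp_all add: W_one)

lemma W_R: "HB B \<Longrightarrow> y \<in> R \<Longrightarrow> v \<in> W B \<Longrightarrow> \<phi> y v \<in> W B"
proof -
  assume B: "HB B" and y: "y \<in> R" and v: "v \<in> W B"
  have "\<phi> b (\<phi> y v) = \<phi> y v" if "b \<in> B" for b
    using A_comm[OF HBD(4)[OF B that] y WV[OF v]] WB[OF v that] by simp
  moreover have "T a (\<phi> y v) = \<one>" if "a \<in> A" "a \<notin> B" for a
    using T_comm[OF y that(1) WV[OF v]] WT[OF v that] y RY by simp
  ultimately show ?thesis using WV[OF v] RY[OF y] by (simp add: W_def)
qed

lemma W_cj: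
  assumes x: "x \<in> F \<or> x \<in> H \<or> x \<in> R" and B: "HB B" and v: "v \<in> W B"
  shows "\<phi> x v \<in> W (cj x ` B)"
proof -
  have xY: "x \<in> Y" using x F H R by auto
  have mx: "- x \<in> F \<or> - x \<in> H \<or> - x \<in> R" using x F H R by (auto simp: sgrp_mem)
  have "\<phi> b (\<phi> x v) = \<phi> x v" if "b \<in> cj x ` B" for b
  proof -
    obtain c where c: "c \<in> B" "b = cj x c" using \<open>b \<in> cj x ` B\<close> by blast
    then show ?thesis using act_cj'[OF xY A_Y[OF HBD(4)[OF B c(1)]] WV[OF v]] WB[OF v c(1)] by simp
  qed
  moreover have "T a (\<phi> x v) = \<one>" if a: "a \<in> A" "a \<notin> cj x ` B" for a
  proof -
    have 1: "cj (- x) a \<in> A" using A_cj[OF mx a(1)] .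
    have 2: "cj (- x) a \<notin> B" using a(2) by (simp add: cj_mem_image)
    have "\<phi> x (T (cj (- x) a) v) = T a (\<phi> x v)" using T_act[OF xY A_Y[OF 1] WV[OF v]] by simp
    then show ?thesis using WT[OF v 1 2] xY by simp
  qed
  ultimately show ?thesis using WV[OF v] xY by (simp add: W_def)
qed

lemma HB_cj:
  assumes x: "x \<in> F \<or> x \<in> H \<or> x \<in> R" and B: "HB B"
  shows "HB (cj x ` B)"
proof -
  have mx: "- x \<in> F \<or> - x \<in> H \<or> - x \<in> R" using x F H R by (auto simp: sgrp_mem)
  have sub: "cj x ` B \<subseteq> A" using A_cj[OF x] HBD(4)[OF B] by auto
  have "E \<subseteq> cj x ` B" using E_cj[OF mx] subsetD[OF HBD(2)[OF B]] by (auto simp: cj_mem_image)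
  moreover have "cj x ` B \<noteq> A"
  proof
    assume e: "cj x ` B = A"
    obtain a where a: "a \<in> A" "a \<notin> B" using HB_ex[OF B] by blast
    then have "cj x a \<in> cj x ` B" using e A_cj[OF x] by simp
    then show False using a by (simp add: cj_image_mem)
  qed
  moreover have "\<exists>i. nm i a + b \<in> cj x ` B" if "a \<in> A - cj x ` B" "b \<in> A" for a b
  proof -
    have "cj (- x) a \<in> A - B" "cj (- x) b \<in> A" using A_cj[OF mx] that by (auto simp: cj_mem_image)
    then obtain i where "nm i (cj (- x) a) + cj (- x) b \<in> B" using B unfolding HB_def by blast
    then show ?thesis by (auto simp: cj_mem_image cj_add nm_cj)
  qed
  ultimately show ?thesis
    using sub sgrp_image[OF homo_cjfun HBD(1)[OF B] order_refl HBD(1)[OF B]] by (auto simp: HB_def)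
qed

lemma HB_diff:
  assumes B: "HB B" and C: "HB C" and BC: "B \<noteq> C"
  obtains b where "b \<in> B" "b \<notin> C"
proof (cases "B \<subseteq> C")
  case True
  then obtain a where a: "a \<in> C" "a \<notin> B" using BC by blast
  have "A \<subseteq> C"
  proof
    fix c assume c: "c \<in> A"
    have "a \<in> A - B" using a HBD(4)[OF C] by blast
    then obtain i where "nm i a + c \<in> B" using B c unfolding HB_def by blast
    then show "c \<in> C" using True sgrp_add_left[OF HBD(1)[OF C] nm_in[OF HBD(1)[OF C] a(1)]] by blast
  qed
  then show thesis using C by (auto simp: HB_def)
qed (use that in blast)

text \<open>For b in \<open>B0\<close> outside \<open>B1\<close>, the trace \<open>T b\<close> kills
  the component at \<open>B1\<close>, preserves all blocks and is the p-th power at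
  \<open>B0\<close>. So one component is removed and induction applies.\<close>

lemma W_independent:
  assumes "finite S" "\<And>B. B \<in> S \<Longrightarrow> HB B" "\<And>B. B \<in> S \<Longrightarrow> w B \<in> W B" "(\<Otimes>B\<in>S. w B) = \<one>" "B0 \<in> S"
  shows "w B0 = \<one>"
  using assms
proof (induct "card S" arbitrary: S w B0 rule: less_induct)
  case less
  note S = less.prems
  have wV: "w B \<in> carrier V" if "B \<in> S" for B using S(3)[OF that] WV by blast
  show ?case
  proof (cases "S = {B0}")
    case True then show ?thesis using S(4) wV by simp
  next
    case False
    then obtain B1 where B1: "B1 \<in> S" "B1 \<noteq> B0" using S(5) by blast
    obtain b where b: "b \<in> B0" "b \<notin> B1" using HB_diff[OF S(2)[OF S(5)] S(2)[OF B1(1)]] B1 by blast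
    have bA: "b \<in> A" using HBD(4)[OF S(2)[OF S(5)] b(1)] .
    then have bY: "b \<in> Y" using A_Y by blast
    have TW: "T b v \<in> W B" if "HB B" "v \<in> W B" for B v
      unfolding T_def using that W_R nm_in[OF A_sgrp bA] A_R by (intro W_finprod) auto
    have "(\<Otimes>B\<in>S - {B1}. T b (w B)) = \<one>"
    proof -
      have "(\<Otimes>B\<in>insert B1 (S - {B1}). T b (w B)) = T b (w B1) \<otimes> (\<Otimes>B\<in>S - {B1}. T b (w B))"
        using S(1) wV bY B1 by (intro finprod_insert) auto
      moreover have "insert B1 (S - {B1}) = S" using B1 by blast
      moreover have "T b (w B1) = \<one>" using WT[OF S(3)[OF B1(1)] bA b(2)] .
      moreover have "(\<Otimes>B\<in>S. T b (w B)) = T b \<one>" using T_finprod[OF bY, of S w] wV S(4) by simp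
      moreover have "(\<Otimes>B\<in>S - {B1}. T b (w B)) \<in> carrier V" using wV bY by (intro finprod_closed) auto
      ultimately show ?thesis using bY by simp
    qed
    then have "T b (w B0) = \<one>"
      using less.hyps[of "S - {B1}" "\<lambda>B. T b (w B)" B0] S B1 TW card_Diff1_less[OF S(1) B1(1)] by auto
    moreover have "T b (w B0) = w B0 [^] p" using T_fixed[OF bY wV[OF S(5)]] WB[OF S(3)[OF S(5)] b(1)] by simp
    ultimately show ?thesis using p(2) wV[OF S(5)] by (simp add: divisible_by_def)
  qed
qed

end

lemma mult_mod_inj:
  assumes "coprime i p" "j < p" "k < p" "(i * j) mod p = (i * k) mod (p::nat)"
  shows "j = k"
proof -
  have *: "j = k" if "j \<le> k" "k < p" "(i * j) mod p = (i * k) mod p" for j k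
  proof -
    have "p dvd i * k - i * j" using mod_eq_dvd_iff_nat[of "i * j" "i * k" p] that by simp
    then have "p dvd k - j" using assms(1) by (simp add: diff_mult_distrib2[symmetric] coprime_dvd_mult_right_iff coprime_commute)
    then show ?thesis using that by (auto dest: dvd_imp_le)
  qed
  show ?thesis using *[of j k] *[of k j] assms by (cases "j \<le> k") auto
qed

context frobenius_core
begin

lemma fix_gen:
  assumes "B \<subseteq> Y" "v \<in> carrier V" "\<And>b. b \<in> B \<Longrightarrow> \<phi> b v = v" "x \<in> gen B"
  shows "\<phi> x v = v"
proof -
  have "x \<in> Y \<and> \<phi> x v = v"
    using assms(4)
  proof (induct rule: gen.induct)
    case (uminus x)
    then show ?case using act_uminus(1)[of x v] assms(2) by (simp add: Ym)
  qed (use assms in \<open>auto simp: Ym act_add\<close>)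
  then show ?thesis by blast
qed

text \<open>B is maximal among the subgroups between E and A that fix a vector v moved by A; so a
  vector fixed by B and by one more element of A is fixed by A. If A/B were not of order p, the
  traces along the p + 1 lines of a plane in A/B would have values fixed by A and would combine to a
  power of v, and A would fix v.\<close>

lemma ex_hyperplane: "\<exists>B v. HB B \<and> v \<in> W B \<and> v \<noteq> \<one>"
proof -
  have a0A: "a0 \<in> A" using a0 by (auto simp: A_def)
  let ?M = "{B. sgrp B \<and> E \<subseteq> B \<and> B \<subseteq> A \<and> (\<exists>v\<in>carrier V. (\<forall>b\<in>B. \<phi> b v = v) \<and> (\<exists>a\<in>A. \<phi> a v \<noteq> v))}"
  have finA: "finite A" using A_Y Y finite_subset[of A Y] by blast
  have "finite ?M" by (rule finite_subset[of _ "Pow A"]) (use finA in auto)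
  moreover have "E \<in> ?M" using a0(4) a0A E_sgrp E_A by (auto simp: E_def)
  then have "?M \<noteq> {}" by blast
  ultimately have "\<exists>B\<in>?M. \<forall>C\<in>?M. B \<subseteq> C \<longrightarrow> B = C" by (rule finite_has_maximal)
  then obtain B where BM: "B \<in> ?M" and mx0: "\<forall>C\<in>?M. B \<subseteq> C \<longrightarrow> B = C" by (elim bexE)
  have mx: "B = C" if "C \<in> ?M" "B \<subseteq> C" for C by (rule mp[OF bspec[OF mx0 that(1)] that(2)])
  from BM obtain v where B: "sgrp B" "E \<subseteq> B" "B \<subseteq> A" and v: "v \<in> carrier V" "\<And>b. b \<in> B \<Longrightarrow> \<phi> b v = v"
    and nv: "\<exists>a\<in>A. \<phi> a v \<noteq> v" by blast
  have key: "\<phi> c u = u" if u: "u \<in> carrier V" "\<And>b. b \<in> B \<Longrightarrow> \<phi> b u = u"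
    and a: "a \<in> A" "a \<notin> B" "\<phi> a u = u" and c: "c \<in> A" for u a c
  proof (rule ccontr)
    assume n: "\<phi> c u \<noteq> u"
    let ?C = "gen (insert a B)"
    have CA: "?C \<subseteq> A" using B a by (intro gen_least[OF A_sgrp]) auto
    have "\<phi> b u = u" if "b \<in> ?C" for b
      by (rule fix_gen[of "insert a B"]) (use A_Y a B u that in auto)
    moreover have "B \<subseteq> ?C" "a \<in> ?C" by (auto intro: gen.base)
    ultimately have "?C \<in> ?M" using CA B u n c sgrp_gen by blast
    then show False using mx[of ?C] \<open>B \<subseteq> ?C\<close> \<open>a \<in> ?C\<close> a by blast
  qed
  have BneA: "B \<noteq> A" using v nv by blast
  have vB: "\<phi> b (\<phi> y u) = \<phi> y u" if "y \<in> A" "b \<in> B" "u \<in> carrier V" "\<phi> b u = u" for b y u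
    using A_comm[of b y u] B A_R that by auto
  have TB: "\<phi> b (T y u) = T y u" if "y \<in> A" "b \<in> B" "u \<in> carrier V" "\<phi> b u = u" for b y u
    using T_comm[of b y u] B A_R that by auto
  have "HB B"
    unfolding HB_def
  proof (intro conjI ballI)
    fix a b assume a: "a \<in> A - B" and b: "b \<in> A"
    show "\<exists>i. nm i a + b \<in> B"
    proof (rule ccontr)
      assume no: "\<not> (\<exists>i. nm i a + b \<in> B)"
      have aY: "a \<in> Y" and bY: "b \<in> Y" using a b A_Y by auto
      \<comment> \<open>Modulo \<open>B\<close>, the elements \<open>a\<close> and \<open>b\<close>
        span a plane; its p + 1 subgroups of order p are generated by \<open>a\<close> and by these
        elements.\<close>
      define c where "c j = nm j a + b" for j
      have cA: "c j \<in> A" for j using a b A_sgrp by (simp add: c_def sgrp_mem nm_in)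
      have cB: "c j \<notin> B" for j using no by (auto simp: c_def)
      have fixT: "\<phi> x (T y v) = T y v" if "y \<in> A" "y \<notin> B" "x \<in> A" for x y
        by (rule key[of _ y]) (use that v TB act_T A_Y in auto)
      have cc: "\<phi> (nm i (c j)) v = \<phi> (nm i b) (\<phi> (nm (i * j) a) v)" for i j
      proof -
        have "\<phi> (nm j a) (\<phi> b u) = \<phi> b (\<phi> (nm j a) u)" if "u \<in> carrier V" for u
          using A_comm[OF nm_in[OF A_sgrp] A_R[OF b] that] a by blast
        then have "\<phi> (nm i (c j)) v = \<phi> (nm i (nm j a)) (\<phi> (nm i b) v)"
          unfolding c_def using aY bY v by (intro act_nm_add) (auto simp: Ym)
        also have "\<dots> = \<phi> (nm i b) (\<phi> (nm i (nm j a)) v)"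
          using A_comm[OF nm_in[OF A_sgrp nm_in[OF A_sgrp]] A_R[OF nm_in[OF A_sgrp b]] v(1)] a by blast
        finally show ?thesis by (simp add: nm_mult)
      qed
      have sumj: "(\<Otimes>j\<in>{..<p}. \<phi> (nm (i * j) a) v) = T a v" if i: "i \<in> {..<p} - {0}" for i
      proof -
        have "\<not> p dvd i" using i by (auto dest: dvd_imp_le)
        then have cop: "coprime i p" using p(1) prime_imp_coprime coprime_commute by blast
        have inj: "inj_on (\<lambda>j. (i * j) mod p) {..<p}"
          using mult_mod_inj[OF cop] by (auto intro!: inj_onI)
        have "bij_betw (\<lambda>j. (i * j) mod p) {..<p} {..<p}"
          using inj p_pos by (simp add: bij_betw_def endo_inj_surj image_subset_iff)
        from finprod_bij[OF this, of "\<lambda>n. \<phi> (nm n a) v"]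
        have "(\<Otimes>j\<in>{..<p}. \<phi> (nm ((i * j) mod p) a) v) = T a v" using aY v by (simp add: T_def Ym)
        then show ?thesis using act_nm_mod a v by simp
      qed
      have cl: "\<phi> (nm i b) (\<phi> (nm (i * j) a) v) \<in> carrier V" for i j using aY bY v by (simp add: Ym)
      \<comment> \<open>After interchanging the products, i = 0 contributes \<open>v [^] p\<close>
        and every other i a copy of \<open>T a v\<close>: multiplication by i permutes the residues
        modulo p, and \<open>nm i b\<close> fixes the trace.\<close>
      have "(\<Otimes>j\<in>{..<p}. T (c j) v) = (\<Otimes>j\<in>{..<p}. \<Otimes>i\<in>{..<p}. \<phi> (nm i b) (\<phi> (nm (i * j) a) v))"
        unfolding T_def cc by simp
      also have "\<dots> = (\<Otimes>i\<in>{..<p}. \<Otimes>j\<in>{..<p}. \<phi> (nm i b) (\<phi> (nm (i * j) a) v))"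
        by (rule finprod_swap) (use cl in auto)
      also have "\<dots> = (\<Otimes>i\<in>insert 0 ({..<p} - {0}). \<Otimes>j\<in>{..<p}. \<phi> (nm i b) (\<phi> (nm (i * j) a) v))"
        using p_pos by (simp add: insert_absorb)
      also have "\<dots> = (\<Otimes>j\<in>{..<p}. \<phi> (nm 0 b) (\<phi> (nm (0 * j) a) v)) \<otimes>
          (\<Otimes>i\<in>{..<p} - {0}. \<Otimes>j\<in>{..<p}. \<phi> (nm i b) (\<phi> (nm (i * j) a) v))"
        using cl v by (intro finprod_insert) (auto intro!: finprod_closed)
      also have "(\<Otimes>j\<in>{..<p}. \<phi> (nm 0 b) (\<phi> (nm (0 * j) a) v)) = v [^] p" using v by (simp add: finprod_const)
      also have "(\<Otimes>i\<in>{..<p} - {0}. \<Otimes>j\<in>{..<p}. \<phi> (nm i b) (\<phi> (nm (i * j) a) v)) = (\<Otimes>i\<in>{..<p} - {0}. T a v)"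
      proof (rule finprod_cong')
        fix i assume i: "i \<in> {..<p} - {0}"
        have "(\<Otimes>j\<in>{..<p}. \<phi> (nm i b) (\<phi> (nm (i * j) a) v)) = \<phi> (nm i b) (T a v)"
          unfolding sumj[OF i, symmetric] using aY bY v by (intro act_finprod[symmetric]) (auto simp: Ym)
        also have "\<dots> = T a v" using fixT a nm_in[OF A_sgrp b] by blast
        finally show "(\<Otimes>j\<in>{..<p}. \<phi> (nm i b) (\<phi> (nm (i * j) a) v)) = T a v" .
      qed (use aY v in auto)
      also have "\<dots> = T a v [^] card ({..<p} - {0})" using aY v by (simp add: finprod_const)
      finally have sum: "(\<Otimes>j\<in>{..<p}. T (c j) v) = v [^] p \<otimes> T a v [^] card ({..<p} - {0})" .
      obtain x where x: "x \<in> A" "\<phi> x v \<noteq> v" using nv by blast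
      have xY: "x \<in> Y" using x A_Y by blast
      have "\<phi> x (\<Otimes>j\<in>{..<p}. T (c j) v) = (\<Otimes>j\<in>{..<p}. \<phi> x (T (c j) v))"
        using xY cA A_Y v by (intro act_finprod) auto
      also have "\<dots> = (\<Otimes>j\<in>{..<p}. T (c j) v)"
        using fixT[OF cA cB x(1)] cA A_Y v by (intro finprod_cong') auto
      finally have "\<phi> x (v [^] p \<otimes> T a v [^] card ({..<p} - {0})) = v [^] p \<otimes> T a v [^] card ({..<p} - {0})" unfolding sum .
      then have "\<phi> x v [^] p \<otimes> T a v [^] card ({..<p} - {0}) = v [^] p \<otimes> T a v [^] card ({..<p} - {0})"
        using fixT[of a x] a x xY aY v by (simp add: act_mult act_pow)
      then have "\<phi> x v [^] p = v [^] p" using xY aY v by simp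
      then have "\<phi> x v = v" using divisible_inj[OF p(2)] xY v by simp
      then show False using x by simp
    qed
  qed (use B BneA in auto)
  moreover obtain a where a: "a \<in> A" "a \<notin> B" using B BneA by blast
  \<comment> \<open>For c outside \<open>B\<close> the trace \<open>T c v\<close> is fixed by
    \<open>a\<close>, so it cancels in \<open>T c w\<close>; this places \<open>w\<close> in the
    block.\<close>
  define w where "w = \<phi> a v \<otimes> inv v"
  have aY: "a \<in> Y" using a A_Y by blast
  have "w \<in> W B"
    unfolding W_def
  proof (intro CollectI conjI ballI)
    show "w \<in> carrier V" using aY v by (simp add: w_def)
    show "\<phi> b w = w" if "b \<in> B" for b
      using vB[OF a(1) that v(1) v(2)[OF that]] that B A_Y v aY by (auto simp: w_def act_mult act_inv)
    show "T c w = \<one>" if c: "c \<in> A - B" for c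
    proof -
      have cY: "c \<in> Y" using c A_Y by blast
      have "T c (\<phi> a v) = \<phi> a (T c v)" using T_comm[OF A_R[OF a(1)], of c v] c v by simp
      also have "\<dots> = T c v" by (rule key[of _ c]) (use a c v TB act_T A_Y in auto)
      finally show ?thesis using aY cY v by (simp add: w_def T_mult T_inv)
    qed
  qed
  moreover have "w \<noteq> \<one>"
  proof
    assume "w = \<one>"
    then have "\<phi> a v = v" using aY v unfolding w_def by (metis act_closed inv_closed inv_equality inv_inv)
    then show False using key[OF v a] nv by blast
  qed
  ultimately show ?thesis by blast
qed

text \<open>As x commutes with H and fixes the norm of w, the norm over H of
  \<open>\<phi> x w \<otimes> inv w\<close> is trivial. Its components lie in the blocks of the
  conjugates of B; the one in \<open>W B\<close> is the product over the stabiliser of B, and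
  independence makes it trivial.\<close>

lemma norm_commutator:
  assumes B: "HB B" and x: "x \<in> K" and w: "w \<in> W B"
  shows "(\<Otimes>h\<in>{h \<in> H. cj h ` B = B}. \<phi> h (\<phi> x w \<otimes> inv w)) = \<one>"
proof -
  have xR: "x \<in> R" "x \<in> Y" using x KR RY by auto
  have wV: "w \<in> carrier V" using WV w by blast
  define u where "u = \<phi> x w \<otimes> inv w"
  have uW: "u \<in> W B" unfolding u_def using W_mult[OF B W_R[OF B xR(1) w] W_inv[OF B w]] .
  then have uV: "u \<in> carrier V" using WV by blast
  have finH: "finite H" using H Y finite_subset by blast
  have "\<phi> x (N H w) = (\<Otimes>h\<in>H. \<phi> x (\<phi> h w))" unfolding N_def using xR HY wV by (intro act_finprod) auto
  also have "\<dots> = N H (\<phi> x w)"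
    unfolding N_def using xR HY wV KH[OF x] by (intro finprod_cong') (auto simp: act_add[symmetric])
  finally have "N H (\<phi> x w) = \<phi> x (N H w)" by simp
  also have "\<dots> = N H w"
    using Kfix[OF x] act_N[OF H _ wV] wV H by (auto simp: fix_set_def)
  finally have NHu: "N H u = \<one>" using xR wV H by (simp add: u_def N_mult N_inv)
  define w' where "w' C = (\<Otimes>h\<in>{h \<in> H. cj h ` B = C}. \<phi> h u)" for C
  have "w' B = \<one>"
  proof (rule W_independent[of "(\<lambda>h. cj h ` B) ` H" w'])
    show "finite ((\<lambda>h. cj h ` B) ` H)" using finH by simp
    show "HB C" if "C \<in> (\<lambda>h. cj h ` B) ` H" for C using that HB_cj B by blast
    show "w' C \<in> W C" if C: "C \<in> (\<lambda>h. cj h ` B) ` H" for C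
    proof -
      have HC: "HB C" using C HB_cj B by blast
      show ?thesis unfolding w'_def using W_cj[OF _ B uW] by (intro W_finprod[OF HC]) auto
    qed
    show "(\<Otimes>C\<in>(\<lambda>h. cj h ` B) ` H. w' C) = \<one>"
      unfolding w'_def using finprod_fibers[OF finH, of "\<lambda>h. \<phi> h u"] HY uV NHu by (simp add: N_def)
    show "B \<in> (\<lambda>h. cj h ` B) ` H" using sgrp_zero[OF H(1)] by (intro image_eqI[of _ _ 0]) (simp_all add: cj_image)
  qed
  then show ?thesis by (simp add: w'_def u_def)
qed

lemma B_normal: "HB B \<Longrightarrow> a \<in> A \<Longrightarrow> b \<in> B \<Longrightarrow> cj a b \<in> B"
proof -
  assume "HB B" "a \<in> A" "b \<in> B"
  then have "cm a b \<in> B" "b \<in> B" "sgrp B" using cm_A_E HBD by blast+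
  then show ?thesis by (simp add: cj_cm sgrp_add)
qed

definition centr :: "'g \<Rightarrow> 'g set \<Rightarrow> bool" where "centr h B \<longleftrightarrow> (\<forall>a\<in>A. cm h a \<in> B)"

text \<open>A/B has prime order, so it is generated by the coset of any a outside B.\<close>

lemma centr_if_one:
  assumes B: "HB B" and h: "h \<in> F \<or> h \<in> H" "cj h ` B = B" and a: "a \<in> A" "a \<notin> B" "cm h a \<in> B"
  shows "centr h B"
  unfolding centr_def
proof
  have sB: "sgrp B" using HBD B by blast
  have hB: "cm h b \<in> B" if "b \<in> B" for b
  proof -
    have "cj h b \<in> B" using h(2) that by blast
    then show ?thesis using that sB by (simp add: cm_cj sgrp_mem)
  qed
  have pw: "cm h (nm i a) \<in> B" for i
  proof (induct i)
    case 0 then show ?case using sB by (simp add: cm_cj sgrp_zero)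
  next
    case (Suc i)
    then show ?case using a B_normal[OF B] sB by (simp add: cm_add_right sgrp_add)
  qed
  fix b assume b: "b \<in> A"
  obtain i where i: "nm i a + b \<in> B" using B a b unfolding HB_def by blast
  have "cm h (nm i a + b) \<in> B" using hB i by blast
  then have "cm h (nm i a) + cj (nm i a) (cm h b) \<in> B" by (simp add: cm_add_right)
  then have "cj (nm i a) (cm h b) \<in> B" using sgrp_add_left[OF sB pw] by blast
  then have "cj (- nm i a) (cj (nm i a) (cm h b)) \<in> B"
    using B_normal[OF B] a A_sgrp by (blast intro: sgrp_uminus nm_in)
  then show "cm h b \<in> B" by simp
qed

lemma act_cm_nm:
  assumes a: "a \<in> A" and h: "h \<in> H" and v: "v \<in> carrier V"
  shows "\<phi> (cm (nm i a) h) v = \<phi> (nm i (cm a h)) v"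
proof (induct i)
  case 0 then show ?case by (simp add: cm_def)
next
  case (Suc i)
  have cA: "cm b h \<in> A" if "b \<in> A" for b
    using that A_cj[of h "- b"] h A_sgrp by (simp add: cm_cj' sgrp_mem)
  have iA: "cm (nm i a) h \<in> A" "cm a h \<in> A" using cA a nm_in[OF A_sgrp] by blast+
  have Y': "a \<in> Y" "cm (nm i a) h \<in> Y" "cm a h \<in> Y" using a iA A_Y by auto
  have "\<phi> (cm (nm (Suc i) a) h) v = \<phi> (cj a (cm (nm i a) h)) (\<phi> (cm a h) v)"
    using Y' v by (simp add: cm_add_left act_add Ym)
  also have "\<dots> = \<phi> a (\<phi> (cm (nm i a) h) (\<phi> (- a) (\<phi> (cm a h) v)))"
    using Y' v by (intro act_cj) auto
  also have "\<dots> = \<phi> (cm (nm i a) h) (\<phi> a (\<phi> (- a) (\<phi> (cm a h) v)))"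
    using A_comm[OF a A_R[OF iA(1)]] Y' v by (simp add: Ym)
  also have "\<dots> = \<phi> (cm (nm i a) h) (\<phi> (cm a h) v)" using Y' v by simp
  also have "\<dots> = \<phi> (cm a h) (\<phi> (cm (nm i a) h) v)"
    using A_comm[OF iA(1) A_R[OF iA(2)] v] .
  also have "\<dots> = \<phi> (nm (Suc i) (cm a h)) v" using Suc Y' v by (simp add: act_add Ym)
  finally show ?case .
qed

text \<open>\<open>norm_commutator\<close> is applied to the translates of w under
  \<open>nm i a\<close> and multiplied over i < p. If no nontrivial h in the stabiliser of B
  centralises A/B, each of them contributes a trace \<open>T (cm a h)\<close> with
  \<open>cm a h\<close> outside B, which is trivial on the block. Only h = 0 remains, giving
  \<open>u [^] p\<close>, so u would be trivial.\<close>

lemma trivial_or_centr: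
  assumes B: "HB B" and x: "x \<in> K" and w: "w \<in> W B" "\<phi> x w \<noteq> w"
  shows "\<exists>h\<in>H. h \<noteq> 0 \<and> cj h ` B = B \<and> centr h B"
proof (rule ccontr)
  assume "\<not> ?thesis"
  then have no: "\<not> centr h B" if "h \<in> H" "h \<noteq> 0" "cj h ` B = B" for h using that by blast
  have xR: "x \<in> R" "x \<in> Y" using x KR RY by auto
  have wV: "w \<in> carrier V" using WV w by blast
  define u where "u = \<phi> x w \<otimes> inv w"
  have uW: "u \<in> W B" unfolding u_def using W_mult[OF B W_R[OF B xR(1) w(1)] W_inv[OF B w(1)]] .
  then have uV: "u \<in> carrier V" using WV by blast
  define H1 where "H1 = {h \<in> H. cj h ` B = B}"
  have finH: "finite H1" using H Y finite_subset[of H Y] by (simp add: H1_def)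
  have H1Y: "h \<in> Y" if "h \<in> H1" for h using that HY by (simp add: H1_def)
  obtain a where a: "a \<in> A" "a \<notin> B" using HB_ex[OF B] by blast
  have aiA: "nm i a \<in> A" "- nm i a \<in> A" for i using a nm_in[OF A_sgrp] A_sgrp by (auto simp: sgrp_mem)
  have aiY: "nm i a \<in> Y" "- nm i a \<in> Y" for i using aiA A_Y by auto
  have one: "(\<Otimes>h\<in>H1. \<phi> (cj (nm i a) h) u) = \<one>" for i
  proof -
    let ?w = "\<phi> (- nm i a) w"
    have "\<phi> x ?w \<otimes> inv ?w = \<phi> (- nm i a) u"
      using A_comm[OF aiA(2) xR(1) wV, of i] aiY xR wV by (simp add: u_def act_mult act_inv)
    then have "(\<Otimes>h\<in>H1. \<phi> h (\<phi> (- nm i a) u)) = \<one>"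
      using norm_commutator[OF B x W_R[OF B A_R[OF aiA(2)] w(1)], of i] by (simp add: H1_def)
    then have "\<phi> (nm i a) (\<Otimes>h\<in>H1. \<phi> h (\<phi> (- nm i a) u)) = \<one>" using aiY by simp
    then have "(\<Otimes>h\<in>H1. \<phi> (nm i a) (\<phi> h (\<phi> (- nm i a) u))) = \<one>"
      using act_finprod[OF aiY(1)[of i], of H1 "\<lambda>h. \<phi> h (\<phi> (- nm i a) u)"] aiY H1Y uV by simp
    moreover have "(\<Otimes>h\<in>H1. \<phi> (cj (nm i a) h) u) = (\<Otimes>h\<in>H1. \<phi> (nm i a) (\<phi> h (\<phi> (- nm i a) u)))"
      using aiY H1Y uV by (intro finprod_cong') (auto simp: act_cj)
    ultimately show ?thesis by simp
  qed
  have zero: "(\<Otimes>i\<in>{..<p}. \<phi> (cj (nm i a) h) u) = \<one>" if h: "h \<in> H1" "h \<noteq> 0" for h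
  proof -
    have hH: "h \<in> H" "cj h ` B = B" using h by (auto simp: H1_def)
    have cA: "cm a h \<in> A" using a(1) A_cj[of h "- a"] hH A_sgrp by (simp add: cm_cj' sgrp_mem)
    have "cm a h \<notin> B"
    proof
      assume "cm a h \<in> B"
      then have "cm h a \<in> B" using sgrp_uminus[OF HBD(1)[OF B]] cm_uminus by metis
      then show False using centr_if_one[OF B _ hH(2) a] hH no h by blast
    qed
    moreover have hu: "\<phi> h u \<in> W B" using W_cj[OF _ B uW, of h] hH by simp
    ultimately have "T (cm a h) (\<phi> h u) = \<one>" using WT cA by blast
    \<comment> \<open>The conjugate of h by \<open>nm i a\<close> is the commutator plus h, and on V
      this commutator acts as the i-th multiple of \<open>cm a h\<close>.\<close>
    moreover have "\<phi> (cj (nm i a) h) u = \<phi> (nm i (cm a h)) (\<phi> h u)" for i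
    proof -
      have "\<phi> (cm (nm i a) h + h) u = \<phi> (cm (nm i a) h) (\<phi> h u)"
        using aiY H1Y[OF h(1)] uV by (intro act_add) (auto simp: Ym)
      then show ?thesis using act_cm_nm[OF a(1) hH(1) WV[OF hu]] by (simp add: cj_cm)
    qed
    ultimately show ?thesis by (simp add: T_def)
  qed
  have z0: "0 \<in> H1" using H by (simp add: H1_def sgrp_mem cj_image)
  have cl: "\<phi> (cj (nm i a) h) u \<in> carrier V" if "h \<in> H1" for i h using aiY H1Y[OF that] uV by (simp add: Ym)
  have "\<one> = (\<Otimes>i\<in>{..<p}. \<Otimes>h\<in>H1. \<phi> (cj (nm i a) h) u)" using one by simp
  also have "\<dots> = (\<Otimes>h\<in>H1. \<Otimes>i\<in>{..<p}. \<phi> (cj (nm i a) h) u)"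
    using finH cl by (intro finprod_swap) auto
  also have "\<dots> = (\<Otimes>h\<in>insert 0 (H1 - {0}). \<Otimes>i\<in>{..<p}. \<phi> (cj (nm i a) h) u)"
    using z0 by (simp add: insert_absorb)
  also have "\<dots> = (\<Otimes>i\<in>{..<p}. \<phi> (cj (nm i a) 0) u) \<otimes> (\<Otimes>h\<in>H1 - {0}. \<Otimes>i\<in>{..<p}. \<phi> (cj (nm i a) h) u)"
    using finH cl z0 uV by (intro finprod_insert) (auto intro!: finprod_closed)
  also have "(\<Otimes>h\<in>H1 - {0}. \<Otimes>i\<in>{..<p}. \<phi> (cj (nm i a) h) u) = \<one>"
    by (rule finprod_one_eqI) (use zero in auto)
  also have "(\<Otimes>i\<in>{..<p}. \<phi> (cj (nm i a) 0) u) = u [^] p" using uV by (simp add: finprod_const)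
  finally have "u [^] p = \<one>" using uV by simp
  then have "u = \<one>" using p(2) uV by (simp add: divisible_by_def)
  then show False using w(2) wV xR unfolding u_def by (metis act_closed inv_closed inv_equality inv_inv)
qed

end

section \<open>Localisation to one block and the contradiction\<close>

context frobenius_core
begin

lemma contradiction: False
proof -
  have finF: "finite F" "finite H" using F H Y finite_subset by auto
  obtain B0 v0 where B0: "HB B0" "v0 \<in> W B0" "v0 \<noteq> \<one>" using ex_hyperplane by blast
  \<comment> \<open>Otherwise R fixes \<open>v0\<close>, and so does an element of A outside
    \<open>B0\<close>, which has no nontrivial fixed vectors in that block.\<close>
  have "\<exists>f\<in>F. \<exists>x\<in>K. \<exists>v\<in>W B0. \<phi> (cj f x) v \<noteq> v"
  proof (rule ccontr)
    assume no: "\<not> ?thesis"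
    obtain a where a: "a \<in> A" "a \<notin> B0" using HB_ex[OF B0(1)] by blast
    have "a \<in> gen ({cj f x | f x. f \<in> F \<and> x \<in> K} \<union> {x \<in> R. \<forall>v\<in>carrier V. \<phi> x v = v})"
      using Rgen A_R a by blast
    then have "\<phi> a v0 = v0"
      by (rule fix_gen[rotated 3]) (use no B0 WV[OF B0(2)] FY RY KR Ym in auto)
    then show False using W_fpf[OF a B0(2)] B0 by blast
  qed
  then obtain f0 x0 u0 where f0: "f0 \<in> F" and x0: "x0 \<in> K" and u0: "u0 \<in> W B0" "\<phi> (cj f0 x0) u0 \<noteq> u0" by blast
  \<comment> \<open>Translating the block by \<open>- f0\<close> makes an element of K itself act
    nontrivially, as \<open>trivial_or_centr\<close> requires.\<close>
  define B where "B = cj (- f0) ` B0"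
  have mf0: "- f0 \<in> F" using f0 F by (simp add: sgrp_mem)
  have B: "HB B" unfolding B_def by (rule HB_cj) (use mf0 B0 in auto)
  define w0 where "w0 = \<phi> (- f0) u0"
  have w0: "w0 \<in> W B" unfolding w0_def B_def by (rule W_cj) (use mf0 B0 u0 in auto)
  have x0Y: "x0 \<in> Y" using x0 KR RY by blast
  have w0x: "\<phi> x0 w0 \<noteq> w0"
  proof
    assume "\<phi> x0 w0 = w0"
    then have "\<phi> (cj f0 x0) u0 = u0" using FY f0 x0Y WV[OF u0(1)] by (simp add: act_cj w0_def)
    then show False using u0 by simp
  qed
  obtain h where h: "h \<in> H" "h \<noteq> 0" "cj h ` B = B" "centr h B"
    using trivial_or_centr[OF B x0 w0 w0x] by blast
  have hY: "h \<in> Y" and mhH: "- h \<in> H" using h HY H by (auto simp: sgrp_mem)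
  have hB: "cj (- h) ` B = B" using h(3) cj_image(1)[of "- h" h B] cj_image(2) by simp
  have sB: "sgrp B" using HBD B by blast
  define F1 where "F1 = {f \<in> F. cj f ` B = B}"
  have F1: "sgrp F1" "F1 \<subseteq> F"
  proof -
    show "sgrp F1"
    proof (rule sgrpI)
      show "- x \<in> F1" if "x \<in> F1" for x
        using that F cj_image(1)[of "- x" x B] by (auto simp: F1_def sgrp_mem)
    qed (use F in \<open>auto simp: F1_def sgrp_mem cj_image cj_image(1)[symmetric]\<close>)
  qed (auto simp: F1_def)
  have hF1: "cj h f \<in> F1" if "f \<in> F1" for f
  proof -
    have "cj (cj h f) ` B = cj h ` cj f ` cj (- h) ` B" by (simp only: cj_image cj_def[of h f] add.assoc)
    then show ?thesis using that nF h hB by (simp add: F1_def nmzD)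
  qed
  have F1B: "f \<in> F1 \<Longrightarrow> b \<in> B \<Longrightarrow> cj f b \<in> B" for f b by (auto simp: F1_def)
  \<comment> \<open>Every element of \<open>F1\<close> is a commutator [g, h] with g in
    \<open>F1\<close>. Since h centralises A/B and g normalises B, the commutator acts trivially on
    A/B.\<close>
  have centF1: "cm f a \<in> B" if f: "f \<in> F1" and a: "a \<in> A" for f a
  proof -
    have "bij_betw (\<lambda>q. cm q h) F1 F1"
      by (rule fixed_point_free_bij) (use F1 hF1 fpf h finite_subset[OF F1(2) finF(1)] in auto)
    then obtain g where g: "g \<in> F1" "f = cm g h" using f by (metis bij_betw_imp_surj_on imageE)
    have gm: "- g \<in> F1" using g F1 by (simp add: sgrp_mem)
    let ?c = "cj (- h) a" and ?b = "cj (- g) (cj (- h) a)"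
    have cA: "?c \<in> A" "?b \<in> A" using A_cj a mhH gm F1(2) by blast+
    have 1: "cm h ?c \<in> B" "cm h ?b \<in> B" using h(4) cA by (auto simp: centr_def)
    have "cj f a = cj g (cj h ?b)" using g(2) by (simp add: cm_def cj_cj add.assoc)
    also have "\<dots> = cj g (cm h ?b) + ?c" by (simp add: cj_cm[of h] cj_add)
    finally have "cm f a = cj g (cm h ?b) + (?c + - a)" by (simp add: cm_cj add.assoc)
    moreover have "?c + - a = - cm h ?c" by (simp add: cm_cj gsimps)
    ultimately show ?thesis using F1B[OF g(1) 1(2)] 1(1) sB by (simp add: sgrp_mem)
  qed
  have HBf: "HB (cj f ` B)" if "f \<in> F" for f by (rule HB_cj) (use that B in auto)
  \<comment> \<open>If K moved a vector in another block of the orbit, the index of this block would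
    be stabilised by a nontrivial element of H, and \<open>frobenius_orbit_fixed_point\<close> would
    identify it with \<open>B\<close>.\<close>
  have Ktriv: "\<phi> x w = w" if f: "f \<in> F" "f \<notin> F1" and x: "x \<in> K" and w: "w \<in> W (cj f ` B)" for f x w
  proof (rule ccontr)
    assume "\<phi> x w \<noteq> w"
    then obtain k where k: "k \<in> H" "k \<noteq> 0" "cj k ` (cj f ` B) = cj f ` B"
      using trivial_or_centr[OF HBf[OF f(1)] x w] by blast
    have "cj f ` B = B"
      by (rule frobenius_orbit_fixed_point[where act = "\<lambda>x. (`) (cj x)",
            OF F(1) finF(1) H(1) finF(2) nF fpf cj_image(1)[symmetric] cj_image(2) h(1-3) f(1) k])
    then show False using f by (simp add: F1_def)
  qed
  text \<open>Localise an element of \<open>A\<close> to the single block \<open>W B\<close>.\<close>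
  obtain a where a: "a \<in> A" "a \<notin> B" using HB_ex[OF B] by blast
  have aY: "a \<in> Y" "a \<in> R" using a A_Y A_R by auto
  define R0 where "R0 = gen {cj f x | f x. f \<in> F1 \<and> x \<in> K}"
  have R0R: "R0 \<subseteq> R"
    unfolding R0_def using R(1) nR(1) F1(2) KR by (intro gen_least) (auto intro: nmzD)
  \<comment> \<open>On \<open>W B\<close> only the generators \<open>cj f x\<close> with f in
    \<open>F1\<close> act nontrivially, so each element of R agrees there with one of
    \<open>R0\<close>.\<close>
  have loc: "\<exists>r\<in>R0. \<forall>w\<in>W B. \<phi> r w = \<phi> y w"
    if "y \<in> gen ({cj f x | f x. f \<in> F \<and> x \<in> K} \<union> {x \<in> R. \<forall>v\<in>carrier V. \<phi> x v = v})" for y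
  proof -
    have "y \<in> R \<and> (\<exists>r\<in>R0. \<forall>w\<in>W B. \<phi> r w = \<phi> y w)"
      using that
    proof (induct rule: gen.induct)
      case zero
      have "0 \<in> R0" by (simp add: R0_def gen.zero)
      then show ?case using R by (auto simp: sgrp_mem)
    next
      case (base y)
      show ?case
      proof (cases "y \<in> {x \<in> R. \<forall>v\<in>carrier V. \<phi> x v = v}")
        case True
        moreover have "0 \<in> R0" by (simp add: R0_def gen.zero)
        ultimately show ?thesis using WV by (auto intro!: bexI[of _ 0])
      next
        case False
        then obtain f x where y: "y = cj f x" "f \<in> F" "x \<in> K" using base by blast
        have yR: "y \<in> R" using y nR(1) KR by (auto intro: nmzD)
        show ?thesis
        proof (cases "f \<in> F1")
          case True
          then have "y \<in> R0" using y unfolding R0_def by (blast intro: gen.base)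
          then show ?thesis using yR by blast
        next
          case nf: False
          have mf: "- f \<in> F" "- f \<notin> F1" using y nf F F1 by (auto simp: sgrp_mem sgrp_uminus_iff)
          have "\<phi> y w = w" if w: "w \<in> W B" for w
          proof -
            have "\<phi> (- f) w \<in> W (cj (- f) ` B)" by (rule W_cj) (use mf B w in auto)
            then have "\<phi> x (\<phi> (- f) w) = \<phi> (- f) w" using Ktriv mf y by blast
            then show ?thesis using y FY KR RY WV[OF w] by (auto simp: act_cj)
          qed
          moreover have "0 \<in> R0" by (simp add: R0_def gen.zero)
          ultimately show ?thesis using yR WV by (auto intro!: bexI[of _ 0])
        qed
      qed
    next
      case (add x y)
      then obtain r s where rs: "r \<in> R0" "\<forall>w\<in>W B. \<phi> r w = \<phi> x w" "s \<in> R0" "\<forall>w\<in>W B. \<phi> s w = \<phi> y w" by blast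
      have "r + s \<in> R0" using rs by (simp add: R0_def gen.add)
      moreover have "\<phi> (r + s) w = \<phi> (x + y) w" if w: "w \<in> W B" for w
        using rs add W_R[OF B _ w, of y] WV[OF w] w RY R0R by (auto simp: act_add subset_iff)
      ultimately show ?case using add R by (auto simp: sgrp_mem)
    next
      case (uminus x)
      then obtain r where r: "r \<in> R0" "\<forall>w\<in>W B. \<phi> r w = \<phi> x w" by blast
      have "- r \<in> R0" using r by (simp add: R0_def gen.uminus)
      moreover have "\<phi> (- r) w = \<phi> (- x) w" if w: "w \<in> W B" for w
      proof -
        have xR: "x \<in> R" "- x \<in> R" using uminus R by (auto simp: sgrp_mem)
        have "\<phi> (- x) w \<in> W B" using W_R[OF B xR(2) w] .
        then have "\<phi> r (\<phi> (- x) w) = w" using r xR RY WV[OF w] by auto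
        then have "\<phi> (- r) w = \<phi> (- r) (\<phi> r (\<phi> (- x) w))" by simp
        also have "\<dots> = \<phi> (- x) w" using r xR RY R0R WV[OF w] Ym by (intro act_uminus(1)) auto
        finally show ?thesis .
      qed
      ultimately show ?case using uminus R by (auto simp: sgrp_mem)
    qed
    then show ?thesis by blast
  qed
  obtain z0 where z0: "z0 \<in> R0" "\<And>w. w \<in> W B \<Longrightarrow> \<phi> z0 w = \<phi> a w"
    using loc[of a] Rgen aY by blast
  have z0R: "z0 \<in> R" "z0 \<in> Y" using z0 R0R RY by auto
  \<comment> \<open>For g in \<open>F1\<close> and f outside, \<open>- g + f\<close> is again
    outside \<open>F1\<close>; so the generators of \<open>R0\<close> are trivial on the remaining
    blocks.\<close>
  have z0triv: "\<phi> z0 w = w" if f: "f \<in> F" "f \<notin> F1" and w: "w \<in> W (cj f ` B)" for f w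
  proof (rule fix_gen[OF _ _ _ z0(1)[unfolded R0_def]])
    show "{cj f x | f x. f \<in> F1 \<and> x \<in> K} \<subseteq> Y" using F1(2) FY KR RY Ym(4) by blast
    show "w \<in> carrier V" using WV w .
    fix b assume "b \<in> {cj f x | f x. f \<in> F1 \<and> x \<in> K}"
    then obtain g x where b: "b = cj g x" "g \<in> F1" "x \<in> K" by blast
    have gF: "g \<in> F" "- g \<in> F" using b F1 F by (auto simp: sgrp_mem)
    have "\<phi> (- g) w \<in> W (cj (- g) ` cj f ` B)" by (rule W_cj) (use gF HBf f w in auto)
    moreover have "- g + f \<in> F" using gF f F by (simp add: sgrp_mem)
    moreover have "- g + f \<notin> F1" using f b F1 by (simp add: sgrp_add_left sgrp_mem)
    ultimately have "\<phi> x (\<phi> (- g) w) = \<phi> (- g) w" using Ktriv[of "- g + f"] b by (simp add: cj_image)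
    then show "\<phi> b w = w" using b gF FY KR RY WV[OF w] by (auto simp: act_cj)
  qed
  text \<open>The product of the conjugates of \<open>z0\<close>, one for each block of the orbit.\<close>
  have prodex: "\<exists>y\<in>R. \<forall>f\<in>F. \<forall>v\<in>W (cj f ` B). \<phi> y v = (if cj f ` B \<in> J then \<phi> (cj f a) v else v)"
    if "finite J" "J \<subseteq> (\<lambda>f. cj f ` B) ` F" for J
    using that
  proof (induct rule: finite_induct)
    case empty
    show ?case using R WV by (intro bexI[of _ 0]) (auto simp: sgrp_mem)
  next
    case (insert C J)
    then obtain y where y: "y \<in> R" "\<And>f v. f \<in> F \<Longrightarrow> v \<in> W (cj f ` B) \<Longrightarrow> \<phi> y v = (if cj f ` B \<in> J then \<phi> (cj f a) v else v)"
      by auto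
    obtain g where g: "g \<in> F" "C = cj g ` B" using insert by blast
    have gz: "cj g z0 \<in> R" using nR(1) g z0R by (simp add: nmzD)
    have gY: "g \<in> Y" "- g \<in> Y" "- g \<in> F" using g FY F by (auto simp: sgrp_mem)
    have "\<phi> (cj g z0 + y) v = (if cj f ` B \<in> insert C J then \<phi> (cj f a) v else v)"
      if f: "f \<in> F" and v: "v \<in> W (cj f ` B)" for f v
    proof -
      have vV: "v \<in> carrier V" using WV v .
      have faA: "cj f a \<in> A" "cj g a \<in> A" by (rule A_cj; use f g a in simp)+
      have yv: "\<phi> y v \<in> W (cj f ` B)" using W_R[OF HBf[OF f] y(1) v] .
      have yvV: "\<phi> y v \<in> carrier V" using WV yv .
      have e: "\<phi> (cj g z0 + y) v = \<phi> g (\<phi> z0 (\<phi> (- g) (\<phi> y v)))"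
        using act_add[of "cj g z0" y v] RY[OF gz] RY[OF y(1)] vV act_cj[OF gY(1) z0R(2) yvV] by simp
      have gv: "\<phi> (- g) (\<phi> y v) \<in> W (cj (- g + f) ` B)"
        unfolding cj_image(1)[symmetric] by (rule W_cj) (use gY HBf f yv in auto)
      show ?thesis
      proof (cases "cj f ` B = C")
        case True
        have "cj (- g + f) ` B = cj (- g) ` cj g ` B" unfolding cj_image(1)[symmetric] using True g by simp
        then have CB: "cj (- g + f) ` B = B" by (simp add: cj_image)
        then have f1: "- g + f \<in> F1" using gY f F by (simp add: F1_def sgrp_mem)
        have "\<phi> y v = v" using y(2)[OF f v] insert(2) True by simp
        then have "\<phi> (cj g z0 + y) v = \<phi> g (\<phi> a (\<phi> (- g) v))" using e z0(2) gv CB by simp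
        also have "\<dots> = \<phi> (cj g a) v" using gY aY vV by (simp add: act_cj)
        \<comment> \<open>Independence of the coset representative: \<open>- g + f\<close> lies in
          \<open>F1\<close> and centralises A/B, so \<open>cj f a\<close> and \<open>cj g a\<close>
          differ by an element acting trivially on this block.\<close>
        also have "\<dots> = \<phi> (cj f a) v"
        proof -
          have "cj f a = cj g (cj (- g + f) a)" by (simp add: cj_cj)
          also have "\<dots> = cj g (cm (- g + f) a) + cj g a" by (simp add: cj_cm[of "- g + f"] cj_add)
          finally have ee: "cj f a = cj g (cm (- g + f) a) + cj g a" .
          have inB: "cj g (cm (- g + f) a) \<in> cj f ` B" using centF1[OF f1 a(1)] True g by simp
          then have inY: "cj g (cm (- g + f) a) \<in> Y" using HBD(4)[OF HBf[OF f]] A_Y by blast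
          have "\<phi> (cj g a) v \<in> W (cj f ` B)" using W_R[OF HBf[OF f] A_R[OF faA(2)] v] .
          then have "\<phi> (cj g (cm (- g + f) a)) (\<phi> (cj g a) v) = \<phi> (cj g a) v" using WB inB by blast
          then show ?thesis unfolding ee using act_add[OF inY A_Y[OF faA(2)] vV] by simp
        qed
        finally show ?thesis using True by simp
      next
        case False
        have "cj f ` B = cj g ` cj (- g + f) ` B" by (simp add: cj_image)
        then have "cj (- g + f) ` B \<noteq> B" using False g by auto
        then have "- g + f \<notin> F1" by (simp add: F1_def)
        moreover have "- g + f \<in> F" using gY f F by (simp add: sgrp_mem)
        ultimately have "\<phi> z0 (\<phi> (- g) (\<phi> y v)) = \<phi> (- g) (\<phi> y v)" using z0triv gv by blast
        then have "\<phi> (cj g z0 + y) v = \<phi> y v" using e gY yvV by simp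
        then show ?thesis using y(2)[OF f v] False by simp
      qed
    qed
    moreover have "cj g z0 + y \<in> R" using gz y R by (simp add: sgrp_mem)
    ultimately show ?case by blast
  qed
  obtain z where z: "z \<in> R" "\<And>f v. f \<in> F \<Longrightarrow> v \<in> W (cj f ` B) \<Longrightarrow> \<phi> z v = \<phi> (cj f a) v"
    using prodex[of "(\<lambda>f. cj f ` B) ` F"] finF by auto
  have zY: "z \<in> Y" using z RY by blast
  \<comment> \<open>The kernel of R on the blocks in the orbit of B. By \<open>star\<close>, an
    element of R centralised by F and by h modulo \<open>S\<close> lies in \<open>S\<close>.\<close>
  define S where "S = {y \<in> R. \<forall>f\<in>F. \<forall>v\<in>W (cj f ` B). \<phi> y v = v}"
  have SI: "cm g y \<in> S" if y: "y \<in> R" and g: "g \<in> Y" "cj g y \<in> R"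
    and e: "\<And>f v. f \<in> F \<Longrightarrow> v \<in> W (cj f ` B) \<Longrightarrow> \<phi> (cj g y) v = \<phi> y v" for g y
  proof -
    have my: "- y \<in> R" using y R by (simp add: sgrp_mem)
    have "\<phi> (cm g y) v = v" if f: "f \<in> F" and v: "v \<in> W (cj f ` B)" for f v
    proof -
      have "\<phi> (cm g y) v = \<phi> (cj g y) (\<phi> (- y) v)"
        using act_add[of "cj g y" "- y" v] RY g my WV[OF v] by (simp add: cm_cj)
      also have "\<dots> = \<phi> y (\<phi> (- y) v)" using e[OF f W_R[OF HBf[OF f] my v]] .
      also have "\<dots> = v" using y RY WV[OF v] by simp
      finally show ?thesis .
    qed
    moreover have "cm g y \<in> R" using g my R by (simp add: cm_cj sgrp_add)
    ultimately show ?thesis by (simp add: S_def)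
  qed
  have "z \<in> S"
  proof (rule star[of S h])
    show "sgrp S"
    proof (rule sgrpI)
      show "- x \<in> S" if x: "x \<in> S" for x
      proof -
        have xR: "x \<in> R" "- x \<in> R" "x \<in> Y" using x R RY by (auto simp: S_def sgrp_mem)
        have "\<phi> (- x) v = v" if "f \<in> F" "v \<in> W (cj f ` B)" for f v
        proof -
          have "\<phi> x v = v" using x that by (simp add: S_def)
          then show ?thesis using act_uminus(1)[OF xR(3) WV[OF that(2)]] by simp
        qed
        then show ?thesis using xR by (simp add: S_def)
      qed
    qed (use R RY WV in \<open>auto simp: S_def sgrp_mem act_add\<close>)
    show "S \<subseteq> R" by (auto simp: S_def)
    show "nmz R S"
      unfolding nmz_def
    proof (intro ballI)
      fix x s assume x: "x \<in> R" and s: "s \<in> S"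
      have sR: "s \<in> R" using s by (simp add: S_def)
      have mx: "- x \<in> R" using x R by (simp add: sgrp_mem)
      have "\<phi> (cj x s) v = v" if "f \<in> F" "v \<in> W (cj f ` B)" for f v
        using W_R[OF HBf[OF that(1)] mx that(2)] s that x sR RY WV by (auto simp: act_cj S_def)
      then show "cj x s \<in> S" using x sR R by (auto simp: S_def sgrp_cj)
    qed
    show "nmz F S"
      unfolding nmz_def
    proof (intro ballI)
      fix x s assume x: "x \<in> F" and s: "s \<in> S"
      have sR: "s \<in> R" using s by (simp add: S_def)
      have mx: "- x \<in> F" using x F by (simp add: sgrp_mem)
      have "\<phi> (cj x s) v = v" if f: "f \<in> F" and v: "v \<in> W (cj f ` B)" for f v
      proof -
        have "\<phi> (- x) v \<in> W (cj (- x + f) ` B)"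
          unfolding cj_image(1)[symmetric] by (rule W_cj) (use mx HBf f v in auto)
        moreover have "- x + f \<in> F" using mx f F by (simp add: sgrp_mem)
        ultimately have "\<phi> s (\<phi> (- x) v) = \<phi> (- x) v" using s unfolding S_def by blast
        then show ?thesis using x sR RY FY WV[OF v] by (simp add: act_cj)
      qed
      then show "cj x s \<in> S" using x sR nR(1) by (auto simp: S_def nmzD)
    qed
    have hv: "\<phi> (- h) v \<in> W (cj (cj (- h) f) ` B) \<and> cj (- h) f \<in> F" if f: "f \<in> F" and v: "v \<in> W (cj f ` B)" for f v
    proof -
      have "\<phi> (- h) v \<in> W (cj (- h) ` cj f ` B)" by (rule W_cj) (use mhH HBf f v in auto)
      also have "cj (- h) ` cj f ` B = cj (- h) ` cj f ` cj h ` B" using h(3) by simp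
      also have "\<dots> = cj (cj (- h) f) ` B" by (simp only: cj_image cj_def[of "- h" f] add.assoc minus_minus)
      finally show ?thesis using nF mhH f by (simp add: nmzD)
    qed
    show "nmz {h} S"
      unfolding nmz_def
    proof (intro ballI)
      fix x s assume "x \<in> {h}" and s: "s \<in> S"
      have sR: "s \<in> R" using s by (simp add: S_def)
      have "\<phi> (cj h s) v = v" if f: "f \<in> F" and v: "v \<in> W (cj f ` B)" for f v
      proof -
        have "\<phi> s (\<phi> (- h) v) = \<phi> (- h) v" using s hv[OF f v] unfolding S_def by blast
        then show ?thesis using hY sR RY WV[OF v] by (simp add: act_cj)
      qed
      then show "cj x s \<in> S" using \<open>x \<in> {h}\<close> sR nR(2) h by (auto simp: S_def nmzD)
    qed
    show "h \<in> H" "h \<noteq> 0" "z \<in> R" using h z by auto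
    \<comment> \<open>On the block of f both z and its conjugate by g act as
      \<open>cj f a\<close>.\<close>
    show "cm g z \<in> S" if g: "g \<in> F" for g
    proof (rule SI[OF z(1)])
      show gY: "g \<in> Y" "cj g z \<in> R" using g FY nR(1) z by (auto simp: nmzD)
      fix f v assume f: "f \<in> F" and v: "v \<in> W (cj f ` B)"
      have mg: "- g \<in> F" "- g + f \<in> F" using g f F by (auto simp: sgrp_mem)
      have gv: "\<phi> (- g) v \<in> W (cj (- g + f) ` B)"
        unfolding cj_image(1)[symmetric] by (rule W_cj) (use mg HBf f v in auto)
      have "\<phi> (cj g z) v = \<phi> g (\<phi> z (\<phi> (- g) v))" using gY(1) zY WV[OF v] by (simp add: act_cj)
      also have "\<dots> = \<phi> g (\<phi> (cj (- g + f) a) (\<phi> (- g) v))" using z(2)[OF mg(2) gv] by simp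
      also have "\<dots> = \<phi> (cj g (cj (- g + f) a)) v"
        using gY(1) mg FY aY WV[OF v] Ym by (intro act_cj[symmetric]) auto
      also have "\<dots> = \<phi> z v" using z(2)[OF f v] by (simp add: cj_cj)
      finally show "\<phi> (cj g z) v = \<phi> z v" .
    qed
    \<comment> \<open>Since \<open>cm h a\<close> lies in \<open>B\<close>, replacing a by its
      conjugate under h does not change the action of \<open>cj f a\<close> on the block of
      f.\<close>
    show "cm h z \<in> S"
    proof (rule SI[OF z(1)])
      show "h \<in> Y" "cj h z \<in> R" using hY h nR(2) z by (auto simp: nmzD)
      fix f v assume f: "f \<in> F" and v: "v \<in> W (cj f ` B)"
      have vV: "v \<in> carrier V" using WV v .
      let ?f = "cj (- h) f"
      have fF: "?f \<in> F" "?f \<in> Y" using hv[OF f v] FY by auto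
      have fY: "f \<in> Y" using f FY by blast
      have "\<phi> (cj h z) v = \<phi> h (\<phi> z (\<phi> (- h) v))" using hY zY vV by (simp add: act_cj)
      also have "\<dots> = \<phi> h (\<phi> (cj ?f a) (\<phi> (- h) v))" using z(2)[of ?f] hv[OF f v] by simp
      also have "\<dots> = \<phi> (cj h (cj ?f a)) v"
        using hY fF aY vV Ym by (intro act_cj[symmetric]) auto
      also have "cj h (cj ?f a) = cj f (cm h a) + cj f a"
        by (simp add: cj_add[symmetric] cj_cm[symmetric] cj_cj) (simp add: cj_def gsimps)
      also have "\<phi> (cj f (cm h a) + cj f a) v = \<phi> (cj f (cm h a)) (\<phi> (cj f a) v)"
        using hY fY aY vV Ym by (intro act_add) auto
      also have "\<dots> = \<phi> (cj f a) v"
      proof -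
        have faA: "cj f a \<in> A" by (rule A_cj; use f a in simp)
        have "cj f (cm h a) \<in> cj f ` B" using h(4) a by (auto simp: centr_def)
        then show ?thesis using WB W_R[OF HBf[OF f] A_R[OF faA] v] by blast
      qed
      finally show "\<phi> (cj h z) v = \<phi> z v" using z(2)[OF f v] by simp
    qed
  qed
  then have "\<phi> z w0 = w0" using w0 sgrp_zero[OF F(1)] cj_image(2)[of B] unfolding S_def by force
  moreover have "\<phi> z w0 = \<phi> a w0" using z(2)[of 0 w0] w0 sgrp_zero[OF F(1)] by (simp add: cj_image)
  ultimately have "w0 = \<one>" using W_fpf[OF a w0] by simp
  then show False using w0x x0Y by simp
qed

end

section \<open>Carter subgroups and covering of fixed points\<close>

lemma comm_group_mon:
  assumes "sgrp V" "\<And>v w. v \<in> V \<Longrightarrow> w \<in> V \<Longrightarrow> v + w = w + v"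
  shows "comm_group (mon V)"
  using group.group_comm_groupI[OF group_mon[OF assms(1)]] assms(2) by simp

lemma conj_action:
  assumes X: "sgrp X" "finite X" and V: "sgrp V" "V \<subseteq> X" "nmz X V"
    and ab: "\<And>v w. v \<in> V \<Longrightarrow> w \<in> V \<Longrightarrow> v + w = w + v"
  shows "abelian_action (mon V) X cj"
proof -
  interpret comm_group "mon V" by (rule comm_group_mon[OF V(1) ab])
  show ?thesis
    by unfold_locales (use X V in \<open>auto simp: finite_subset nmzD cj_add cj_cj\<close>)
qed

lemma coprime_exponent_zero:
  assumes "prime r" "\<not> r dvd n" "nm r v = 0" "nm n v = 0" shows "v = 0"
  using nm_coprime_zero[OF assms(3,4)] prime_imp_coprime[OF assms(1,2)] by simp

lemma exponent_dvd_card: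
  assumes V: "sgrp V" "finite V" and r: "prime (r::nat)" "\<And>v. v \<in> V \<Longrightarrow> nm r v = 0" and x: "x \<in> V" "x \<noteq> 0"
  shows "r dvd card V"
  using coprime_exponent_zero[OF r(1) _ r(2)[OF x(1)] nm_card[OF V(2,1) x(1)]] x by blast

lemma splus_image_mem:
  assumes f: "homo G f" and G: "sgrp G" and A: "A \<subseteq> G" and M: "sgrp M" "M \<subseteq> G"
    and ker: "\<And>x. x \<in> G \<Longrightarrow> f x = 0 \<Longrightarrow> x \<in> M" and g: "g \<in> G"
  shows "f g \<in> splus (f ` A) (f ` M) \<longleftrightarrow> g \<in> splus A M"
proof
  assume "f g \<in> splus (f ` A) (f ` M)"
  then obtain a m where a: "a \<in> A" "m \<in> M" "f g = f a + f m" by (auto simp: splus_def)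
  have am: "a \<in> G" "m \<in> G" "a + m \<in> G" using a A M G by (auto simp: sgrp_mem subset_iff)
  then have "f (a + m) = f g" using a homoD[OF f] by simp
  then have "f (- (a + m) + g) = 0" using homo_eq_iff[OF f G am(3) g] by simp
  then have "- (a + m) + g \<in> M" using ker am(3) g G by (blast intro: sgrp_mem)
  then have "m + (- (a + m) + g) \<in> M" using a M by (simp only: sgrp_add)
  then have "a + (m + (- (a + m) + g)) \<in> splus A M" using a by (auto simp: splus_def)
  then show "g \<in> splus A M" by (simp add: gsimps)
next
  assume "g \<in> splus A M"
  then obtain a m where "a \<in> A" "m \<in> M" "g = a + m" by (auto simp: splus_def)
  then show "f g \<in> splus (f ` A) (f ` M)" using homoD[OF f] A M by (auto simp: splus_def subset_iff)
qed

lemma normal_fix_set: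
  assumes "sgrp F" "nmz F D" "nmz F Q"
  shows "nmz F {v \<in> D. \<forall>q\<in>Q. cj q v = v}"
  unfolding nmz_def
proof (intro ballI CollectI conjI)
  fix x s assume x: "x \<in> F" and s: "s \<in> {v \<in> D. \<forall>q\<in>Q. cj q v = v}"
  show "cj x s \<in> D" using assms x s by (simp add: nmzD)
  fix q assume q: "q \<in> Q"
  then have "cj (- x) q \<in> Q" using assms x by (simp add: nmzD sgrp_uminus)
  then have "cj (cj (- x) q) s = s" using s by simp
  then have "cj x (cj (cj (- x) q) s) = cj x s" by simp
  then show "cj q (cj x s) = cj x s" by (simp add: cj_cj) (simp add: cj_def gsimps)
qed

lemma sgrp_fix_set: "sgrp D \<Longrightarrow> sgrp {v \<in> D. \<forall>q\<in>Q. cj q v = v}"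
  by (rule sgrpI) (auto simp: sgrp_mem cj_add cj_uminus)

lemma nmz_torsion: "nmz X F \<Longrightarrow> nmz X {x \<in> F. nm n x = 0}"
  by (auto simp: nmz_def nm_cj)

lemma card_Diff_add: "finite A \<Longrightarrow> B \<subseteq> A \<Longrightarrow> card A = card (A - B) + card B"
  by (simp add: card_Diff_subset card_mono finite_subset)

text \<open>F acts through an r-group on the centraliser D of Q in V. Were D not contained in F,
  counting would give a nontrivial fixed point of F on D modulo its intersection with F. A lift d
  has [F, d] inside F, so d normalises F and lies in F, a contradiction.\<close>

lemma carter_hall:
  assumes G: "sgrp G" "finite G" and c: "carter G F" and V: "sgrp V" "V \<subseteq> G" "nmz G V"
    and ab: "\<And>v w. v \<in> V \<Longrightarrow> w \<in> V \<Longrightarrow> v + w = w + v"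
    and r: "prime (r::nat)" "\<And>v. v \<in> V \<Longrightarrow> nm r v = 0"
  obtains Q P k where "sgrp Q" "Q \<subseteq> F" "sgrp P" "P \<subseteq> F" "card P = r ^ k" "coprime r (card Q)"
    "Q = {x \<in> F. nm (card Q) x = 0}" "F = splus Q P" "\<forall>v\<in>V. (\<forall>q\<in>Q. cj q v = v) \<longrightarrow> v \<in> F"
proof -
  have F: "sgrp F" "F \<subseteq> G" "nil F" "\<And>g. g \<in> G \<Longrightarrow> (\<And>f. f \<in> F \<Longrightarrow> cj g f \<in> F) \<Longrightarrow> g \<in> F"
    using c by (auto simp: carter_def)
  have finF: "finite F" using F(2) G finite_subset by blast
  obtain Q P k where Q: "sgrp Q" "Q \<subseteq> F" and P: "sgrp P" "P \<subseteq> F" "card P = r ^ k"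
    and cop: "coprime r (card Q)" and cF: "card F = r ^ k * card Q" and Qd: "Q = {x \<in> F. nm (card Q) x = 0}"
    and FQP: "F = splus Q P"
    by (rule nil_hall[OF F(1) finF F(3) r(1)])
  have nQ: "nmz F Q" by (subst Qd) (rule nmz_torsion[OF nmz_self[OF F(1)]])
  define D where "D = {v \<in> V. \<forall>q\<in>Q. cj q v = v}"
  have DV: "v \<in> V" and DQ: "q \<in> Q \<Longrightarrow> cj q v = v" if "v \<in> D" for v q using that by (auto simp: D_def)
  have nVF: "nmz F V" using nmz_mono[OF V(3) F(2)] .
  have D: "sgrp D" "nmz F D" using sgrp_fix_set[OF V(1)] normal_fix_set[OF F(1) nVF nQ] by (auto simp: D_def)
  have DG: "D \<subseteq> G" using V DV by blast
  have finD: "finite D" using DG G(2) finite_subset by blast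
  have "v \<in> F" if v: "v \<in> D" for v
  proof (rule ccontr)
    assume vF: "v \<notin> F"
    define E where "E = D \<inter> F"
    let ?Z = "splus F D"
    have Z: "sgrp ?Z" by (rule sgrp_splus[OF F(1) D])
    have FZ: "F \<subseteq> ?Z" "D \<subseteq> ?Z" by (rule splus_left[OF D(1)], rule splus_right[OF F(1)])
    have D0: "sgrp E" "E \<subseteq> ?Z" using sgrp_Int[OF D(1) F(1)] FZ unfolding E_def by blast+
    have nFE: "nmz F E" unfolding E_def by (rule nmz_Int[OF D(2) nmz_self[OF F(1)]])
    have "cj (f + d) x \<in> E" if "f \<in> F" "d \<in> D" "x \<in> E" for f d x
    proof -
      have "cj d x = x" using ab[OF DV DV, of d x] that by (simp add: E_def cj_eq_self)
      then have "cj (f + d) x = cj f x" by (simp add: cj_cj[symmetric])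
      then show ?thesis using nmzD[OF nFE that(1,3)] by simp
    qed
    then have "nmz ?Z E" unfolding nmz_def splus_def by blast
    then obtain \<pi> :: "'a \<Rightarrow> 'a set sym" where pi: "homo ?Z \<pi>" "\<And>x. x \<in> ?Z \<Longrightarrow> \<pi> x = 0 \<longleftrightarrow> x \<in> E"
      using quotient_map[OF Z D0] by metis
    have piD: "sgrp (\<pi> ` D)" by (rule sgrp_image[OF pi(1) Z FZ(2) D(1)])
    have e: "cj (\<pi> f) (\<pi> d) = \<pi> (cj f d)" if "f \<in> F" "d \<in> D" for f d
      using homo_cj[OF pi(1) Z subsetD[OF FZ(1) that(1)] subsetD[OF FZ(2) that(2)]] by simp
    let ?Fix = "{b \<in> \<pi> ` D. \<forall>x\<in>F. cj (\<pi> x) b = b}"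
    have "r dvd card (\<pi> ` D - ?Fix)"
    proof (rule card_non_fixed_dvd[OF F(1) finF Q r(1) cF])
      show "finite (\<pi> ` D)" using finD by simp
      show "cj (\<pi> x) b \<in> \<pi> ` D" if "x \<in> F" "b \<in> \<pi> ` D" for x b
      proof -
        obtain d where d: "d \<in> D" "b = \<pi> d" using \<open>b \<in> \<pi> ` D\<close> by blast
        then show ?thesis using e[OF \<open>x \<in> F\<close> d(1)] nmzD[OF D(2) \<open>x \<in> F\<close> d(1)] by (metis imageI)
      qed
      show "cj (\<pi> (x + y)) b = cj (\<pi> x) (cj (\<pi> y) b)" if "x \<in> F" "y \<in> F" for x y b
        using homoD[OF pi(1) subsetD[OF FZ(1) that(1)] subsetD[OF FZ(1) that(2)]] by (simp add: cj_cj)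
      show "cj (\<pi> x) b = b" if "x \<in> Q" "b \<in> \<pi> ` D" for x b
      proof -
        obtain d where d: "d \<in> D" "b = \<pi> d" using \<open>b \<in> \<pi> ` D\<close> by blast
        then show ?thesis using e[OF subsetD[OF Q(2) \<open>x \<in> Q\<close>] d(1)] DQ[OF d(1) \<open>x \<in> Q\<close>] by simp
      qed
    qed
    moreover have "r dvd card (\<pi> ` D)"
    proof (rule exponent_dvd_card[OF piD _ r(1)])
      show "finite (\<pi> ` D)" using finD by simp
      show "nm r w = 0" if "w \<in> \<pi> ` D" for w
      proof -
        obtain d where d: "d \<in> D" "w = \<pi> d" using \<open>w \<in> \<pi> ` D\<close> by blast
        then show ?thesis using homo_nm[OF pi(1) Z subsetD[OF FZ(2) d(1)], of r] r(2)[OF DV[OF d(1)]] homo_zero[OF pi(1) Z] by simp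
      qed
      show "\<pi> v \<in> \<pi> ` D" using v by blast
      show "\<pi> v \<noteq> 0" using pi(2)[OF subsetD[OF FZ(2) v]] vF unfolding E_def by blast
    qed
    moreover have "finite (\<pi> ` D)" "?Fix \<subseteq> \<pi> ` D" using finD by auto
    then have "card (\<pi> ` D) = card (\<pi> ` D - ?Fix) + card ?Fix" by (rule card_Diff_add)
    ultimately have "r dvd card ?Fix" by (simp only: dvd_add_right_iff)
    moreover have z: "0 \<in> ?Fix" using sgrp_zero[OF piD] by simp
    moreover have "finite ?Fix" using finD by simp
    ultimately have "\<not> ?Fix \<subseteq> {0}"
    proof -
      assume a: "r dvd card ?Fix" "0 \<in> ?Fix"
      show ?thesis
      proof
        assume "?Fix \<subseteq> {0}"
        then have "?Fix = {0}" using a(2) by blast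
        then have "card ?Fix = 1" by simp
        then show False using a(1) r(1) by simp
      qed
    qed
    then obtain d where d: "d \<in> D" "\<pi> d \<noteq> 0" "\<And>f. f \<in> F \<Longrightarrow> cj (\<pi> f) (\<pi> d) = \<pi> d" by blast
    have "cj d f \<in> F" if f: "f \<in> F" for f
    proof -
      have dZ: "d \<in> ?Z" "f \<in> ?Z" using FZ d f by blast+
      have "\<pi> (cm f d) = 0"
        using d(3)[OF f] homo_cm[OF pi(1) Z dZ(2,1)] by (simp add: cm_cj)
      then have "cm f d \<in> F" using pi(2)[OF sgrp_cm[OF Z dZ(2,1)]] unfolding E_def by blast
      then have "cm d f \<in> F" using sgrp_uminus[OF F(1)] cm_uminus by metis
      then show ?thesis using f F(1) by (simp add: cj_cm sgrp_add)
    qed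
    then have "d \<in> F" using F(4)[of d] d(1) DG by blast
    then show False using d(1,2) pi(2)[of d] FZ(1) unfolding E_def by blast
  qed
  then show thesis by (intro that[OF Q P cop Qd FQP]) (simp add: D_def)
qed

text \<open>A complement argument: g carries Q to another complement of V in Q + V. By averaging,
  some w in V makes \<open>- w + g\<close> normalise Q. This element also normalises F, since its
  error terms in V centralise Q and so lie in F by \<open>carter_hall\<close>.\<close>

lemma carter_normalizer_abelian:
  assumes G: "sgrp G" "finite G" and c: "carter G F" and V: "sgrp V" "V \<subseteq> G" "nmz G V"
    and ab: "\<And>v w. v \<in> V \<Longrightarrow> w \<in> V \<Longrightarrow> v + w = w + v"
    and r: "prime (r::nat)" "\<And>v. v \<in> V \<Longrightarrow> nm r v = 0"
    and g: "g \<in> G" "\<And>f. f \<in> F \<Longrightarrow> cj g f \<in> splus F V"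
  shows "g \<in> splus F V"
proof -
  have F: "sgrp F" "F \<subseteq> G" "nil F" "\<And>g. g \<in> G \<Longrightarrow> (\<And>f. f \<in> F \<Longrightarrow> cj g f \<in> F) \<Longrightarrow> g \<in> F"
    using c by (auto simp: carter_def)
  have finF: "finite F" using F(2) G finite_subset by blast
  obtain Q P k where Q: "sgrp Q" "Q \<subseteq> F" and P: "sgrp P" "P \<subseteq> F" "card P = r ^ k"
    and cop: "coprime r (card Q)" and Qd: "Q = {x \<in> F. nm (card Q) x = 0}"
    and FQP: "F = splus Q P" and CQ0: "\<forall>v\<in>V. (\<forall>q\<in>Q. cj q v = v) \<longrightarrow> v \<in> F"
    by (rule carter_hall[OF G c V ab r])
  have CQ: "v \<in> F" if "v \<in> V" "\<And>q. q \<in> Q \<Longrightarrow> cj q v = v" for v using CQ0 that by blast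
  have finQ: "finite Q" using Q finF finite_subset by blast
  have QG: "Q \<subseteq> G" using Q F by blast
  have QV: "q = 0" if "q \<in> Q" "q \<in> V" for q
    using nm_coprime_zero[OF r(2)[OF that(2)] nm_card[OF finQ Q(1) that(1)] cop] .
  have nQ: "nmz F Q" by (subst Qd) (rule nmz_torsion[OF nmz_self[OF F(1)]])
  interpret act: abelian_action "mon V" G cj by (rule conj_action[OF G V ab])
  obtain \<pi> :: "'a \<Rightarrow> 'a set sym" where pi: "homo G \<pi>" "\<And>x. x \<in> G \<Longrightarrow> \<pi> x = 0 \<longleftrightarrow> x \<in> V"
    using quotient_map[OF G(1) V] by metis
  \<comment> \<open>\<open>card Q\<close> annihilates the conjugate of q, so its component in P
    vanishes modulo V.\<close>
  have ex: "\<exists>q'\<in>Q. \<pi> (cj g q) = \<pi> q'" if q: "q \<in> Q" for q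
  proof -
    obtain f v where fv: "cj g q = f + v" "f \<in> F" "v \<in> V" using g(2)[OF subsetD[OF Q(2) q]] unfolding splus_def by blast
    obtain q' p where qp: "f = q' + p" "q' \<in> Q" "p \<in> P" using fv(2) FQP by (auto simp: splus_def)
    have mem: "f \<in> G" "q' \<in> G" "p \<in> G" "v \<in> G" "q \<in> G" "cj g q \<in> G" using fv(2,3) qp(2,3) F(2) Q(2) P(2) V(2) q sgrp_cj[OF G(1) g(1)] by blast+
    have cq: "coprime (card Q) (card P)" using cop P(3) by (simp add: coprime_commute)
    have finP: "finite P" using P finF finite_subset by blast
    have com: "q' + p = p + q'"
      using nil_coprime_commute[OF F(1,3), of q' "card Q" p "card P"] qp Q P nm_card[OF finQ Q(1) qp(2)] nm_card[OF finP P(1) qp(3)] cq by blast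
    have "nm (card Q) (cj g q) = 0" using nm_card[OF finQ Q(1) q] by (simp add: nm_cj)
    then have "nm (card Q) (\<pi> (cj g q)) = 0" using homo_nm[OF pi(1) G(1) mem(6)] homo_zero[OF pi(1) G(1)] by metis
    moreover have pf: "\<pi> (cj g q) = \<pi> f"
      using homoD[OF pi(1) mem(1,4)] fv(1) pi(2)[OF mem(4)] fv(3) by simp
    moreover have "\<pi> f = \<pi> q' + \<pi> p" using qp mem pi by (simp add: homoD)
    moreover have "\<pi> q' + \<pi> p = \<pi> p + \<pi> q'" using com mem pi homoD by metis
    moreover have "nm (card Q) (\<pi> q') = 0"
      using homo_nm[OF pi(1) G(1) mem(2), of "card Q"] nm_card[OF finQ Q(1) qp(2)] homo_zero[OF pi(1) G(1)] by simp
    ultimately have "nm (card Q) (\<pi> p) = 0" by (simp add: nm_commute_add)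
    moreover have "nm (card P) (\<pi> p) = 0"
      using homo_nm[OF pi(1) G(1) mem(3), of "card P"] nm_card[OF finP P(1) qp(3)] homo_zero[OF pi(1) G(1)] by simp
    ultimately have "\<pi> p = 0" using cq nm_coprime_zero by blast
    then show ?thesis using pf \<open>\<pi> f = \<pi> q' + \<pi> p\<close> qp by auto
  qed
  then obtain \<sigma> where \<sigma>: "\<And>q. q \<in> Q \<Longrightarrow> \<sigma> q \<in> Q" "\<And>q. q \<in> Q \<Longrightarrow> \<pi> (cj g q) = \<pi> (\<sigma> q)" by metis
  have injpi: "x = y" if "x \<in> Q" "y \<in> Q" "\<pi> x = \<pi> y" for x y
  proof -
    have "\<pi> (- x + y) = 0" using homo_eq_iff[OF pi(1) G(1), of x y] that QG by blast
    moreover have "- x + y \<in> Q" using that Q by (simp add: sgrp_mem)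
    ultimately have "- x + y = 0" using pi(2) QG QV by blast
    then have "x + (- x + y) = x" by simp
    then show ?thesis by simp
  qed
  have cjG: "cj g q \<in> G" if "q \<in> Q" for q using that QG g(1) G by (auto simp: sgrp_cj)
  have \<sigma>add: "\<sigma> (x + y) = \<sigma> x + \<sigma> y" if "x \<in> Q" "y \<in> Q" for x y
  proof (rule injpi)
    have "\<pi> (cj g (x + y)) = \<pi> (cj g x) + \<pi> (cj g y)" using that cjG pi(1) by (simp add: cj_add homoD)
    then show "\<pi> (\<sigma> (x + y)) = \<pi> (\<sigma> x + \<sigma> y)"
      using \<sigma> that Q QG pi(1) by (simp add: sgrp_mem homoD subset_iff)
  qed (use \<sigma> that Q in \<open>auto simp: sgrp_mem\<close>)
  have "inj_on \<sigma> Q"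
  proof (rule inj_onI)
    fix x y assume xy: "x \<in> Q" "y \<in> Q" "\<sigma> x = \<sigma> y"
    then have "\<pi> (cj g x) = \<pi> (cj g y)" using \<sigma> by metis
    then have "\<pi> (- cj g x + cj g y) = 0" using homo_eq_iff[OF pi(1) G(1)] cjG xy by blast
    then have "\<pi> (cj g (- x + y)) = 0" by (simp add: cj_add cj_uminus)
    moreover have m: "- x + y \<in> Q" using xy Q by (simp add: sgrp_mem)
    ultimately have "cj g (- x + y) \<in> V" using pi(2) cjG by blast
    then have "- x + y \<in> V" using nmz_cj_iff[OF V(3) G(1) g(1)] by blast
    then have "- x + y = 0" using QV m by blast
    then have "x + (- x + y) = x" by simp
    then show "x = y" by simp
  qed
  then have bij: "bij_betw \<sigma> Q Q" using \<sigma> finQ by (simp add: bij_betw_def endo_inj_surj image_subset_iff)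
  \<comment> \<open>The inverse of the automorphism \<open>\<sigma>\<close> of Q induced by g modulo
    V; with it, \<open>\<delta>\<close> compares a conjugate under g with q itself.\<close>
  define \<tau> where "\<tau> = inv_into Q \<sigma>"
  have \<tau>: "\<tau> q \<in> Q" "\<sigma> (\<tau> q) = q" if "q \<in> Q" for q
    using that bij by (auto simp: \<tau>_def bij_betw_def inv_into_into f_inv_into_f)
  have \<tau>add: "\<tau> (x + y) = \<tau> x + \<tau> y" if "x \<in> Q" "y \<in> Q" for x y
  proof -
    have m: "\<tau> (x + y) \<in> Q" "\<tau> x + \<tau> y \<in> Q" using that \<tau> Q by (auto simp: sgrp_mem)
    have "\<sigma> (\<tau> (x + y)) = \<sigma> (\<tau> x + \<tau> y)" using that \<tau> \<sigma>add Q by (simp add: sgrp_mem)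
    from inj_onD[OF \<open>inj_on \<sigma> Q\<close> this m] show ?thesis .
  qed
  define \<delta> where "\<delta> q = cj g (\<tau> q) + - q" for q
  have "act.cocycle Q \<delta>"
    unfolding act.cocycle_def
  proof (intro conjI ballI)
    show "\<delta> q \<in> carrier (mon V)" if q: "q \<in> Q" for q
    proof -
      have "\<pi> (cj g (\<tau> q)) = \<pi> q" using \<sigma>(2)[OF \<tau>(1)[OF q]] \<tau>(2)[OF q] by simp
      moreover have m: "cj g (\<tau> q) \<in> G" "q \<in> G" "- q \<in> G" using cjG \<tau> q QG G by (auto simp: sgrp_mem)
      ultimately have "\<pi> (\<delta> q) = 0"
        using homoD[OF pi(1) m(1,3)] homo_uminus[OF pi(1) G(1) m(2)] by (simp add: \<delta>_def)
      moreover have "\<delta> q \<in> G" using m G by (simp add: \<delta>_def sgrp_add)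
      ultimately show ?thesis using pi(2) by simp
    qed
    show "\<delta> (x + y) = \<delta> x \<otimes>\<^bsub>mon V\<^esub> cj x (\<delta> y)" if "x \<in> Q" "y \<in> Q" for x y
      using \<tau>add[OF that] by (simp add: \<delta>_def cj_add cj_def[of x] gsimps)
  qed
  moreover have "act.divisible_by (card Q)"
    using nm_coprime_zero[OF r(2) _ cop] V(1) by (auto simp: act.divisible_by_def pow_mon)
  ultimately obtain w where w: "w \<in> V" "\<And>q. q \<in> Q \<Longrightarrow> \<delta> q = w + - cj q w"
    using act.cocycle_coprime[OF Q(1) QG, of \<delta>] V(1,3) QG
    by (metis inv_mon mon_simps nmzD subsetD)
  have wG: "w \<in> G" using w V by blast
  have gw: "cj g (\<tau> q) = cj w q" if "q \<in> Q" for q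
  proof -
    have "cj g (\<tau> q) = \<delta> q + q" by (simp add: \<delta>_def add.assoc)
    also have "\<dots> = cj w q" unfolding w(2)[OF that] by (simp add: cj_def gsimps)
    finally show ?thesis .
  qed
  define g' where "g' = - w + g"
  have g'Q: "cj g' q \<in> Q" if "q \<in> Q" for q
  proof -
    have "\<tau> (\<sigma> q) = q" using that bij by (simp add: \<tau>_def bij_betw_def)
    then have "cj g q = cj w (\<sigma> q)" using gw[OF \<sigma>(1)[OF that]] by simp
    then have "cj g' q = \<sigma> q" by (simp add: g'_def cj_cj[symmetric])
    then show ?thesis using \<sigma> that by simp
  qed
  have g'G: "g' \<in> G" using g wG G by (simp add: g'_def sgrp_mem)
  have g'Q': "cj (- g') q \<in> Q" if q: "q \<in> Q" for q
  proof -
    have "cj g' ` Q = Q" by (rule endo_inj_surj[OF finQ]) (use g'Q in \<open>auto intro!: inj_onI\<close>)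
    then obtain p where "p \<in> Q" "q = cj g' p" using q by (metis imageE)
    then show ?thesis by simp
  qed
  have FV: "sgrp (splus F V)" "V \<subseteq> splus F V" "F \<subseteq> splus F V"
    using sgrp_splus[OF F(1) V(1) nmz_mono[OF V(3) F(2)]] splus_right[OF F(1)] splus_left[OF V(1)] by auto
  have "g' \<in> F"
  proof (rule F(4)[OF g'G])
    fix f assume f: "f \<in> F"
    have "- w \<in> splus F V" using w FV V by (auto simp: sgrp_mem subset_iff)
    then have "cj (- w) (cj g f) \<in> splus F V" using g(2)[OF f] FV(1) by (simp add: sgrp_cj)
    then obtain f1 v1 where fv: "cj g' f = f1 + v1" "f1 \<in> F" "v1 \<in> V" by (auto simp: splus_def g'_def cj_cj)
    \<comment> \<open>Both \<open>cj g' f\<close> and \<open>f1\<close> normalise Q, hence so does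
      \<open>v1\<close>. As V is normal, [v1, Q] lies in the trivial intersection of Q and
      V.\<close>
    have "v1 \<in> F"
    proof (rule CQ[OF fv(3)])
      fix q assume q: "q \<in> Q"
      have 1: "cj (cj g' f) q \<in> Q"
      proof -
        have "cj g' (cj f (cj (- g') q)) \<in> Q" using g'Q' g'Q q f nmzD[OF nQ] by blast
        then show ?thesis by (simp add: cj_cj) (simp add: cj_def gsimps)
      qed
      have e: "v1 = - f1 + cj g' f" using fv by simp
      have "cj v1 q = cj (- f1) (cj (cj g' f) q)" unfolding e by (simp add: cj_cj)
      then have "cj v1 q \<in> Q" using 1 nmzD[OF nQ] fv F by (simp add: sgrp_mem)
      then have "cm v1 q \<in> Q" using q Q by (simp add: cm_cj sgrp_mem)
      moreover have "cm v1 q \<in> V"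
        using cm_in_normal'[OF V(1,3) subsetD[OF QG q] fv(3)] .
      ultimately have "cm v1 q = 0" using QV by blast
      then show "cj q v1 = v1" by (simp add: cm_eq_zero cj_eq_self)
    qed
    then show "cj g' f \<in> F" using fv F by (simp add: sgrp_add)
  qed
  moreover have "g = w + g'" by (simp add: g'_def)
  ultimately show ?thesis using w FV by (metis sgrp_add subsetD)
qed

text \<open>The hypothesis \<open>norm\<close> is kept separate because
  \<open>carter_normalizer\<close> uses this lemma inside its own induction, where
  \<open>norm\<close> is the induction hypothesis.\<close>

lemma carter_image:
  assumes G: "sgrp G" and c: "carter G F" and f: "homo G f"
    and M: "sgrp M" "M \<subseteq> G" "\<And>x. x \<in> G \<Longrightarrow> f x = 0 \<longleftrightarrow> x \<in> M"
    and norm: "\<And>g. g \<in> G \<Longrightarrow> (\<And>x. x \<in> F \<Longrightarrow> cj g x \<in> splus F M) \<Longrightarrow> g \<in> splus F M"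
  shows "carter (f ` G) (f ` F)"
proof -
  have F: "sgrp F" "F \<subseteq> G" "nil F" using c by (auto simp: carter_def)
  have fM: "f ` M = {0}" using M sgrp_zero[OF M(1)] by (auto simp: image_iff subset_iff)
  have key: "f x \<in> f ` F \<longleftrightarrow> x \<in> splus F M" if "x \<in> G" for x
    using splus_image_mem[OF f G F(2) M(1,2) _ that] M(3) fM by (auto simp: splus_def)
  have "f g \<in> f ` F" if g: "g \<in> G" "\<forall>x\<in>f ` F. cj (f g) x \<in> f ` F" for g
  proof -
    have "cj g x \<in> splus F M" if x: "x \<in> F" for x
    proof -
      have "f (cj g x) \<in> f ` F" using g x homo_cj[OF f G g(1)] F by (metis imageI subsetD)
      then show ?thesis using key[of "cj g x"] g x F G by (auto simp: sgrp_cj subset_iff)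
    qed
    then show ?thesis using norm[OF g(1)] key[OF g(1)] by blast
  qed
  then show ?thesis
    using sgrp_image[OF f G F(2,1)] nil_image[OF F(3) homo_mono[OF f F(2)] F(1)] F by (auto simp: carter_def)
qed

text \<open>With a chief factor M/M0 at the top of M, induction for \<open>M0\<close> makes the
  image of F in G/M0 a Carter subgroup. There the image of M is elementary abelian, and the abelian
  case applies.\<close>

lemma carter_normalizer:
  assumes G: "sgrp G" "finite G" "solv G" and c: "carter G F"
  shows "sgrp M \<Longrightarrow> M \<subseteq> G \<Longrightarrow> nmz G M \<Longrightarrow> g \<in> G \<Longrightarrow> (\<And>f. f \<in> F \<Longrightarrow> cj g f \<in> splus F M) \<Longrightarrow> g \<in> splus F M"
proof (induct "card M" arbitrary: M g rule: less_induct)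
  case less
  note M = less.prems
  have F: "sgrp F" "F \<subseteq> G" using c by (auto simp: carter_def)
  have finM: "finite M" using M G finite_subset by blast
  show ?case
  proof (cases "M = {0}")
    case True
    then have "splus F M = F" by (auto simp: splus_def)
    then show ?thesis using M c by (simp add: carter_def)
  next
    case False
    then have "{0} \<subset> M" using sgrp_zero[OF M(1)] by auto
    then obtain M0 where M0: "chief G M0 M"
      using exists_chief[OF finM M(1,3), of "{0}"] by auto
    note cM0 = chiefD[OF M0]
    have M0G: "M0 \<subseteq> G" using cM0 M by blast
    obtain \<pi> :: "'a \<Rightarrow> 'a set sym" where pi: "homo G \<pi>" "\<And>x. x \<in> G \<Longrightarrow> \<pi> x = 0 \<longleftrightarrow> x \<in> M0"
      using quotient_map[OF G(1) cM0(1) M0G cM0(5)] by metis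
    have "carter (\<pi> ` G) (\<pi> ` F)"
      by (rule carter_image[OF G(1) c pi(1) cM0(1) M0G pi(2)])
         (use less.hyps[OF psubset_card_mono[OF finM cM0(3)] cM0(1) M0G cM0(5)] in auto)
    moreover have piG: "sgrp (\<pi> ` G)" "finite (\<pi> ` G)" using sgrp_image[OF pi(1) G(1) order_refl G(1)] G by auto
    moreover have "\<pi> ` M0 = {0}" using pi(2) M0G sgrp_zero[OF cM0(1)] homo_zero[OF pi(1) G(1)] by (auto simp: image_iff subset_iff) 
    then have ch: "chief (\<pi> ` G) {0} (\<pi> ` M)" using chief_image[OF pi(1) G(1) M0 M(2)] pi(2) by simp
    moreover have "\<pi> ` M \<subseteq> \<pi> ` G" using M by blast
    moreover have "solv (\<pi> ` M)" using solv_subset[OF solv_image[OF G(3,1,2) pi(1)]] M by blast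
    ultimately obtain r where r: "prime (r::nat)" "\<And>v. v \<in> \<pi> ` M \<Longrightarrow> nm r v = 0"
      "\<And>v w. v \<in> \<pi> ` M \<Longrightarrow> w \<in> \<pi> ` M \<Longrightarrow> v + w = w + v"
      using minimal_normal_solv[OF piG ch] by blast
    have sm: "\<pi> x \<in> splus (\<pi> ` F) (\<pi> ` M) \<longleftrightarrow> x \<in> splus F M" if "x \<in> G" for x
      by (rule splus_image_mem[OF pi(1) G(1) F(2) M(1,2) _ that]) (use pi(2) cM0 in blast)
    have "\<pi> g \<in> splus (\<pi> ` F) (\<pi> ` M)"
    proof (rule carter_normalizer_abelian[OF piG \<open>carter (\<pi> ` G) (\<pi> ` F)\<close> _ \<open>\<pi> ` M \<subseteq> \<pi> ` G\<close> _ r(3) r(1,2)])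
      show "sgrp (\<pi> ` M)" "nmz (\<pi> ` G) (\<pi> ` M)" using chiefD[OF ch] by auto
      show "\<pi> g \<in> \<pi> ` G" using M by blast
      show "cj (\<pi> g) f \<in> splus (\<pi> ` F) (\<pi> ` M)" if "f \<in> \<pi> ` F" for f
      proof -
        obtain x where x: "x \<in> F" "f = \<pi> x" using \<open>f \<in> \<pi> ` F\<close> by blast
        have xG: "x \<in> G" using x F by blast
        have "\<pi> (cj g x) \<in> splus (\<pi> ` F) (\<pi> ` M)" using sm[of "cj g x"] M(5)[OF x(1)] sgrp_cj[OF G(1) M(4) xG] by blast
        then show ?thesis using homo_cj[OF pi(1) G(1) M(4) xG] x by simp
      qed
    qed
    then show ?thesis using sm M by blast
  qed
qed

text \<open>The group \<open>G\<close> with its group \<open>H\<close> of automorphisms, both inside an ambient group \<open>X\<close> in which \<open>H\<close>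
  acts by conjugation.\<close>

definition frobcar :: "'a::group_add set \<Rightarrow> 'a set \<Rightarrow> 'a set \<Rightarrow> 'a set \<Rightarrow> bool" where
  "frobcar X G H F \<longleftrightarrow> sgrp X \<and> finite X \<and> sgrp G \<and> G \<subseteq> X \<and> nmz X G \<and> solv G \<and>
     sgrp H \<and> H \<subseteq> X \<and> G \<inter> H = {0} \<and> H \<noteq> {0} \<and> carter G F \<and> nmz H F \<and>
     (\<forall>h\<in>H. h \<noteq> 0 \<longrightarrow> (\<forall>f\<in>F. h + f = f + h \<longrightarrow> f = 0))"

definition cent :: "'a::group_add set \<Rightarrow> 'a set \<Rightarrow> 'a set" where
  "cent G H = {g \<in> G. \<forall>h\<in>H. cj h g = g}"

section \<open>Quotients of the configuration and lifting of fixed points\<close>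

lemma sgrp_cent: "sgrp G \<Longrightarrow> sgrp (cent G H)"
  unfolding cent_def by (rule sgrp_fix_set)

lemma cent_subset: "cent G H \<subseteq> G"
  by (auto simp: cent_def)

lemma frobcarD:
  assumes "frobcar X G H F"
  shows "sgrp X" "finite X" "sgrp G" "G \<subseteq> X" "nmz X G" "solv G" "sgrp H" "H \<subseteq> X" "H \<noteq> {0}"
    "carter G F" "nmz H F" "sgrp F" "F \<subseteq> G" "nil F" "F \<subseteq> X" "finite G" "finite H" "finite F"
    "\<And>g. g \<in> G \<Longrightarrow> (\<And>f. f \<in> F \<Longrightarrow> cj g f \<in> F) \<Longrightarrow> g \<in> F"
    "\<And>h f. h \<in> H \<Longrightarrow> h \<noteq> 0 \<Longrightarrow> f \<in> F \<Longrightarrow> h + f = f + h \<Longrightarrow> f = 0"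
    "\<And>x. x \<in> G \<Longrightarrow> x \<in> H \<Longrightarrow> x = 0" "G \<inter> H = {0}"
  using assms finite_subset[of _ X] by (auto simp: frobcar_def carter_def)

text \<open>If the images of q and h commute, then [q, h] lies in the part of F inside the kernel,
  on which the commutator map is bijective too; injectivity on F puts q there. As the kernel lies in
  G, the image of H still meets that of G trivially. The Carter property is inherited by
  \<open>carter_normalizer\<close>.\<close>

lemma frobcar_image:
  assumes fc: "frobcar X G H F" and f: "homo X f" and ker: "\<And>x. x \<in> X \<Longrightarrow> f x = 0 \<Longrightarrow> x \<in> G"
  shows "frobcar (f ` X) (f ` G) (f ` H) (f ` F)"
proof -
  note D = frobcarD[OF fc]
  note G = homo_mono[OF f D(4)]
  let ?M = "{x \<in> G. f x \<in> {0}}"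
  have M: "sgrp ?M" "nmz G ?M" "?M \<subseteq> G" "\<And>x. x \<in> G \<Longrightarrow> f x = 0 \<longleftrightarrow> x \<in> ?M"
    using sgrp_vimage[OF G D(3) sgrp_trivial] nmz_vimage[OF G D(3) order_refl order_refl nmz_self[OF D(3)] nmz_trivial] by auto
  have car: "carter (f ` G) (f ` F)"
    by (rule carter_image[OF D(3,10) G M(1,3,4)], assumption, rule carter_normalizer[OF D(3,16,6,10) M(1,3,2)])
  have GH: "f ` G \<inter> f ` H = {0}"
  proof -
    have "f g = 0" if g: "g \<in> G" and h: "h \<in> H" and e: "f g = f h" for g h
    proof -
      have X: "g \<in> X" "h \<in> X" using g h D(4,8) by auto
      have "f (- g + h) = 0" using homo_eq_iff[OF f D(1) X] e by simp
      then have "- g + h \<in> G" using ker X D(1) by (simp add: sgrp_mem)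
      then have "h \<in> G" using sgrp_add_left[OF D(3) sgrp_uminus[OF D(3) g]] by blast
      then have "h = 0" using D(21) h by blast
      then show ?thesis using e homo_zero[OF f D(1)] by simp
    qed
    moreover have "0 \<in> f ` G" "0 \<in> f ` H" using homo_zero[OF f D(1)] sgrp_zero[OF D(3)] sgrp_zero[OF D(7)] by force+
    ultimately show ?thesis by blast
  qed
  have Hne: "f ` H \<noteq> {0}"
  proof
    assume "f ` H = {0}"
    then have "h = 0" if "h \<in> H" for h using ker[of h] D(21)[of h] that D(8) by blast
    then show False using D(9) sgrp_zero[OF D(7)] by blast
  qed
  have fpf: "f q = 0" if h: "h \<in> H" "f h \<noteq> 0" and q: "q \<in> F" and c: "f h + f q = f q + f h" for h q
  proof -
    have X: "h \<in> X" "q \<in> X" using h q D(8,15) by auto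
    have h0: "h \<noteq> 0" using h homo_zero[OF f D(1)] by auto
    let ?F = "{x \<in> F. f x \<in> {0}}"
    have F0: "sgrp ?F" using sgrp_vimage[OF homo_mono[OF f D(15)] D(12) sgrp_trivial] .
    have hF: "cj h x \<in> F" if "x \<in> F" for x using D(11) h that by (simp add: nmzD)
    have hF0: "cj h x \<in> ?F" if "x \<in> ?F" for x
      using that hF homo_cj[OF f D(1) X(1), of x] D(15) by auto
    have b: "bij_betw (\<lambda>q. cm q h) F F"
      by (rule fixed_point_free_bij) (use D(12,18,20) hF h h0 in auto)
    have b0: "bij_betw (\<lambda>q. cm q h) ?F ?F"
      by (rule fixed_point_free_bij) (use F0 D(18,20) hF0 h h0 in auto)
    have "cm (f q) (f h) = 0" using c by (simp add: cm_eq_zero)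
    then have "f (cm q h) = 0" using homo_cm[OF f D(1) X(2,1)] by simp
    moreover have "cm q h \<in> F" using q hF[of "- q"] D(12) by (simp add: cm_cj' sgrp_mem)
    ultimately have "cm q h \<in> (\<lambda>q. cm q h) ` ?F" using bij_betw_imp_surj_on[OF b0] by simp
    then obtain s where s: "s \<in> ?F" "cm q h = cm s h" by blast
    then have "q = s" using bij_betw_imp_inj_on[OF b] q by (simp add: inj_on_def)
    then show ?thesis using s by simp
  qed
  show ?thesis
    unfolding frobcar_def
    using sgrp_image[OF f D(1) order_refl D(1)] D(2) sgrp_image[OF f D(1) D(4,3)] D(4)
      nmz_image[OF f D(1) D(4) order_refl D(5)] solv_image[OF D(6,3,16) G] sgrp_image[OF f D(1) D(8,7)] D(8)
      GH Hne car nmz_image[OF f D(1) D(15,8,11)] fpf by blast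
qed

text \<open>A subgroup of order r in H acts on F with 0 as its only fixed point, so r divides
  \<open>card F - 1\<close>.\<close>

lemma frobcar_coprime:
  assumes fc: "frobcar X G H F" and r: "prime (r::nat)" "r dvd card H"
  shows "\<not> r dvd card F"
proof -
  note D = frobcarD[OF fc]
  obtain P where P: "sgrp P" "P \<subseteq> H" "card P = r ^ 1"
    using sylow_set[OF D(17,7) r(1), of 1] r(2) by auto
  have finP: "finite P" using P(2) D(17) finite_subset by blast
  have "card P > 1" using P(3) prime_gt_1_nat[OF r(1)] by simp
  then have "\<not> P \<subseteq> {0}" using card_mono[of "{0::'a}" P] by auto
  then obtain h where h: "h \<in> P" "h \<noteq> 0" by blast
  have "r dvd card (F - {b \<in> F. \<forall>x\<in>P. cj x b = b})"
    by (rule card_non_fixed_dvd[OF P(1) finP sgrp_trivial _ r(1), of 1])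
       (use P D(18) D(11) sgrp_zero[OF P(1)] in \<open>auto simp: cj_cj nmz_def\<close>)
  moreover have "{b \<in> F. \<forall>x\<in>P. cj x b = b} = {0}"
    using D(20)[of h] h P(2) sgrp_zero[OF D(12)] by (auto simp: cj_eq_self)
  ultimately have "r dvd card F - 1" using D(18) sgrp_zero[OF D(12)] by simp
  moreover have "card F > 0" using card_sgrp_pos[OF D(18,12)] .
  ultimately show ?thesis using r(1) by (metis One_nat_def Suc_pred dvd_diffD1 not_prime_unit less_eq_Suc_le)
qed

text \<open>The vanishing of the first cohomology group of \<open>H\<close> with values in \<open>V\<close>.\<close>

lemma covering_abelian:
  assumes fc: "frobcar X G H F" and V: "sgrp V" "V \<subseteq> G" "nmz X V"
    and ab: "\<And>v w. v \<in> V \<Longrightarrow> w \<in> V \<Longrightarrow> v + w = w + v"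
    and r: "prime (r::nat)" "\<And>v. v \<in> V \<Longrightarrow> nm r v = 0"
    and g: "g \<in> G" "\<And>h. h \<in> H \<Longrightarrow> - g + cj h g \<in> V"
  shows "\<exists>v\<in>V. \<forall>h\<in>H. cj h (g + v) = g + v"
proof -
  note D = frobcarD[OF fc]
  have VX: "V \<subseteq> X" using V(2) D(4) by blast
  interpret act: abelian_action "mon V" X cj by (rule conj_action[OF D(1,2) V(1) VX V(3) ab])
  define \<delta> where "\<delta> h = - g + cj h g" for h
  have coc: "act.cocycle H \<delta>"
    unfolding act.cocycle_def
  proof (intro conjI ballI)
    show "\<delta> (x + y) = \<delta> x \<otimes>\<^bsub>mon V\<^esub> cj x (\<delta> y)" for x y
      by (simp add: \<delta>_def cj_add cj_uminus cj_cj add.assoc)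
  qed (use g in \<open>simp add: \<delta>_def\<close>)
  have "\<exists>w\<in>carrier (mon V). \<forall>h\<in>H. \<delta> h = w \<otimes>\<^bsub>mon V\<^esub> inv\<^bsub>mon V\<^esub> (cj h w)"
  proof (cases "r dvd card H")
    case False
    then have "act.divisible_by (card H)"
      using coprime_exponent_zero[OF r(1) _ r(2)] V(1) by (auto simp: act.divisible_by_def pow_mon)
    then show ?thesis using act.cocycle_coprime[OF D(7,8) coc] by metis
  next
    case True
    then have rF: "\<not> r dvd card F" using frobcar_coprime[OF fc r(1)] by blast
    then have "act.divisible_by (card F)"
      using coprime_exponent_zero[OF r(1) _ r(2)] V(1) by (auto simp: act.divisible_by_def pow_mon)
    moreover have "act.frob F H" using D(7,8,11,12,15,20) unfolding act.frob_def by blast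
    \<comment> \<open>An element of V centralised by F normalises F and so lies in F; its order
      divides r and the order of F, which r does not divide.\<close>
    moreover have "act.fix_set F \<subseteq> {\<one>\<^bsub>mon V\<^esub>}"
    proof
      fix v assume "v \<in> act.fix_set F"
      then have v: "v \<in> V" "\<And>f. f \<in> F \<Longrightarrow> cj f v = v" by (auto simp: act.fix_set_def)
      have "cj v f = f" if "f \<in> F" for f using cj_commute[OF v(2)[OF that]] .
      then have "v \<in> F" using D(19)[of v] v(1) V(2) by auto
      then have "v = 0" using coprime_exponent_zero[OF r(1) rF r(2)[OF v(1)]] nm_card[OF D(18,12)] by blast
      then show "v \<in> {\<one>\<^bsub>mon V\<^esub>}" by simp
    qed
    ultimately show ?thesis using act.cocycle_frobenius[OF _ _ _ coc] by metis
  qed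
  then obtain w where w: "w \<in> V" "\<And>h. h \<in> H \<Longrightarrow> \<delta> h = w + inv\<^bsub>mon V\<^esub> (cj h w)" by auto
  have "cj h (g + w) = g + w" if h: "h \<in> H" for h
  proof -
    have "cj h w \<in> V" using nmzD[OF V(3)] w(1) h D(8) by blast
    then have "\<delta> h = w + - cj h w" using w(2)[OF h] inv_mon[OF V(1)] by simp
    then have "\<delta> h + cj h w = w" by (simp add: add.assoc)
    then have "g + (\<delta> h + cj h w) = g + w" by simp
    then show ?thesis by (simp add: \<delta>_def cj_add add.assoc[symmetric])
  qed
  then show ?thesis using w(1) by blast
qed

text \<open>One step along a chief series: the hypotheses survive in X/M, where the image of N is
  minimal normal and, by solvability, elementary abelian.\<close>

lemma chief_quotient:
  assumes fc: "frobcar X G H F" and ch: "chief X M N" and N: "N \<subseteq> G"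
  obtains \<pi> :: "'a::group_add \<Rightarrow> 'a set sym" and r where "homo X \<pi>" "\<forall>x\<in>X. \<pi> x = 0 \<longleftrightarrow> x \<in> M"
    "frobcar (\<pi> ` X) (\<pi> ` G) (\<pi> ` H) (\<pi> ` F)" "chief (\<pi> ` X) {0} (\<pi> ` N)" "\<pi> ` N \<subseteq> \<pi> ` G"
    "prime (r::nat)" "\<forall>v\<in>\<pi> ` N. nm r v = 0" "\<forall>v\<in>\<pi> ` N. \<forall>w\<in>\<pi> ` N. v + w = w + v"
proof -
  note D = frobcarD[OF fc] and C = chiefD[OF ch]
  have MX: "M \<subseteq> X" "N \<subseteq> X" "M \<subseteq> G" using C(4) N D(4) by auto
  obtain \<pi> :: "'a \<Rightarrow> 'a set sym" where pi: "homo X \<pi>" "\<And>x. x \<in> X \<Longrightarrow> \<pi> x = 0 \<longleftrightarrow> x \<in> M"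
    using quotient_map[OF D(1) C(1) MX(1) C(5)] by metis
  have fcp: "frobcar (\<pi> ` X) (\<pi> ` G) (\<pi> ` H) (\<pi> ` F)" by (rule frobcar_image[OF fc pi(1)]) (use pi(2) MX in blast)
  note P = frobcarD[OF fcp]
  have "\<pi> ` M = {0}" using pi(2) MX sgrp_zero[OF C(1)] homo_zero[OF pi(1) D(1)] by (auto simp: image_iff subset_iff)
  then have chp: "chief (\<pi> ` X) {0} (\<pi> ` N)" using chief_image[OF pi(1) D(1) ch MX(2)] pi(2) by simp
  have NG: "\<pi> ` N \<subseteq> \<pi> ` G" using N by blast
  then have NX: "\<pi> ` N \<subseteq> \<pi> ` X" using P(4) by blast
  obtain r where "prime (r::nat)" "\<And>v. v \<in> \<pi> ` N \<Longrightarrow> nm r v = 0"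
      "\<And>v w. v \<in> \<pi> ` N \<Longrightarrow> w \<in> \<pi> ` N \<Longrightarrow> v + w = w + v"
    using minimal_normal_solv[OF P(1,2) chp NX solv_subset[OF P(6) NG]] by blast
  then show thesis using pi by (intro that[OF pi(1) _ fcp chp NG]) auto
qed

text \<open>For a chief factor M/M0 at the top of M, the abelian case supplies \<open>m1\<close>
  that makes the coset of the element modulo \<open>M0\<close> fixed by H; induction corrects it
  further inside \<open>M0\<close>.\<close>

lemma covering:
  assumes fc: "frobcar X G H F"
  shows "sgrp M \<Longrightarrow> M \<subseteq> G \<Longrightarrow> nmz X M \<Longrightarrow> g \<in> G \<Longrightarrow> (\<And>h. h \<in> H \<Longrightarrow> - g + cj h g \<in> M) \<Longrightarrow>
    \<exists>m\<in>M. \<forall>h\<in>H. cj h (g + m) = g + m"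
proof (induct "card M" arbitrary: M g rule: less_induct)
  case less
  note M = less.prems
  note D = frobcarD[OF fc]
  have finM: "finite M" using M(2) D(16) finite_subset by blast
  show ?case
  proof (cases "M = {0}")
    case True
    have "cj h g = g" if "h \<in> H" for h
    proof -
      have "g + (- g + cj h g) = g" using M(5)[OF that] True by simp
      then show ?thesis by simp
    qed
    then show ?thesis using True by simp
  next
    case False
    then have "{0} \<subset> M" using sgrp_zero[OF M(1)] by auto
    then obtain M0 where ch: "chief X M0 M" using exists_chief[OF finM M(1,3), of "{0}"] by auto
    note C = chiefD[OF ch]
    obtain \<pi> :: "'a \<Rightarrow> 'a set sym" and r where pi0: "homo X \<pi>" "\<forall>x\<in>X. \<pi> x = 0 \<longleftrightarrow> x \<in> M0"
      and fcp: "frobcar (\<pi> ` X) (\<pi> ` G) (\<pi> ` H) (\<pi> ` F)" and chp: "chief (\<pi> ` X) {0} (\<pi> ` M)"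
      and NG: "\<pi> ` M \<subseteq> \<pi> ` G" and r0: "prime (r::nat)" "\<forall>v\<in>\<pi> ` M. nm r v = 0"
      and ab0: "\<forall>v\<in>\<pi> ` M. \<forall>w\<in>\<pi> ` M. v + w = w + v"
      by (rule chief_quotient[OF fc ch M(2)])
    note pi = pi0(1) bspec[OF pi0(2)] and r = r0(1) bspec[OF r0(2)] and ab = bspec[OF bspec[OF ab0]]
    have gX: "g \<in> X" using M(4) D(4) by blast
    have dif: "\<pi> (- x + cj h x) = - \<pi> x + cj (\<pi> h) (\<pi> x)" if "x \<in> X" "h \<in> H" for x h
    proof -
      have h: "h \<in> X" "cj h x \<in> X" "- x \<in> X" using that D(1,8) by (auto simp: sgrp_mem sgrp_cj)
      then show ?thesis using homoD[OF pi(1) h(3,2)] homo_uminus[OF pi(1) D(1) that(1)] homo_cj[OF pi(1) D(1) h(1) that(1)] by simp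
    qed
    have "\<exists>v\<in>\<pi> ` M. \<forall>h\<in>\<pi> ` H. cj h (\<pi> g + v) = \<pi> g + v"
    proof (rule covering_abelian[OF fcp chiefD(2)[OF chp] NG chiefD(6)[OF chp] ab r])
      show "\<pi> g \<in> \<pi> ` G" using M(4) by blast
      show "- \<pi> g + cj h (\<pi> g) \<in> \<pi> ` M" if "h \<in> \<pi> ` H" for h
      proof -
        obtain k where k: "k \<in> H" "h = \<pi> k" using \<open>h \<in> \<pi> ` H\<close> by blast
        then show ?thesis using dif[OF gX k(1)] M(5)[OF k(1)] by (metis imageI)
      qed
    qed
    then obtain m1 where m1: "m1 \<in> M" "\<And>h. h \<in> H \<Longrightarrow> cj (\<pi> h) (\<pi> g + \<pi> m1) = \<pi> g + \<pi> m1" by blast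
    have m1X: "m1 \<in> X" "g + m1 \<in> X" "g + m1 \<in> G" using m1(1) M(2,4) D(1,3,4) gX by (auto simp: sgrp_add subset_iff)
    have "- (g + m1) + cj h (g + m1) \<in> M0" if h: "h \<in> H" for h
    proof -
      have "\<pi> (- (g + m1) + cj h (g + m1)) = 0"
        using dif[OF m1X(2) h] m1(2)[OF h] homoD[OF pi(1) gX m1X(1)] by simp
      moreover have "- (g + m1) + cj h (g + m1) \<in> X" using m1X(2) h D(1,8) by (blast intro: sgrp_mem sgrp_cj)
      ultimately show ?thesis using pi(2) by blast
    qed
    then obtain m0 where m0: "m0 \<in> M0" "\<forall>h\<in>H. cj h (g + m1 + m0) = g + m1 + m0"
      using less.hyps[OF psubset_card_mono[OF finM C(3)] C(1) _ C(5) m1X(3)] C(4) M(2) by blast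
    have "m1 + m0 \<in> M" using m0 m1 C(4) M(1) by (blast intro: sgrp_add)
    then show ?thesis using m0(2) by (intro bexI[of _ "m1 + m0"]) (simp_all add: add.assoc)
  qed
qed

text \<open>Lifting a fixed point through the kernel of f is an instance of \<open>covering\<close>.
  This equality carries statements about fixed points to quotients.\<close>

lemma cent_image:
  assumes fc: "frobcar X G H F" and f: "homo X f" and ker: "\<And>x. x \<in> X \<Longrightarrow> f x = 0 \<Longrightarrow> x \<in> G"
  shows "cent (f ` G) (f ` H) = f ` cent G H"
proof
  note D = frobcarD[OF fc]
  show "f ` cent G H \<subseteq> cent (f ` G) (f ` H)"
  proof
    fix y assume "y \<in> f ` cent G H"
    then obtain x where x: "x \<in> G" "\<And>h. h \<in> H \<Longrightarrow> cj h x = x" "y = f x" by (auto simp: cent_def)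
    have "cj (f h) y = y" if "h \<in> H" for h
      using homo_cj[OF f D(1), of h x] x D(4,8) that by (metis subsetD)
    then show "y \<in> cent (f ` G) (f ` H)" using x by (auto simp: cent_def)
  qed
  show "cent (f ` G) (f ` H) \<subseteq> f ` cent G H"
  proof
    fix y assume y: "y \<in> cent (f ` G) (f ` H)"
    then obtain g where g: "g \<in> G" "y = f g" by (auto simp: cent_def)
    let ?M = "{x \<in> G. f x \<in> {0}}"
    have M: "sgrp ?M" "nmz X ?M"
      using sgrp_vimage[OF homo_mono[OF f D(4)] D(3) sgrp_trivial] nmz_vimage[OF f D(1,4) order_refl D(5) nmz_trivial] .
    have gX: "g \<in> X" using g(1) D(4) by blast
    have "- g + cj h g \<in> ?M" if h: "h \<in> H" for h
    proof -
      have hX: "h \<in> X" using h D(8) by blast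
      have m: "cj h g \<in> G" using nmzD[OF D(5) hX g(1)] .
      have "f (cj h g) = f g" using homo_cj[OF f D(1) hX gX] y g h by (auto simp: cent_def)
      then have "f (- g + cj h g) = 0" using homo_eq_iff[OF f D(1) gX] m D(4) by (metis subsetD)
      then show ?thesis using g m D(3) by (simp add: sgrp_mem)
    qed
    then obtain m where m: "m \<in> ?M" "\<forall>h\<in>H. cj h (g + m) = g + m"
      using covering[OF fc M(1) _ M(2) g(1)] by blast
    have "f (g + m) = y" using m g gX D(4) homoD[OF f, of g m] by auto
    moreover have "g + m \<in> cent G H" using m g D(3) by (simp add: cent_def sgrp_add)
    ultimately show "y \<in> f ` cent G H" by blast
  qed
qed

text \<open>Norms over H vanish on V, so the partition identity for Q and H becomes
  \<open>act.N Q v = nm (card Q) v\<close>. The left side is centralised by Q, hence lies in F by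
  \<open>carter_hall\<close>. As r annihilates v and is coprime to \<open>card Q\<close>, also v
  lies in F.\<close>

lemma abelian_in_carter:
  assumes fc: "frobcar X G H F" and V: "sgrp V" "V \<subseteq> G" "nmz X V"
    and ab: "\<And>v w. v \<in> V \<Longrightarrow> w \<in> V \<Longrightarrow> v + w = w + v"
    and r: "prime (r::nat)" "\<And>v. v \<in> V \<Longrightarrow> nm r v = 0" and C: "cent V H = {0}"
  shows "V \<subseteq> F"
proof
  fix v assume v: "v \<in> V"
  note D = frobcarD[OF fc]
  have VX: "V \<subseteq> X" using V(2) D(4) by blast
  interpret act: abelian_action "mon V" X cj by (rule conj_action[OF D(1,2) V(1) VX V(3) ab])
  obtain Q P k where Q: "sgrp Q" "Q \<subseteq> F" and P: "sgrp P" "P \<subseteq> F" "card P = r ^ k"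
    and cop: "coprime r (card Q)" and Qd: "Q = {x \<in> F. nm (card Q) x = 0}"
    and FQP: "F = splus Q P" and CQ: "\<forall>v\<in>V. (\<forall>q\<in>Q. cj q v = v) \<longrightarrow> v \<in> F"
    by (rule carter_hall[OF D(3,16,10) V(1,2) nmz_mono[OF V(3) D(4)] ab r])
  have QX: "Q \<subseteq> X" using Q(2) D(15) by blast
  have "nmz H Q" by (subst Qd) (rule nmz_torsion[OF D(11)])
  then have fr: "act.frob Q H" using Q QX D(7,8,20) unfolding act.frob_def by blast
  have NH: "act.N H u = 0" if u: "u \<in> V" for u
  proof -
    have "act.N H u \<in> V" using act.N_closed[OF D(8), of u] u by simp
    moreover have "cj h (act.N H u) = act.N H u" if "h \<in> H" for h
      using act.act_N[OF D(7,8) that, of u] u by simp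
    ultimately show ?thesis using C by (auto simp: cent_def)
  qed
  have cl: "cj q v \<in> V" if "q \<in> X" for q using nmzD[OF V(3) that v] .
  have mQ: "- q \<in> X" if "q \<in> Q" for q using that QX D(1) by (auto simp: sgrp_mem)
  have "finprod (mon V) (\<lambda>q. cj q (act.N H (cj (- q) v))) Q = 0"
    using act.finprod_one_eqI[of Q "\<lambda>q. cj q (act.N H (cj (- q) v))"] NH cl mQ by simp
  then have "act.N Q v = nm (card Q) v"
    using act.frobenius_partition[OF fr, of v] v NH act.N_one[OF QX] pow_mon[OF V(1) v] by simp
  moreover have "cj q (act.N Q v) = act.N Q v" if "q \<in> Q" for q
    using act.act_N[OF Q(1) QX that, of v] v by simp
  moreover have "act.N Q v \<in> V" using act.N_closed[OF QX, of v] v by simp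
  ultimately have "nm (card Q) v \<in> F" using CQ by metis
  moreover have "nm r v \<in> F" using r(2)[OF v] sgrp_zero[OF D(12)] by simp
  ultimately show "v \<in> F" using nm_coprime_mem[OF D(12) _ _ cop] by blast
qed

text \<open>By \<open>cent_image\<close>, H has no nontrivial fixed points on G/L for L above M. So
  \<open>abelian_in_carter\<close> puts the chief factor N/L into the image of F, and induction
  covers L.\<close>

lemma fixed_point_free_in_carter:
  assumes fc: "frobcar X G H F" and C: "cent G H \<subseteq> M" and M: "sgrp M" "M \<subseteq> G" "nmz X M"
  shows "sgrp N \<Longrightarrow> M \<subseteq> N \<Longrightarrow> N \<subseteq> G \<Longrightarrow> nmz X N \<Longrightarrow> N \<subseteq> splus F M"
proof (induct "card N" arbitrary: N rule: less_induct)
  case less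
  note N = less.prems
  note D = frobcarD[OF fc]
  have finN: "finite N" using N(3) D(16) finite_subset by blast
  show ?case
  proof (cases "N = M")
    case True then show ?thesis using splus_right[OF D(12)] by blast
  next
    case False
    then obtain L where L: "M \<subseteq> L" "chief X L N" using exists_chief[OF finN N(1,4) M(1,3)] N(2) by blast
    note ch = L(2)
    note CL = chiefD[OF ch]
    have LF: "L \<subseteq> splus F M"
      using less.hyps[OF psubset_card_mono[OF finN CL(3)] CL(1) L(1) _ CL(5)] CL(4) N(3) by blast
    obtain \<pi> :: "'a \<Rightarrow> 'a set sym" and r where pi0: "homo X \<pi>" "\<forall>x\<in>X. \<pi> x = 0 \<longleftrightarrow> x \<in> L"
      and fcp: "frobcar (\<pi> ` X) (\<pi> ` G) (\<pi> ` H) (\<pi> ` F)" and chp: "chief (\<pi> ` X) {0} (\<pi> ` N)"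
      and NG: "\<pi> ` N \<subseteq> \<pi> ` G" and r0: "prime (r::nat)" "\<forall>v\<in>\<pi> ` N. nm r v = 0"
      and ab0: "\<forall>v\<in>\<pi> ` N. \<forall>w\<in>\<pi> ` N. v + w = w + v"
      by (rule chief_quotient[OF fc ch N(3)])
    note pi = pi0(1) bspec[OF pi0(2)] and r = r0(1) bspec[OF r0(2)] and ab = bspec[OF bspec[OF ab0]]
    have LG: "L \<subseteq> G" using CL(4) N(3) by blast
    have "cent (\<pi> ` G) (\<pi> ` H) = \<pi> ` cent G H" by (rule cent_image[OF fc pi(1)]) (use pi(2) LG in blast)
    moreover have "\<pi> x = 0" if "x \<in> cent G H" for x using pi(2)[of x] that C L(1) LG D(4) by blast
    ultimately have "cent (\<pi> ` G) (\<pi> ` H) \<subseteq> {0}" by auto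
    moreover have "cent (\<pi> ` N) (\<pi> ` H) \<subseteq> cent (\<pi> ` G) (\<pi> ` H)" using NG unfolding cent_def by blast
    ultimately have "cent (\<pi> ` N) (\<pi> ` H) = {0}"
      using sgrp_zero[OF sgrp_cent[OF chiefD(2)[OF chp]]] by blast
    from abelian_in_carter[OF fcp chiefD(2)[OF chp] NG chiefD(6)[OF chp] ab r this] have "\<pi> ` N \<subseteq> \<pi> ` F" .
    moreover have "x \<in> splus F L" if x: "x \<in> N" "\<pi> x \<in> \<pi> ` F" for x
    proof -
      obtain f where f: "f \<in> F" "\<pi> x = \<pi> f" using x(2) by blast
      have X: "f \<in> X" "x \<in> X" using f x D(15) N(3) D(4) by auto
      have "\<pi> (- f + x) = 0" using homo_eq_iff[OF pi(1) D(1) X] f by simp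
      then have "- f + x \<in> L" using pi(2) X D(1) by (simp add: sgrp_mem)
      moreover have "x = f + (- f + x)" by simp
      ultimately show ?thesis using f(1) unfolding splus_def by blast
    qed
    ultimately have "N \<subseteq> splus F L" by blast
    also have "splus F L \<subseteq> splus F M"
      by (rule splus_subset[OF sgrp_splus[OF D(12) M(1) nmz_mono[OF M(3) D(15)]] splus_left[OF M(1)] LF])
    finally show ?thesis .
  qed
qed

text \<open>The commutator map with h is surjective on the intersection of F and S and injective on
  F.\<close>

lemma fixed_point_free_mem:
  assumes F: "sgrp F" "finite F" and h: "\<And>q. q \<in> F \<Longrightarrow> cj h q \<in> F"
    and fpf: "\<And>q. q \<in> F \<Longrightarrow> h + q = q + h \<Longrightarrow> q = 0"
    and S: "sgrp S" "\<And>s. s \<in> S \<Longrightarrow> cj h s \<in> S" and q: "q \<in> F" "cm q h \<in> S"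
  shows "q \<in> S"
proof -
  have b: "bij_betw (\<lambda>q. cm q h) F F"
    by (rule fixed_point_free_bij) (use F h fpf in auto)
  have b0: "bij_betw (\<lambda>q. cm q h) (F \<inter> S) (F \<inter> S)"
    by (rule fixed_point_free_bij) (use F h fpf S sgrp_Int[OF F(1) S(1)] in auto)
  have "cm q h \<in> F" using q(1) h[of "- q"] F(1) by (simp add: cm_cj' sgrp_mem)
  then have "cm q h \<in> (\<lambda>q. cm q h) ` (F \<inter> S)" using bij_betw_imp_surj_on[OF b0] q(2) by simp
  then obtain s where s: "s \<in> F \<inter> S" "cm q h = cm s h" by blast
  then have "q = s" using bij_betw_imp_inj_on[OF b] q by (simp add: inj_on_def)
  then show ?thesis using s by simp
qed

section \<open>The action of the Fitting subgroup of the fixed points on chief factors\<close>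

lemma sgrp_centralizer: "sgrp L \<Longrightarrow> sgrp {y \<in> L. \<forall>v\<in>V. cj y v = v}"
  by (rule sgrpI) (auto simp: sgrp_mem cj_cj[symmetric] cj_eq_iff[of "- _"])

lemma nmz_centralizer:
  assumes "sgrp X" "nmz X L" "nmz X V"
  shows "nmz X {y \<in> L. \<forall>v\<in>V. cj y v = v}"
  unfolding nmz_def
proof (intro ballI CollectI conjI)
  fix x y assume x: "x \<in> X" and y: "y \<in> {y \<in> L. \<forall>v\<in>V. cj y v = v}"
  then show "cj x y \<in> L" using assms by (simp add: nmzD)
  fix v assume "v \<in> V"
  then have "cj (- x) v \<in> V" using assms x by (simp add: nmzD sgrp_uminus)
  then have "cj y (cj (- x) v) = cj (- x) v" using y by blast
  then have "cj x (cj y (cj (- x) v)) = v" by simp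
  then show "cj (cj x y) v = v" by (simp add: cj_cj) (simp add: cj_def gsimps)
qed

lemma nil_abelian: assumes "sgrp V" "\<And>v w. v \<in> V \<Longrightarrow> w \<in> V \<Longrightarrow> v + w = w + v" shows "nil V"
proof -
  have "lcs V (Suc 0) \<subseteq> {0}"
    unfolding lcs.simps using assms(2) by (intro gen_least) (auto simp: cm_eq_zero)
  then have "lcs V (Suc 0) = {0}" using sgrp_zero[OF sgrp_lcs[OF assms(1), of "Suc 0"]] by blast
  then show ?thesis unfolding nil_def by blast
qed

text \<open>No \<open>r\<close>-element acts nontrivially on \<open>V\<close> modulo the kernel of the action of \<open>L\<close>: the
  Sylow \<open>r\<close>-subgroup of the nilpotent group induced by \<open>L\<close> is normal in \<open>X\<close> and fixes a nontrivial
  element of \<open>V\<close>.\<close>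

lemma irreducible_action_coprime:
  assumes X: "sgrp X" "finite X" and ch: "chief X {0} V" and V: "V \<subseteq> X"
    and r: "prime (r::nat)" "\<And>v. v \<in> V \<Longrightarrow> nm r v = 0"
    and L: "sgrp L" "L \<subseteq> X" "nmz X L" and E: "E = {y \<in> L. \<forall>v\<in>V. cj y v = v}" and lcs: "lcs L i \<subseteq> E"
  obtains m where "m > 0" "coprime r m" "\<And>y. y \<in> L \<Longrightarrow> nm m y \<in> E"
proof -
  note C = chiefD[OF ch]
  have finL: "finite L" "finite V" using L(2) V X finite_subset by auto
  have sE: "sgrp E" "nmz X E" "E \<subseteq> L" "E \<subseteq> X"
    using sgrp_centralizer[OF L(1)] nmz_centralizer[OF X(1) L(3) C(6)] L(2) by (auto simp: E)
  obtain \<pi> :: "'a \<Rightarrow> 'a set sym" where pi: "homo X \<pi>" "\<And>x. x \<in> X \<Longrightarrow> \<pi> x = 0 \<longleftrightarrow> x \<in> E"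
    using quotient_map[OF X(1) sE(1,4,2)] by metis
  have piL: "homo L \<pi>" using homo_mono[OF pi(1) L(2)] .
  have Lq: "sgrp (\<pi> ` L)" "finite (\<pi> ` L)" using sgrp_image[OF pi(1) X(1) L(2,1)] finL by auto
  have "lcs L i \<subseteq> {x \<in> L. \<pi> x = 0}" using lcs sE(3) pi(2) L(2) by blast
  then have nL: "nil (\<pi> ` L)" using nil_image_iff[OF piL L(1)] by blast
  obtain Q P k where Q: "sgrp Q" "Q \<subseteq> \<pi> ` L" and P: "sgrp P" "P \<subseteq> \<pi> ` L" "card P = r ^ k"
    and cop: "coprime r (card Q)" and cL: "card (\<pi> ` L) = r ^ k * card Q"
    and Qd: "Q = {x \<in> \<pi> ` L. nm (card Q) x = 0}" and Pd: "P = {x \<in> \<pi> ` L. nm (r ^ k) x = 0}" and sp: "\<pi> ` L = splus Q P"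
    by (rule nil_hall[OF Lq nL r(1)])
  define S where "S = {y \<in> L. \<pi> y \<in> P}"
  have S: "sgrp S" "S \<subseteq> L" "S \<subseteq> X" using sgrp_vimage[OF piL L(1) P(1)] L(2) by (auto simp: S_def)
  have "nmz (\<pi> ` X) P" by (subst Pd) (rule nmz_torsion[OF nmz_image[OF pi(1) X(1) L(2) order_refl L(3)]])
  then have nS: "nmz X S" unfolding S_def by (rule nmz_vimage[OF pi(1) X(1) L(2) order_refl L(3)])
  have "\<pi> x = 0" if "x \<in> E" for x using that pi(2) sE(4) by blast
  then have ES: "E \<subseteq> S" using sE(3) sgrp_zero[OF P(1)] by (auto simp: S_def)
  have "\<pi> ` S = P" using P(2) by (auto simp: S_def)
  moreover have "{x \<in> S. \<pi> x = 0} = E" using ES S(3) pi(2) by blast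
  moreover have finS: "finite S" using S(2) finL(1) finite_subset by blast
  ultimately have cS: "card S = r ^ k * card E"
    using card_image_kernel[OF homo_mono[OF pi(1) S(3)] S(1)] P(3) by simp
  define W where "W = {v \<in> V. \<forall>x\<in>S. cj x v = v}"
  have W: "sgrp W" "nmz X W" "W \<subseteq> V"
    using sgrp_fix_set[OF C(2)] normal_fix_set[OF X(1) C(6) nS] by (auto simp: W_def)
  have "r dvd card (V - W)"
    unfolding W_def
    by (rule card_non_fixed_dvd[OF S(1) finS sE(1) ES r(1) cS finL(2)])
       (use nmzD[OF C(6)] S(3) E in \<open>auto simp: cj_cj\<close>)
  moreover obtain v0 where "v0 \<in> V" "v0 \<noteq> 0" using C(3) by blast
  then have "r dvd card V" using exponent_dvd_card[OF C(2) finL(2) r] by blast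
  moreover have "card V = card (V - W) + card W" by (rule card_Diff_add[OF finL(2) W(3)])
  ultimately have "r dvd card W" by (simp only: dvd_add_right_iff)
  then have "W \<noteq> {0}" using r(1) by auto
  then have "W = V" using C(7)[OF W(1,2)] W(3) sgrp_zero[OF W(1)] by blast
  then have "S \<subseteq> E" using S(2) unfolding W_def E by blast
  then have "\<pi> x = 0" if "x \<in> S" for x using that pi(2) S(3) by blast
  then have "P \<subseteq> {0}" using \<open>\<pi> ` S = P\<close> by blast
  then have "P = {0}" using sgrp_zero[OF P(1)] by blast
  then have "r ^ k = 1" using P(3) by simp
  then have cQ: "card (\<pi> ` L) = card Q" using cL by simp
  show thesis
  proof (rule that[of "card Q"])
    show "card Q > 0" using card_sgrp_pos[OF Lq(2,1)] cQ by simp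
    show "coprime r (card Q)" by (rule cop)
    fix y assume y: "y \<in> L"
    have "\<pi> (nm (card Q) y) = 0"
      using homo_nm[OF piL L(1) y, of "card Q"] nm_card[OF Lq(2,1), of "\<pi> y"] y cQ by simp
    moreover have "nm (card Q) y \<in> X" using nm_in[OF L(1) y] L(2) by blast
    ultimately show "nm (card Q) y \<in> E" using pi(2) by blast
  qed
qed

text \<open>If K were not inside E, \<open>frobenius_core\<close> would apply to the group R
  generated by E and the F-conjugates of K. Its element of prime order, central modulo E, comes from
  the last term of the lower central series of R not contained in E.\<close>

lemma centralizing_fixed_points_trivial:
  assumes fc: "frobcar X G H F" and V: "sgrp V" "V \<subseteq> G" "nmz X V"
    and ab: "\<And>v w. v \<in> V \<Longrightarrow> w \<in> V \<Longrightarrow> v + w = w + v"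
    and r: "prime (r::nat)" "\<And>v. v \<in> V \<Longrightarrow> nm r v = 0"
    and L: "sgrp L" "L \<subseteq> G" "nmz X L" and E: "E = {y \<in> L. \<forall>v\<in>V. cj y v = v}" and lcs: "lcs L i \<subseteq> E"
    and m: "m > 0" "coprime r m" "\<And>y. y \<in> L \<Longrightarrow> nm m y \<in> E"
    and K: "K \<subseteq> L" "\<And>x h. x \<in> K \<Longrightarrow> h \<in> H \<Longrightarrow> cj h x = x" "\<And>x v. x \<in> K \<Longrightarrow> v \<in> cent V H \<Longrightarrow> cj x v = v"
  shows "K \<subseteq> E"
proof (rule ccontr)
  assume nKE: "\<not> K \<subseteq> E"
  note D = frobcarD[OF fc]
  have VX: "V \<subseteq> X" "L \<subseteq> X" using V(2) L(2) D(4) by auto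
  have sE: "sgrp E" "nmz X E" "E \<subseteq> L" "E \<subseteq> X"
    using sgrp_centralizer[OF L(1)] nmz_centralizer[OF D(1) L(3) V(3)] VX(2) by (auto simp: E)
  interpret act: abelian_action "mon V" X cj by (rule conj_action[OF D(1,2) V(1) VX(1) V(3) ab])
  let ?U = "{cj f x | f x. f \<in> F \<and> x \<in> K} \<union> E"
  define R where "R = gen ?U"
  have sR: "sgrp R" by (simp add: R_def sgrp_gen)
  have RL: "R \<subseteq> L"
    unfolding R_def using K(1) nmzD[OF L(3)] D(15) sE(3) by (intro gen_least[OF L(1)]) blast
  have RX: "R \<subseteq> X" "R \<subseteq> G" using RL VX L(2) by auto
  have ER: "E \<subseteq> R" by (auto simp: R_def intro: gen.base)
  have KR: "K \<subseteq> R"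
  proof
    fix x assume "x \<in> K"
    then have "cj 0 x \<in> ?U" using sgrp_zero[OF D(12)] by blast
    then show "x \<in> R" unfolding R_def by (intro gen.base) simp
  qed
  have nFR: "nmz F R"
    unfolding R_def
  proof (rule nmz_gen, unfold nmz_def, intro ballI)
    fix x s assume x: "x \<in> F" and s: "s \<in> ?U"
    show "cj x s \<in> ?U"
    proof (cases "s \<in> E")
      case True then show ?thesis using nmzD[OF sE(2)] x D(15) by blast
    next
      case False
      then obtain f y where s: "s = cj f y" "f \<in> F" "y \<in> K" using s by blast
      then have "cj x s = cj (x + f) y" "x + f \<in> F" using x D(12) by (auto simp: cj_cj sgrp_add)
      then show ?thesis using s by blast
    qed
  qed
  have nHR: "nmz H R"
    unfolding R_def
  proof (rule nmz_gen, unfold nmz_def, intro ballI)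
    fix h s assume h: "h \<in> H" and s: "s \<in> ?U"
    show "cj h s \<in> ?U"
    proof (cases "s \<in> E")
      case True then show ?thesis using nmzD[OF sE(2)] h D(8) by blast
    next
      case False
      then obtain f y where s: "s = cj f y" "f \<in> F" "y \<in> K" using s by blast
      have "cj h s = cj (cj h f) (cj h y)" unfolding s by (simp add: cj_def gsimps)
      also have "cj h y = y" using K(2) s h by blast
      finally show ?thesis using nmzD[OF D(11) h s(2)] s(3) by blast
    qed
  qed
  have nRE: "\<not> R \<subseteq> E" using KR nKE by blast
  have "lcs R i \<subseteq> E" using lcs_mono[OF RL] lcs by blast
  moreover have "\<not> lcs R 0 \<subseteq> E" using nRE by simp
  ultimately obtain j where j: "\<not> lcs R j \<subseteq> E" "lcs R (Suc j) \<subseteq> E"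
    using nat_induct[of "\<lambda>j. \<not> lcs R j \<subseteq> E" i] by blast
  then obtain a where a: "a \<in> lcs R j" "a \<notin> E" by blast
  have aR: "a \<in> R" using a lcs_subset[OF sR] by blast
  have aE: "cm a y \<in> E" if "y \<in> R" for y using cm_lcs[OF a(1) that] j(2) by blast
  \<comment> \<open>The order of \<open>a\<close> modulo \<open>E\<close>. It divides m and is thus
    prime to r; for a prime p dividing n, the multiple of \<open>a\<close> by n/p has order p modulo
    \<open>E\<close>.\<close>
  define n where "n = (LEAST n. n > 0 \<and> nm n a \<in> E)"
  have n: "n > 0" "nm n a \<in> E"
    using LeastI[of "\<lambda>n. n > 0 \<and> nm n a \<in> E" m] m aR RL by (auto simp: n_def)
  have nmin: "nm k a \<notin> E" if "0 < k" "k < n" for k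
    using not_less_Least[of k "\<lambda>n. n > 0 \<and> nm n a \<in> E"] that by (auto simp: n_def)
  have "n \<noteq> 1" using n a by auto
  then obtain p where p: "prime p" "p dvd n" using prime_factor_nat by blast
  obtain k where k: "n = p * k" using p by blast
  have k0: "0 < k" "k < n" using k n(1) prime_gt_1_nat[OF p(1)] by auto
  have "n dvd m"
  proof -
    have "nm m a = nm (m div n) (nm n a) + nm (m mod n) a"
      by (simp add: nm_mult[symmetric] nm_add[symmetric])
    moreover have "nm m a \<in> E" using m(3) aR RL by blast
    ultimately have "nm (m mod n) a \<in> E" using sgrp_add_left[OF sE(1) nm_in[OF sE(1) n(2)]] by metis
    then have "m mod n = 0" using nmin[of "m mod n"] n(1) by (metis mod_less_divisor neq0_conv)
    then show ?thesis by presburger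
  qed
  then have "p dvd m" using p(2) by (rule dvd_trans[rotated])
  then have "p \<noteq> r" using m(2) p(1) by (metis coprime_common_divisor dvd_refl not_prime_unit)
  then have cpr: "coprime p r" using p(1) r(1) by (simp add: primes_coprime)
  define a0 where "a0 = nm k a"
  have a0R: "a0 \<in> R" using nm_in[OF sR aR] by (simp add: a0_def)
  have a0E: "a0 \<notin> E" using nmin k0 by (simp add: a0_def)
  have pa0: "nm p a0 \<in> E" using n(2) k by (simp add: a0_def nm_mult[symmetric])
  have a0c: "cm a0 y \<in> E" if y: "y \<in> R" for y
    unfolding a0_def
  proof (induct k)
    case 0 then show ?case using sgrp_zero[OF sE(1)] by (simp add: cm_def)
  next
    case (Suc l)
    have "cj a (cm (nm l a) y) \<in> E" using nmzD[OF sE(2)] Suc aR RX by blast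
    then show ?case using aE[OF y] sE(1) by (simp add: cm_add_left sgrp_add)
  qed
  have comm: "cj a0 (cj y v) = cj y (cj a0 v)" if "y \<in> R" "v \<in> V" for y v
  proof -
    have "y \<in> X" "a0 \<in> X" using that a0R RX by auto
    then have vV: "cj (y + a0) v \<in> V" using nmzD[OF V(3)] that sgrp_add[OF D(1)] by blast
    have "a0 + y = cm a0 y + (y + a0)" by (simp add: cm_def gsimps)
    then have "cj (a0 + y) v = cj (cm a0 y) (cj (y + a0) v)" by (simp add: cj_cj)
    also have "\<dots> = cj (y + a0) v" using a0c[OF that(1)] vV unfolding E by blast
    finally show ?thesis by (simp add: cj_cj)
  qed
  interpret core: frobenius_core "mon V" X cj R F H K p a0
  proof
    show "sgrp R" "R \<subseteq> X" "sgrp F" "F \<subseteq> X" "sgrp H" "H \<subseteq> X" "nmz F R" "nmz H R" "nmz H F"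
      using sR RX D nFR nHR by auto
    show "f = 0" if "h \<in> H" "h \<noteq> 0" "f \<in> F" "h + f = f + h" for h f using D(20) that .
    show "K \<subseteq> R" by (rule KR)
    show "x + h = h + x" if "x \<in> K" "h \<in> H" for x h using K(2)[OF that] by (simp add: cj_eq_self)
    show "cj x v = v" if "x \<in> K" "v \<in> act.fix_set H" for x v
      using K(3)[OF that(1)] that(2) by (simp add: act.fix_set_def cent_def)
    have "?U \<subseteq> {cj f x | f x. f \<in> F \<and> x \<in> K} \<union> {x \<in> R. \<forall>v\<in>carrier (mon V). cj x v = v}"
      using ER by (auto simp: E)
    from gen_mono[OF this]
    show "R \<subseteq> gen ({cj f x | f x. f \<in> F \<and> x \<in> K} \<union> {x \<in> R. \<forall>v\<in>carrier (mon V). cj x v = v})"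
      by (simp only: R_def[symmetric])
    show "prime p" by (rule p(1))
    show "act.divisible_by p"
      using nm_coprime_zero[OF _ r(2) cpr] V(1) by (auto simp: act.divisible_by_def pow_mon)
    show "a0 \<in> R" by (rule a0R)
    show "cj a0 (cj y v) = cj y (cj a0 v)" if "y \<in> R" "v \<in> carrier (mon V)" for y v using comm that by simp
    show "cj (nm p a0) v = v" if "v \<in> carrier (mon V)" for v using pa0 that unfolding E by simp
    show "\<exists>v\<in>carrier (mon V). cj a0 v \<noteq> v" using a0E a0R RL unfolding E by auto
    fix S h z
    assume S: "sgrp S" "S \<subseteq> R" "nmz R S" "nmz F S" and h: "h \<in> H" "h \<noteq> 0" "nmz {h} S"
      and z: "z \<in> R" "\<And>f. f \<in> F \<Longrightarrow> cm f z \<in> S" "cm h z \<in> S"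
    \<comment> \<open>F remains a Carter subgroup of F + R, so F + S is self-normalising there and
      contains z, which F centralises modulo S. In a decomposition z = f + s, the element f commutes
      with h modulo S, and \<open>fixed_point_free_mem\<close> puts it into S.\<close>
    let ?G = "splus F R"
    have sG: "sgrp ?G" by (rule sgrp_splus[OF D(12) sR nFR])
    have GG: "?G \<subseteq> G" by (rule splus_subset[OF D(3,13) RX(2)])
    have FG: "F \<subseteq> ?G" "R \<subseteq> ?G" by (rule splus_left[OF sR], rule splus_right[OF D(12)])
    have car: "carter ?G F" using D(10,12,14,19) FG(1) GG unfolding carter_def by blast
    have "cj (f + y) s \<in> S" if "f \<in> F" "y \<in> R" "s \<in> S" for f y s
      using nmzD[OF S(4) that(1) nmzD[OF S(3) that(2,3)]] by (simp add: cj_cj)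
    then have nS: "nmz ?G S" unfolding nmz_def splus_def by blast
    have "z \<in> splus F S"
    proof (rule carter_normalizer[OF sG finite_subset[OF GG D(16)] solv_subset[OF D(6) GG] car S(1) _ nS])
      show "S \<subseteq> ?G" "z \<in> ?G" using S(2) FG(2) z(1) by auto
      show "cj z f \<in> splus F S" if f: "f \<in> F" for f
      proof -
        have "cm z f \<in> S" using z(2)[OF f] sgrp_uminus[OF S(1)] cm_uminus by metis
        then have "cj (- f) (cm z f) \<in> S" using nmzD[OF S(4)] f D(12) by (simp add: sgrp_uminus)
        moreover have "cj z f = f + cj (- f) (cm z f)" by (simp add: cj_def cm_def gsimps)
        ultimately show ?thesis using f unfolding splus_def by blast
      qed
    qed
    then obtain f s where fs: "z = f + s" "f \<in> F" "s \<in> S" by (auto simp: splus_def)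
    have hS: "cj h t \<in> S" if "t \<in> S" for t using nmzD[OF h(3) _ that] by simp
    have "cm h s \<in> S" using hS[OF fs(3)] fs(3) S(1) by (simp add: cm_cj sgrp_mem)
    then have "cj f (cm h s) \<in> S" using nmzD[OF S(4) fs(2)] by blast
    moreover have "cm h z = cm h f + cj f (cm h s)" using fs(1) by (simp add: cm_add_right)
    ultimately have "cm h f \<in> S" using z(3) sgrp_add_right[OF S(1)] by metis
    then have "cm f h \<in> S" using sgrp_uminus[OF S(1)] cm_uminus by metis
    have "f \<in> S"
      by (rule fixed_point_free_mem[OF D(12,18) _ _ S(1) hS fs(2) \<open>cm f h \<in> S\<close>])
         (use nmzD[OF D(11) h(1)] D(20)[OF h(1,2)] in auto)
    then show "z \<in> S" using fs S(1) by (simp add: sgrp_add)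
  qed
  show False by (rule core.contradiction)
qed

text \<open>The fixed points of H in V form a normal r-subgroup of C_G(H), so they lie in its
  Fitting subgroup and commute with the r'-elements there; these fall under
  \<open>centralizing_fixed_points_trivial\<close>. The r-part of x acts trivially because L induces
  an r'-group on V.\<close>

lemma Fit_cent_acts_trivially:
  assumes fc: "frobcar X G H F" and ch: "chief X {0} V" and V: "V \<subseteq> G"
    and ab: "\<And>v w. v \<in> V \<Longrightarrow> w \<in> V \<Longrightarrow> v + w = w + v"
    and r: "prime (r::nat)" "\<And>v. v \<in> V \<Longrightarrow> nm r v = 0"
    and L: "sgrp L" "L \<subseteq> G" "nmz X L" and lcs: "lcs L i \<subseteq> {y \<in> L. \<forall>v\<in>V. cj y v = v}"
    and x: "x \<in> Fit (cent G H)" "x \<in> L" and v: "v \<in> V"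
  shows "cj x v = v"
proof -
  note D = frobcarD[OF fc] and C = chiefD[OF ch]
  define E where E: "E = {y \<in> L. \<forall>v\<in>V. cj y v = v}"
  have VX: "V \<subseteq> X" "L \<subseteq> X" using V L(2) D(4) by auto
  obtain m where m: "m > 0" "coprime r m" "\<And>y. y \<in> L \<Longrightarrow> nm m y \<in> E"
    using irreducible_action_coprime[OF D(1,2) ch VX(1) r L(1) VX(2) L(3) E lcs[folded E]] by blast
  let ?C = "cent G H" and ?N = "Fit (cent G H)"
  have sC: "sgrp ?C" "finite ?C" using sgrp_cent[OF D(3)] finite_subset[OF cent_subset D(16)] by auto
  note N = Fit_props[OF sC]
  define K where "K = {y \<in> L. (\<forall>h\<in>H. cj h y = y) \<and> (\<forall>v\<in>cent V H. cj y v = v)}"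
  have KE: "K \<subseteq> E"
    by (rule centralizing_fixed_points_trivial[OF fc C(2) V C(6) ab r L E lcs[folded E] m])
       (auto simp: K_def)
  have cV: "cent V H \<subseteq> ?N"
  proof (rule nil_normal_subset_Fit[OF sgrp_cent[OF C(2)]])
    show "cent V H \<subseteq> ?C" using V by (auto simp: cent_def)
    show "nil (cent V H)" by (rule nil_abelian[OF sgrp_cent[OF C(2)]]) (auto simp: cent_def ab)
    show "nmz ?C (cent V H)"
      unfolding nmz_def
    proof (intro ballI)
      fix x v assume x: "x \<in> ?C" and v: "v \<in> cent V H"
      have "cj x v \<in> V" using nmzD[OF C(6)] x v D(4) by (auto simp: cent_def)
      moreover have "cj h (cj x v) = cj x v" if "h \<in> H" for h
      proof -
        have "cj h (cj x v) = cj (cj h x) (cj h v)" by (simp add: cj_def gsimps)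
        then show ?thesis using x v that by (simp add: cent_def)
      qed
      ultimately show "cj x v \<in> cent V H" by (simp add: cent_def)
    qed
  qed
  have finN: "finite ?N" using N(2) sC(2) finite_subset by blast
  have "card ?N \<noteq> 0" using card_sgrp_pos[OF finN N(1)] by simp
  then obtain n where n: "card ?N = r ^ multiplicity r (card ?N) * n" "\<not> r dvd n"
    using multiplicity_decompose'[of "card ?N" r] r(1) not_prime_unit by blast
  \<comment> \<open>The factor is the full power of r in the order of the Fitting subgroup, which
    leaves an element of order prime to r.\<close>
  define x' where "x' = nm (r ^ multiplicity r (card ?N)) x"
  have x'N: "x' \<in> ?N" using nm_in[OF N(1) x(1)] by (simp add: x'_def)
  have nx': "nm n x' = 0"
    using nm_card[OF finN N(1) x(1)] n(1) by (simp add: x'_def nm_mult[symmetric] mult.commute)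
  have cop: "coprime n r" using prime_imp_coprime[OF r(1) n(2)] by (simp add: coprime_commute)
  have "cj x' w = w" if w: "w \<in> cent V H" for w
    using nil_coprime_commute[OF N(1,3) x'N nx' _ _ cop, of w] r(2)[of w] w cV by (auto simp: cj_eq_self cent_def)
  moreover have "x' \<in> L" using nm_in[OF L(1) x(2)] by (simp add: x'_def)
  moreover have "cj h x' = x'" if "h \<in> H" for h using x'N N(2) that by (auto simp: cent_def)
  ultimately have "x' \<in> E" using KE by (auto simp: K_def)
  moreover have "nm m x \<in> E" using m(3) x(2) .
  moreover have sE: "sgrp E" using sgrp_centralizer[OF L(1)] by (simp add: E)
  ultimately have "x \<in> E"
    using nm_coprime_mem[OF sE, of "r ^ multiplicity r (card ?N)" x m] m(2) by (simp add: x'_def)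
  then show ?thesis using v by (simp add: E)
qed

lemma Fit_image: "sgrp S \<Longrightarrow> finite S \<Longrightarrow> homo S f \<Longrightarrow> f ` Fit S \<subseteq> Fit (f ` S)"
  using Fit_props[of S] nmz_image[of S f "Fit S" S] nmz_Fit[OF _ nmz_self, of S] sgrp_image[of S f "Fit S"]
    nil_image[OF _ homo_mono, of "Fit S" S f]
  by (intro nil_normal_subset_Fit) auto

text \<open>Descending on N: by induction the Fitting subgroup of C_G(H) centralises the chief
  factors above N, so it lies in \<open>L\<close>. The lower central series of \<open>L\<close>
  reaches N, which acts trivially on the abelian factor N/M. This is the situation of
  \<open>Fit_cent_acts_trivially\<close> in X/M.\<close>

lemma Fit_cent_subset_cen:
  assumes fc: "frobcar X G H F"
  shows "Fit (cent G H) \<subseteq> cen X G {0}"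
proof -
  note D = frobcarD[OF fc]
  let ?C = "cent G H"
  have sC: "sgrp ?C" "finite ?C" using sgrp_cent[OF D(3)] finite_subset[OF cent_subset D(16)] by auto
  have CX: "?C \<subseteq> X" using cent_subset D(4) by blast
  have NG: "Fit ?C \<subseteq> G" using Fit_props(2)[OF sC] cent_subset by blast
  have main: "cm x z \<in> M" if "chief X M N" "N \<subseteq> G" "x \<in> Fit ?C" "z \<in> N" for M N x z
    using that
  proof (induct "card G - card N" arbitrary: M N x z rule: less_induct)
    case less
    note ch = less.prems(1) and N = less.prems(2) and x = less.prems(3) and z = less.prems(4)
    note CM = chiefD[OF ch]
    define L where "L = cen X G N"
    have FL: "Fit ?C \<subseteq> L"
    proof
      fix y assume y: "y \<in> Fit ?C"
      show "y \<in> L"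
        unfolding L_def
      proof (rule cenI)
        show "y \<in> G" using y NG by blast
        fix M' N' w assume c: "chief X M' N'" "N \<subseteq> M'" "N' \<subseteq> G" "w \<in> N'"
        have "card N < card N'"
          by (rule psubset_card_mono[OF finite_subset[OF c(3) D(16)]]) (use c(2) chiefD(3)[OF c(1)] in blast)
        moreover have "card N' \<le> card G" by (rule card_mono[OF D(16) c(3)])
        ultimately have "card G - card N' < card G - card N" by simp
        then show "cm y w \<in> M'" using less.hyps c y by blast
      qed
    qed
    have L: "sgrp L" "nmz X L" "L \<subseteq> G" "L \<subseteq> X"
      using sgrp_cen[OF D(3,4)] nmz_cen[OF D(1,5)] cen_subset[of X G N] D(4) by (auto simp: L_def)
    obtain i where i: "lcs L i \<subseteq> N" using lcs_cen[OF D(3,16,4,5) CM(2,6) N] by (auto simp: L_def)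
    obtain \<pi> :: "'a \<Rightarrow> 'a set sym" and r where pi0: "homo X \<pi>" "\<forall>x\<in>X. \<pi> x = 0 \<longleftrightarrow> x \<in> M"
      and fcp: "frobcar (\<pi> ` X) (\<pi> ` G) (\<pi> ` H) (\<pi> ` F)" and chp: "chief (\<pi> ` X) {0} (\<pi> ` N)"
      and NGp: "\<pi> ` N \<subseteq> \<pi> ` G" and r0: "prime (r::nat)" "\<forall>v\<in>\<pi> ` N. nm r v = 0"
      and ab0: "\<forall>v\<in>\<pi> ` N. \<forall>w\<in>\<pi> ` N. v + w = w + v"
      by (rule chief_quotient[OF fc ch N])
    note pi = pi0(1) bspec[OF pi0(2)] and r = r0(1) bspec[OF r0(2)] and ab = bspec[OF bspec[OF ab0]]
    have MG: "M \<subseteq> G" using CM(4) N by blast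
    have ce: "cent (\<pi> ` G) (\<pi> ` H) = \<pi> ` ?C" by (rule cent_image[OF fc pi(1)]) (use pi(2) MG in blast)
    have X: "x \<in> X" "z \<in> X" using x NG z N D(4) by auto
    have "cj (\<pi> x) (\<pi> z) = \<pi> z"
    proof (rule Fit_cent_acts_trivially[OF fcp chp NGp ab r])
      show "sgrp (\<pi> ` L)" "\<pi> ` L \<subseteq> \<pi> ` G" "nmz (\<pi> ` X) (\<pi> ` L)"
        using sgrp_image[OF pi(1) D(1) L(4,1)] L(3) nmz_image[OF pi(1) D(1) L(4) order_refl L(2)] by auto
      have "lcs (\<pi> ` L) i = \<pi> ` lcs L i" using homo_lcs[OF homo_mono[OF pi(1) L(4)] L(1)] by simp
      then have "lcs (\<pi> ` L) i \<subseteq> \<pi> ` N" "lcs (\<pi> ` L) i \<subseteq> \<pi> ` L" using i lcs_subset[OF L(1), of i] by blast+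
      moreover have "cj w v = v" if "w \<in> \<pi> ` N" "v \<in> \<pi> ` N" for w v using ab[OF that] by (simp add: cj_eq_self)
      ultimately show "lcs (\<pi> ` L) i \<subseteq> {y \<in> \<pi> ` L. \<forall>v\<in>\<pi> ` N. cj y v = v}" by blast
      show "\<pi> x \<in> Fit (cent (\<pi> ` G) (\<pi> ` H))"
        unfolding ce using Fit_image[OF sC homo_mono[OF pi(1) CX]] x by blast
      show "\<pi> x \<in> \<pi> ` L" using x FL by blast
      show "\<pi> z \<in> \<pi> ` N" using z by blast
    qed
    then have "\<pi> (cm x z) = 0" using homo_cm[OF pi(1) D(1) X] by (simp add: cm_cj)
    then show "cm x z \<in> M" using pi(2)[OF sgrp_cm[OF D(1) X]] by blast
  qed
  show ?thesis using main NG by (auto intro!: cenI)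
qed

text \<open>\<open>cen X G {0}\<close> is normal and nilpotent, hence inside \<open>Fit G\<close>,
  which gives one inclusion. For the other, the intersection of \<open>Fit G\<close> with C_G(H) is
  nilpotent and normal in C_G(H).\<close>

lemma Fit_cent:
  assumes fc: "frobcar X G H F"
  shows "Fit (cent G H) = Fit G \<inter> cent G H"
proof
  note D = frobcarD[OF fc]
  let ?C = "cent G H"
  have sC: "sgrp ?C" "finite ?C" using sgrp_cent[OF D(3)] finite_subset[OF cent_subset D(16)] by auto
  have "cen X G {0} \<subseteq> Fit G"
  proof (rule nil_normal_subset_Fit)
    show s: "sgrp (cen X G {0})" "cen X G {0} \<subseteq> G" "nmz G (cen X G {0})"
      by (rule sgrp_cen[OF D(3,4)], rule cen_subset, rule nmz_mono[OF nmz_cen[OF D(1,5)] D(4)])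
    obtain j where "lcs (cen X G {0}) j \<subseteq> {0}"
      using lcs_cen[OF D(3,16,4,5) sgrp_trivial nmz_trivial] sgrp_zero[OF D(3)] by auto
    then have "lcs (cen X G {0}) j = {0}" using sgrp_zero[OF sgrp_lcs[OF s(1), of j]] by blast
    then show "nil (cen X G {0})" unfolding nil_def by blast
  qed
  then show "Fit ?C \<subseteq> Fit G \<inter> ?C" using Fit_cent_subset_cen[OF fc] Fit_props(2)[OF sC] by blast
  note N = Fit_props[OF D(3,16)]
  show "Fit G \<inter> ?C \<subseteq> Fit ?C"
  proof (rule nil_normal_subset_Fit)
    show s: "sgrp (Fit G \<inter> ?C)" by (rule sgrp_Int[OF N(1) sC(1)])
    show "nil (Fit G \<inter> ?C)" by (rule nil_subgroup[OF N(3) s]) blast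
    show "nmz ?C (Fit G \<inter> ?C)"
      using nmz_Int[OF nmz_mono[OF nmz_Fit[OF D(3) nmz_self[OF D(3)]] cent_subset] nmz_self[OF sC(1)]] .
  qed blast
qed

section \<open>The Fitting series\<close>

text \<open>By the lemma \<open>cen_eq_vimage_Fit\<close>, \<open>cen S S T\<close> is the full preimage of the Fitting subgroup of \<open>S/T\<close>.\<close>

primrec fs :: "'a::group_add set \<Rightarrow> nat \<Rightarrow> 'a set" where
  "fs S 0 = {0}"
| "fs S (Suc n) = cen S S (fs S n)"

lemma fs_props: assumes "sgrp S" shows "sgrp (fs S n)" "fs S n \<subseteq> S"
  using sgrp_zero[OF assms] sgrp_cen[OF assms order_refl] cen_subset[of S S] by (cases n; auto)+

lemma cen_eq_vimage_Fit:
  assumes S: "sgrp S" "finite S" and T: "sgrp T" "T \<subseteq> S" "nmz S T" and f: "homo S f"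
    and ker: "\<And>x. x \<in> S \<Longrightarrow> f x = 0 \<longleftrightarrow> x \<in> T"
  shows "cen S S T = {x \<in> S. f x \<in> Fit (f ` S)}"
proof -
  have "Fit (f ` S) = cen (f ` S) (f ` S) {0}"
    using Fit_eq_cen[of "f ` S"] sgrp_image[OF f S(1) order_refl S(1)] S(2) by simp
  then show ?thesis
    using cen_image[OF f S(1) S(1) order_refl nmz_self[OF S(1)] T(2) ker] cen_subset[of S S T] by auto
qed

lemma nmz_fs:
  assumes X: "sgrp X" and G: "sgrp G" "finite G" "G \<subseteq> X" "nmz X G"
  shows "nmz X (fs G n)"
proof (induct n)
  case (Suc n)
  note N = fs_props[OF G(1), of n]
  have NX: "fs G n \<subseteq> X" using N(2) G(3) by blast
  obtain \<pi> :: "'a \<Rightarrow> 'a set sym" where pi: "homo X \<pi>" "\<And>x. x \<in> X \<Longrightarrow> \<pi> x = 0 \<longleftrightarrow> x \<in> fs G n"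
    using quotient_map[OF X N(1) NX Suc] by metis
  have "fs G (Suc n) = {x \<in> G. \<pi> x \<in> Fit (\<pi> ` G)}"
    using cen_eq_vimage_Fit[OF G(1,2) N nmz_mono[OF Suc G(3)] homo_mono[OF pi(1) G(3)]] pi(2) G(3) by auto
  moreover have "nmz (\<pi> ` X) (Fit (\<pi> ` G))"
    using nmz_Fit[OF sgrp_image[OF pi(1) X order_refl X] nmz_image[OF pi(1) X G(3) order_refl G(4)]] .
  ultimately show ?case using nmz_vimage[OF pi(1) X G(3) order_refl G(4)] by simp
qed simp

text \<open>In the quotient by \<open>fs G n\<close> the image of C_G(H) is again the group of fixed
  points, so \<open>Fit_cent\<close> applies there. By induction the kernel on C_G(H) is the n-th
  term of its own series.\<close>

theorem fs_cent:
  assumes fc: "frobcar X G H F"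
  shows "fs (cent G H) n = fs G n \<inter> cent G H"
proof (induct n)
  case 0
  then show ?case using sgrp_zero[OF sgrp_cent[OF frobcarD(3)[OF fc]], of H] by auto
next
  case (Suc n)
  note D = frobcarD[OF fc]
  let ?C = "cent G H"
  have sC: "sgrp ?C" "finite ?C" using sgrp_cent[OF D(3)] finite_subset[OF cent_subset D(16)] by auto
  note N = fs_props[OF D(3), of n] and nX = nmz_fs[OF D(1,3,16,4,5), of n]
  have NX: "fs G n \<subseteq> X" and CX: "?C \<subseteq> X" using N(2) D(4) cent_subset by blast+
  obtain \<pi> :: "'a \<Rightarrow> 'a set sym" where pi: "homo X \<pi>" "\<And>x. x \<in> X \<Longrightarrow> \<pi> x = 0 \<longleftrightarrow> x \<in> fs G n"
    using quotient_map[OF D(1) N(1) NX nX] by metis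
  have ker: "x \<in> G" if "x \<in> X" "\<pi> x = 0" for x using pi(2) that N(2) by blast
  note fcp = frobcar_image[OF fc pi(1) ker] and ce = cent_image[OF fc pi(1) ker]
  have "nmz ?C (fs G n \<inter> ?C)" by (rule nmz_Int[OF nmz_mono[OF nX CX] nmz_self[OF sC(1)]])
  moreover have "sgrp (fs G n \<inter> ?C)" by (rule sgrp_Int[OF N(1) sC(1)])
  ultimately have "cen ?C ?C (fs G n \<inter> ?C) = {x \<in> ?C. \<pi> x \<in> Fit (\<pi> ` ?C)}"
    using pi(2) CX by (intro cen_eq_vimage_Fit[OF sC]) (auto intro: homo_mono[OF pi(1)])
  moreover have "cen G G (fs G n) = {x \<in> G. \<pi> x \<in> Fit (\<pi> ` G)}"
    using pi(2) D(4) by (intro cen_eq_vimage_Fit[OF D(3,16) N nmz_mono[OF nX D(4)]]) (auto intro: homo_mono[OF pi(1)])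
  moreover have "Fit (\<pi> ` ?C) = Fit (\<pi> ` G) \<inter> \<pi> ` ?C" using Fit_cent[OF fcp] ce by simp
  ultimately show ?case using Suc cent_subset[of G H] by auto
qed

text \<open>C_G(H) lies in \<open>fs G m\<close>, so F covers the quotient of G by
  \<open>fs G m\<close>. That quotient is an image of the nilpotent F, and one more term reaches G;
  this is the summand 1 in the bound on the height.\<close>

theorem carter_fs:
  assumes fc: "frobcar X G H F" and m: "fs (cent G H) m = cent G H"
  shows "G = splus F (fs G m)" "fs G (Suc m) = G"
proof -
  note D = frobcarD[OF fc]
  note N = fs_props[OF D(3), of m] and nX = nmz_fs[OF D(1,3,16,4,5), of m]
  have "cent G H \<subseteq> fs G m" using fs_cent[OF fc, of m] m by blast
  then have "G \<subseteq> splus F (fs G m)"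
    using fixed_point_free_in_carter[OF fc _ N nX D(3) N(2) order_refl D(5)] by blast
  then show G: "G = splus F (fs G m)" using splus_subset[OF D(3,13) N(2)] by blast
  have nG: "nmz G (fs G m)" using nmz_mono[OF nX D(4)] .
  obtain \<pi> :: "'a \<Rightarrow> 'a set sym" where pi: "homo G \<pi>" "\<And>x. x \<in> G \<Longrightarrow> \<pi> x = 0 \<longleftrightarrow> x \<in> fs G m"
    using quotient_map[OF D(3) N nG] by metis
  have "\<pi> g \<in> \<pi> ` F" if g: "g \<in> G" for g
  proof -
    obtain f y where fy: "g = f + y" "f \<in> F" "y \<in> fs G m" using subsetD[OF equalityD1[OF G] g] unfolding splus_def by blast
    have "f \<in> G" "y \<in> G" using fy D(13) N(2) by auto
    then have "\<pi> g = \<pi> f + \<pi> y" "\<pi> y = 0" using fy homoD[OF pi(1)] pi(2) by blast+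
    then show ?thesis using fy(2) by simp
  qed
  then have "\<pi> ` G = \<pi> ` F" using D(13) by blast
  then have "nil (\<pi> ` G)" using nil_image[OF D(14) homo_mono[OF pi(1) D(13)] D(12)] by simp
  moreover have s: "sgrp (\<pi> ` G)" using sgrp_image[OF pi(1) D(3) order_refl D(3)] .
  ultimately have "\<pi> ` G \<subseteq> Fit (\<pi> ` G)" using nil_normal_subset_Fit[OF s order_refl nmz_self[OF s]] by blast
  then show "fs G (Suc m) = G" using cen_eq_vimage_Fit[OF D(3,16) N nG pi] by auto
qed

lemma exists_minimal_normal:
  assumes "sgrp S" "finite S" "S \<noteq> {0}"
  obtains V where "chief S {0} V" "V \<subseteq> S"
proof -
  let ?A = "{V. sgrp V \<and> nmz S V \<and> V \<subseteq> S \<and> V \<noteq> {0}}"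
  have "finite ?A" by (rule finite_subset[of _ "Pow S"]) (use assms in auto)
  moreover have "S \<in> ?A" using assms nmz_self by blast
  then have "?A \<noteq> {}" by blast
  ultimately have "\<exists>V\<in>?A. \<forall>L\<in>?A. L \<subseteq> V \<longrightarrow> V = L" by (rule finite_has_minimal)
  then obtain V where V: "V \<in> ?A" "\<forall>L\<in>?A. L \<subseteq> V \<longrightarrow> V = L" by (elim bexE)
  have "chief S {0} V"
  proof (rule chiefI)
    show "{0} \<subset> V" using V(1) sgrp_zero by auto
    show "K = {0} \<or> K = V" if "sgrp K" "nmz S K" "{0} \<subseteq> K" "K \<subseteq> V" for K
      using V that by blast
  qed (use V(1) in auto)
  then show thesis using that V(1) by blast
qed

text \<open>This makes the least index in \<open>fitting_height\<close> meaningful. A nontrivial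
  quotient has an abelian minimal normal subgroup, so the series grows strictly until it reaches
  S.\<close>

lemma fs_reaches:
  assumes S: "sgrp S" "finite S" "solv S"
  shows "\<exists>n. fs S n = S"
proof (rule ccontr)
  assume no: "\<not> ?thesis"
  have nS: "nmz S (fs S n)" for n by (rule nmz_fs[OF S(1) S(1,2) order_refl nmz_self[OF S(1)]])
  have step: "fs S n \<subset> fs S (Suc n)" for n
  proof -
    note N = fs_props[OF S(1), of n]
    obtain \<pi> :: "'a \<Rightarrow> 'a set sym" where pi: "homo S \<pi>" "\<And>x. x \<in> S \<Longrightarrow> \<pi> x = 0 \<longleftrightarrow> x \<in> fs S n"
      using quotient_map[OF S(1) N nS] by metis
    have s: "sgrp (\<pi> ` S)" "finite (\<pi> ` S)" using sgrp_image[OF pi(1) S(1) order_refl S(1)] S(2) by auto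
    have e: "fs S (Suc n) = {x \<in> S. \<pi> x \<in> Fit (\<pi> ` S)}" using cen_eq_vimage_Fit[OF S(1,2) N nS pi] by simp
    have "\<pi> ` S \<noteq> {0}" using no N(2) pi(2) by blast
    then obtain V where V: "chief (\<pi> ` S) {0} V" "V \<subseteq> \<pi> ` S" using exists_minimal_normal[OF s] by blast
    note C = chiefD[OF V(1)]
    have "\<forall>v\<in>V. \<forall>w\<in>V. v + w = w + v"
      using minimal_normal_solv[OF s V(1,2) solv_subset[OF solv_image[OF S(3,1,2) pi(1)] V(2)]] by metis
    then have "nil V" by (intro nil_abelian[OF C(2)]) blast
    then have VF: "V \<subseteq> Fit (\<pi> ` S)" by (rule nil_normal_subset_Fit[OF C(2) V(2) C(6)])
    obtain v where "v \<in> V" "v \<noteq> 0" using C(3) by blast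
    then obtain x where "x \<in> S" "\<pi> x \<in> V" "\<pi> x \<noteq> 0" using V(2) by blast
    then have "x \<in> fs S (Suc n)" "x \<notin> fs S n" using e VF pi(2) by auto
    moreover have "\<pi> x = 0" if "x \<in> fs S n" for x using that pi(2) N(2) by blast
    then have "fs S n \<subseteq> fs S (Suc n)"
      using e N(2) sgrp_zero[OF Fit_props(1)[OF s]] by auto
    ultimately show ?thesis by blast
  qed
  have "n \<le> card (fs S n)" for n
  proof (induct n)
    case (Suc n)
    have "card (fs S n) < card (fs S (Suc n))"
      by (rule psubset_card_mono[OF finite_subset[OF fs_props(2)[OF S(1)] S(2)] step])
    then show ?case using Suc by simp
  qed simp
  moreover have "card (fs S n) \<le> card S" for n by (rule card_mono[OF S(2) fs_props(2)[OF S(1)]])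
  ultimately show False by (metis Suc_n_not_le_n le_trans)
qed

section \<open>Transfer to groups with a carrier\<close>

text \<open>Injectivity and multiplicativity are asked on the carrier, so that subgroups, factor
  groups and H are instances, each with its own map.\<close>

locale embedding = group G for G (structure) +
  fixes \<iota> :: "'a \<Rightarrow> 'g::group_add"
  assumes inj: "inj_on \<iota> (carrier G)"
    and emb_mult: "x \<in> carrier G \<Longrightarrow> y \<in> carrier G \<Longrightarrow> \<iota> (x \<otimes> y) = \<iota> x + \<iota> y"
begin

lemma emb_one [simp]: "\<iota> \<one> = 0"
  using emb_mult[of \<one> \<one>] by (metis add.right_neutral add_left_cancel l_one one_closed)

lemma emb_inv [simp]: "x \<in> carrier G \<Longrightarrow> \<iota> (inv x) = - \<iota> x"
  using emb_mult[of x "inv x"] minus_unique[of "\<iota> x" "\<iota> (inv x)"] by simp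

lemma emb_eq_iff [simp]: "x \<in> carrier G \<Longrightarrow> y \<in> carrier G \<Longrightarrow> \<iota> x = \<iota> y \<longleftrightarrow> x = y"
  using inj by (auto simp: inj_on_def)

lemma emb_mem_image: "x \<in> carrier G \<Longrightarrow> A \<subseteq> carrier G \<Longrightarrow> \<iota> x \<in> \<iota> ` A \<longleftrightarrow> x \<in> A"
  by (auto simp: subset_iff)

lemma emb_image_eq: "A \<subseteq> carrier G \<Longrightarrow> B \<subseteq> carrier G \<Longrightarrow> \<iota> ` A = \<iota> ` B \<longleftrightarrow> A = B"
  by (rule inj_on_image_eq_iff[OF inj])

lemma emb_conj: "x \<in> carrier G \<Longrightarrow> y \<in> carrier G \<Longrightarrow> \<iota> (x \<otimes> y \<otimes> inv x) = cj (\<iota> x) (\<iota> y)"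
  by (simp add: emb_mult cj_def)

lemma emb_commutator: "x \<in> carrier G \<Longrightarrow> y \<in> carrier G \<Longrightarrow> \<iota> (x \<otimes> y \<otimes> inv x \<otimes> inv y) = cm (\<iota> x) (\<iota> y)"
  by (simp add: emb_mult cm_def)

lemma sgrp_image_iff: assumes "N \<subseteq> carrier G" shows "sgrp (\<iota> ` N) \<longleftrightarrow> subgroup N G"
proof
  assume s: "sgrp (\<iota> ` N)"
  show "subgroup N G"
  proof (rule subgroup.intro)
    show "x \<otimes> y \<in> N" if "x \<in> N" "y \<in> N" for x y
      using sgrp_add[OF s, of "\<iota> x" "\<iota> y"] that assms emb_mem_image[of "x \<otimes> y" N] by (auto simp: emb_mult subset_iff)
    show "\<one> \<in> N" using sgrp_zero[OF s] emb_mem_image[of \<one> N] assms by simp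
    show "inv x \<in> N" if "x \<in> N" for x
      using sgrp_uminus[OF s, of "\<iota> x"] that assms emb_mem_image[of "inv x" N] by (auto simp: subset_iff)
  qed (rule assms)
next
  assume N: "subgroup N G"
  note m = subgroup.mem_carrier[OF N]
  show "sgrp (\<iota> ` N)"
  proof (rule sgrpI)
    show "0 \<in> \<iota> ` N" using subgroup.one_closed[OF N] emb_one by (metis imageI)
    show "x + y \<in> \<iota> ` N" if "x \<in> \<iota> ` N" "y \<in> \<iota> ` N" for x y
      using that subgroup.m_closed[OF N] m by (auto simp: emb_mult[symmetric])
    show "- x \<in> \<iota> ` N" if "x \<in> \<iota> ` N" for x
      using that subgroup.m_inv_closed[OF N] m by (auto simp: emb_inv[symmetric] simp del: emb_inv)
  qed
qed

lemma sgrp_carrier: "sgrp (\<iota> ` carrier G)"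
  using sgrp_image_iff[of "carrier G"] subgroup_self by simp

lemma nmz_image_iff: assumes "N \<subseteq> carrier G" shows "nmz (\<iota> ` carrier G) (\<iota> ` N) \<and> sgrp (\<iota> ` N) \<longleftrightarrow> N \<lhd> G"
proof -
  have "cj (\<iota> x) (\<iota> y) \<in> \<iota> ` N \<longleftrightarrow> x \<otimes> y \<otimes> inv x \<in> N" if "x \<in> carrier G" "y \<in> N" for x y
    using emb_conj[of x y] emb_mem_image[of "x \<otimes> y \<otimes> inv x" N] that assms by auto
  then have "nmz (\<iota> ` carrier G) (\<iota> ` N) \<longleftrightarrow> (\<forall>x\<in>carrier G. \<forall>y\<in>N. x \<otimes> y \<otimes> inv x \<in> N)"
    by (auto simp: nmz_def)
  then show ?thesis using sgrp_image_iff[OF assms] normal_inv_iff[of N] by blast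
qed

lemma emb_generate: assumes "A \<subseteq> carrier G" shows "\<iota> ` generate G A = gen (\<iota> ` A)"
proof
  have gc: "generate G A \<subseteq> carrier G" using generate_incl[OF assms] .
  show "\<iota> ` generate G A \<subseteq> gen (\<iota> ` A)"
  proof clarify
    fix x assume "x \<in> generate G A"
    then show "\<iota> x \<in> gen (\<iota> ` A)"
    proof (induct rule: generate.induct)
      case (inv h)
      then have "h \<in> carrier G" using assms by blast
      then show ?case using inv by (simp add: gen.uminus gen.base)
    next
      case (eng h1 h2)
      then have "h1 \<in> carrier G" "h2 \<in> carrier G" using gc by auto
      then show ?case using eng by (simp add: emb_mult gen.add)
    qed (auto intro: gen.zero gen.base)
  qed
  show "gen (\<iota> ` A) \<subseteq> \<iota> ` generate G A"
    using sgrp_image_iff[OF gc] generate_is_subgroup[OF assms] by (intro gen_least) (auto intro: generate.incl)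
qed

lemma embedding_subgroup: "subgroup N G \<Longrightarrow> embedding (G\<lparr>carrier := N\<rparr>) \<iota>"
  using subgroup_imp_group[of N] inj subgroup.subset[of N G] emb_mult
  by (auto simp: embedding_def embedding_axioms_def inj_on_subset subset_iff)

lemma lcs_emb: "lower_central_series G n \<subseteq> carrier G \<and> \<iota> ` lower_central_series G n = lcs (\<iota> ` carrier G) n"
proof (induct n)
  case (Suc n)
  let ?A = "\<Union>x\<in>lower_central_series G n. \<Union>y\<in>carrier G. {x \<otimes> y \<otimes> inv x \<otimes> inv y}"
  have A: "?A \<subseteq> carrier G" using Suc by (auto simp: subset_iff)
  have e: "\<iota> (x \<otimes> y \<otimes> inv x \<otimes> inv y) = cm (\<iota> x) (\<iota> y)"
    if "x \<in> lower_central_series G n" "y \<in> carrier G" for x y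
    using emb_commutator that Suc by blast
  have "\<iota> ` ?A = {cm x y | x y. x \<in> lcs (\<iota> ` carrier G) n \<and> y \<in> \<iota> ` carrier G}"
  proof -
    have "\<iota> ` ?A = (\<Union>x\<in>lower_central_series G n. \<Union>y\<in>carrier G. {cm (\<iota> x) (\<iota> y)})"
      unfolding image_UN using e by (intro SUP_cong refl) simp
    also have "\<dots> = {cm x y | x y. x \<in> \<iota> ` lower_central_series G n \<and> y \<in> \<iota> ` carrier G}" by blast
    finally show ?thesis using Suc by simp
  qed
  then show ?case using emb_generate[OF A] generate_incl[OF A] by simp
qed simp

lemma nilpotent_emb: "nilpotent_group G \<longleftrightarrow> nil (\<iota> ` carrier G)"
proof -
  have "lower_central_series G n = {\<one>} \<longleftrightarrow> lcs (\<iota> ` carrier G) n = {0}" for n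
    using emb_image_eq[of "lower_central_series G n" "{\<one>}"] lcs_emb[of n] by simp
  then show ?thesis using is_group by (simp add: nilpotent_group_def nil_def)
qed

lemma Fitting_emb: "Fitting G \<subseteq> carrier G" "\<iota> ` Fitting G = Fit (\<iota> ` carrier G)"
proof -
  have sub: "N \<subseteq> carrier G" if "N \<lhd> G" for N using that normal_imp_subgroup subgroup.subset by blast
  let ?A = "\<Union>{N. N \<lhd> G \<and> nilpotent_group (G\<lparr>carrier := N\<rparr>)}"
  let ?B = "\<Union>{N. sgrp N \<and> N \<subseteq> \<iota> ` carrier G \<and> nmz (\<iota> ` carrier G) N \<and> nil N}"
  have A: "?A \<subseteq> carrier G" using sub by blast
  have n: "nilpotent_group (G\<lparr>carrier := N\<rparr>) \<longleftrightarrow> nil (\<iota> ` N)" if "N \<lhd> G" for N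
    using embedding.nilpotent_emb[OF embedding_subgroup[OF normal_imp_subgroup[OF that]]] by simp
  have "\<iota> ` ?A = ?B"
  proof
    show "\<iota> ` ?A \<subseteq> ?B"
    proof clarify
      fix x N assume "N \<lhd> G" "nilpotent_group (G\<lparr>carrier := N\<rparr>)" "x \<in> N"
      then show "\<iota> x \<in> ?B" using nmz_image_iff[OF sub] n sub by blast
    qed
    show "?B \<subseteq> \<iota> ` ?A"
    proof clarify
      fix x N assume N: "x \<in> N" "sgrp N" "N \<subseteq> \<iota> ` carrier G" "nmz (\<iota> ` carrier G) N" "nil N"
      let ?N = "{y \<in> carrier G. \<iota> y \<in> N}"
      have e: "\<iota> ` ?N = N" using N(3) by blast
      have NC: "?N \<subseteq> carrier G" by blast
      have norm: "?N \<lhd> G" using nmz_image_iff[OF NC] N(2,4) e by simp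
      then have "nilpotent_group (G\<lparr>carrier := ?N\<rparr>)" using n[OF norm] e N(5) by simp
      then have "?N \<subseteq> ?A" using norm by blast
      then show "x \<in> \<iota> ` ?A" using e N(1) by blast
    qed
  qed
  then show "\<iota> ` Fitting G = Fit (\<iota> ` carrier G)" using emb_generate[OF A] by (simp add: Fitting_def Fit_def)
  show "Fitting G \<subseteq> carrier G" unfolding Fitting_def using generate_incl[OF A] .
qed

end

text \<open>Both \<open>G Mod N\<close> and the image of f identify exactly the elements of a coset
  of N. The second conclusion is what allows the next Fitting term to be compared on both
  sides.\<close>

lemma (in group) factor_embedding:
  assumes N: "N \<lhd> G" and e: "embedding G \<iota>" and f: "homo (\<iota> ` carrier G) f"
    and ker: "\<And>x. x \<in> \<iota> ` carrier G \<Longrightarrow> f x = 0 \<longleftrightarrow> x \<in> \<iota> ` N"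
  obtains \<rho> where "embedding (G Mod N) \<rho>" "\<And>x. x \<in> carrier G \<Longrightarrow> \<rho> (N #> x) = f (\<iota> x)"
proof -
  interpret e: embedding G \<iota> by (rule e)
  interpret N: normal N G by (rule N)
  \<comment> \<open>By \<open>key\<close> below, the value does not depend on the representative
    chosen.\<close>
  define \<rho> where "\<rho> C = f (\<iota> (SOME x. x \<in> C))" for C
  have sG: "sgrp (\<iota> ` carrier G)" by (rule e.sgrp_carrier)
  have NG: "N \<subseteq> carrier G" by (rule N.subset)
  have key: "f (\<iota> y) = f (\<iota> x) \<longleftrightarrow> y \<in> N #> x" if xy: "x \<in> carrier G" "y \<in> carrier G" for x y
  proof -
    have "f (\<iota> y) = f (\<iota> x) \<longleftrightarrow> f (\<iota> y) + - f (\<iota> x) = 0" by (metis add.inverse_unique eq_neg_iff_add_eq_0 minus_minus)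
    also have "f (\<iota> y) + - f (\<iota> x) = f (\<iota> (y \<otimes> inv x))"
      using homoD[OF f, of "\<iota> y" "- \<iota> x"] homo_uminus[OF f sG, of "\<iota> x"] sgrp_uminus[OF sG, of "\<iota> x"] xy
      by (simp add: e.emb_mult)
    also have "\<dots> = 0 \<longleftrightarrow> y \<otimes> inv x \<in> N" using ker e.emb_mem_image[OF _ NG] xy by simp
    also have "\<dots> \<longleftrightarrow> y \<in> N #> x" using xy N.rcos_module[OF is_group xy] by blast
    finally show ?thesis .
  qed
  have r: "\<rho> (N #> x) = f (\<iota> x)" if x: "x \<in> carrier G" for x
  proof -
    have "x \<in> N #> x" using rcos_self[OF x N.is_subgroup] .
    then have "(SOME y. y \<in> N #> x) \<in> N #> x" by (rule someI)
    then show ?thesis using key[OF x] r_coset_subset_G[OF NG x] by (auto simp: \<rho>_def)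
  qed
  have "embedding (G Mod N) \<rho>"
  proof (intro embedding.intro embedding_axioms.intro)
    show "group (G Mod N)" by (rule N.factorgroup_is_group)
    show "inj_on \<rho> (carrier (G Mod N))"
    proof (rule inj_onI)
      fix C D assume "C \<in> carrier (G Mod N)" "D \<in> carrier (G Mod N)" "\<rho> C = \<rho> D"
      then obtain x y where "x \<in> carrier G" "y \<in> carrier G" "C = N #> x" "D = N #> y" "\<rho> C = \<rho> D"
        by (auto simp: FactGroup_def RCOSETS_def)
      moreover from this have "y \<in> N #> x" using r key[of x y] by simp
      ultimately show "C = D" using repr_independence[of y N x] N.is_subgroup by blast
    qed
    fix C D assume "C \<in> carrier (G Mod N)" "D \<in> carrier (G Mod N)"
    then obtain x y where xy: "x \<in> carrier G" "y \<in> carrier G" "C = N #> x" "D = N #> y"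
      by (auto simp: FactGroup_def RCOSETS_def)
    have "\<rho> (C \<otimes>\<^bsub>G Mod N\<^esub> D) = f (\<iota> (x \<otimes> y))"
      using xy r N.rcos_sum by (simp add: FactGroup_def)
    then show "\<rho> (C \<otimes>\<^bsub>G Mod N\<^esub> D) = \<rho> C + \<rho> D"
      using xy r homoD[OF f] by (simp add: e.emb_mult)
  qed
  then show thesis using that r by blast
qed

lemma (in embedding) fitting_series_emb:
  assumes fin: "finite (carrier G)"
  shows "fitting_series G n \<subseteq> carrier G \<and> \<iota> ` fitting_series G n = fs (\<iota> ` carrier G) n"
proof (induct n)
  case (Suc n)
  let ?S = "\<iota> ` carrier G" and ?N = "fitting_series G n"
  have S: "sgrp ?S" "finite ?S" using sgrp_carrier fin by auto
  have N: "?N \<subseteq> carrier G" "\<iota> ` ?N = fs ?S n" using Suc by auto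
  note T = fs_props[OF S(1), of n] nmz_fs[OF S(1) S order_refl nmz_self[OF S(1)], of n]
  have norm: "?N \<lhd> G" using nmz_image_iff[OF N(1)] N(2) T by simp
  obtain \<pi> :: "'g \<Rightarrow> 'g set sym" where pi: "homo ?S \<pi>" "\<And>x. x \<in> ?S \<Longrightarrow> \<pi> x = 0 \<longleftrightarrow> x \<in> fs ?S n"
    using quotient_map[OF S(1) T] by metis
  obtain \<rho> where \<rho>: "embedding (G Mod ?N) \<rho>" "\<And>x. x \<in> carrier G \<Longrightarrow> \<rho> (?N #> x) = \<pi> (\<iota> x)"
    using factor_embedding[OF norm embedding_axioms pi(1)] pi(2) N(2) by metis
  interpret q: embedding "G Mod ?N" \<rho> by (rule \<rho>(1))
  have "carrier (G Mod ?N) = (\<lambda>x. ?N #> x) ` carrier G" by (auto simp: FactGroup_def RCOSETS_def)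
  then have img: "\<rho> ` carrier (G Mod ?N) = \<pi> ` ?S" using \<rho>(2) by (simp add: image_image)
  have "?N #> x \<in> Fitting (G Mod ?N) \<longleftrightarrow> \<pi> (\<iota> x) \<in> Fit (\<pi> ` ?S)" if x: "x \<in> carrier G" for x
    using q.emb_mem_image[OF _ q.Fitting_emb(1), of "?N #> x"] q.Fitting_emb(2) x \<rho>(2)[OF x] img
    by (auto simp: FactGroup_def RCOSETS_def)
  then have "fitting_series G (Suc n) = {x \<in> carrier G. \<iota> x \<in> fs ?S (Suc n)}"
    using cen_eq_vimage_Fit[OF S T pi] by auto
  then show ?case using cen_subset[of ?S ?S "fs ?S n"] by auto
qed (auto simp: one_closed)

text \<open>Left multiplication, extended by the identity outside the carrier to a permutation of
  the whole type.\<close>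

lemma cayley_embedding:
  assumes "group G"
  obtains \<iota> :: "'a \<Rightarrow> 'a sym" where "embedding G \<iota>"
proof -
  interpret group G by (rule assms)
  define f where "f x y = (if y \<in> carrier G then x \<otimes>\<^bsub>G\<^esub> y else y)" for x y
  have ff: "f x (f y z) = f (x \<otimes>\<^bsub>G\<^esub> y) z" if "x \<in> carrier G" "y \<in> carrier G" for x y z
    using that by (simp add: f_def m_assoc)
  have bij: "bij (f x)" if "x \<in> carrier G" for x
  proof (rule o_bij)
    have "f \<one>\<^bsub>G\<^esub> z = z" for z by (simp add: f_def)
    then show "f (inv\<^bsub>G\<^esub> x) \<circ> f x = id" "f x \<circ> f (inv\<^bsub>G\<^esub> x) = id"
      using that by (auto simp: fun_eq_iff ff)
  qed
  define \<iota> where "\<iota> x = Abs_sym (f x)" for x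
  have rep: "Rep_sym (\<iota> x) = f x" if "x \<in> carrier G" for x
    using bij[OF that] by (simp add: \<iota>_def Abs_sym_inverse)
  have "embedding G \<iota>"
  proof (unfold_locales)
    show "inj_on \<iota> (carrier G)"
    proof (rule inj_onI)
      fix x y assume "x \<in> carrier G" "y \<in> carrier G" "\<iota> x = \<iota> y"
      then have "f x \<one>\<^bsub>G\<^esub> = f y \<one>\<^bsub>G\<^esub>" using rep by metis
      then show "x = y" using \<open>x \<in> carrier G\<close> \<open>y \<in> carrier G\<close> by (simp add: f_def)
    qed
    fix x y assume "x \<in> carrier G" "y \<in> carrier G"
    then have "Rep_sym (\<iota> (x \<otimes>\<^bsub>G\<^esub> y)) = Rep_sym (\<iota> x + \<iota> y)"
      by (auto simp: rep plus_sym.rep_eq ff)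
    then show "\<iota> (x \<otimes>\<^bsub>G\<^esub> y) = \<iota> x + \<iota> y" by (simp add: Rep_sym_inject)
  qed
  then show thesis by (rule that)
qed

text \<open>A subgroup contained in its own commutator subgroup lies in every term of the derived
  series, hence in the trivial one.\<close>

lemma (in embedding) solv_emb:
  assumes "solvable G"
  shows "solv (\<iota> ` carrier G)"
  unfolding solv_def
proof (intro allI impI, elim conjE)
  fix N assume N: "sgrp N" "N \<subseteq> \<iota> ` carrier G" "N \<subseteq> gen {cm x y | x y. x \<in> N \<and> y \<in> N}"
  have sub: "(derived G ^^ n) (carrier G) \<subseteq> carrier G \<and> N \<subseteq> \<iota> ` (derived G ^^ n) (carrier G)" for n
  proof (induct n)
    case (Suc n)
    let ?D = "(derived G ^^ n) (carrier G)"
    have D: "derived_set G ?D \<subseteq> carrier G" using Suc derived_set_in_carrier by blast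
    have "cm x y \<in> \<iota> ` derived_set G ?D" if xy: "x \<in> N" "y \<in> N" for x y
    proof -
      obtain a b where ab: "a \<in> ?D" "b \<in> ?D" "x = \<iota> a" "y = \<iota> b" using Suc xy by blast
      then have "a \<in> carrier G" "b \<in> carrier G" using Suc by auto
      then have "cm x y = \<iota> (a \<otimes> b \<otimes> inv a \<otimes> inv b)" using ab by (simp add: emb_commutator)
      then show ?thesis using ab by blast
    qed
    then have "gen {cm x y | x y. x \<in> N \<and> y \<in> N} \<subseteq> gen (\<iota> ` derived_set G ?D)" by (intro gen_mono) blast
    also have "\<dots> = \<iota> ` derived G ?D" using emb_generate[OF D] by (simp add: derived_def)
    finally have "N \<subseteq> \<iota> ` derived G ?D" using N(3) by blast
    moreover have "derived G ?D \<subseteq> carrier G" using derived_in_carrier Suc by blast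
    ultimately show ?case by simp
  qed (use N in simp)
  obtain n where "(derived G ^^ n) (carrier G) = {\<one>}" using assms solvable_iff_trivial_derived_seq by blast
  then have "N \<subseteq> {0}" using sub[of n] by simp
  then show "N = {0}" using sgrp_zero[OF N(1)] by blast
qed

section \<open>Automorphism groups and the semidirect product\<close>

context group
begin

lemma auto_props:
  assumes "a \<in> auto G"
  shows "x \<in> carrier G \<Longrightarrow> a x \<in> carrier G" "x \<in> carrier G \<Longrightarrow> y \<in> carrier G \<Longrightarrow> a (x \<otimes> y) = a x \<otimes> a y"
    "a \<in> extensional (carrier G)"
  using assms by (auto simp: auto_def hom_def Bij_def)

lemma finite_auto: assumes "finite (carrier G)" shows "finite (auto G)"
proof (rule finite_subset)
  show "auto G \<subseteq> carrier G \<rightarrow>\<^sub>E carrier G" using auto_props by (auto simp: PiE_def)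
  show "finite (carrier G \<rightarrow>\<^sub>E carrier G)" using assms by (simp add: finite_PiE)
qed

lemma AutoGroup_simps:
  "carrier (AutoGroup G) = auto G"
  "a \<in> auto G \<Longrightarrow> b \<in> auto G \<Longrightarrow> x \<in> carrier G \<Longrightarrow> (a \<otimes>\<^bsub>AutoGroup G\<^esub> b) x = a (b x)"
  "x \<in> carrier G \<Longrightarrow> \<one>\<^bsub>AutoGroup G\<^esub> x = x"
  by (auto simp: AutoGroup_def BijGroup_def auto_def compose_def)

lemma semidirect_simps:
  "carrier (auto_semidirect G F H) = F \<times> H"
  "(x, a) \<otimes>\<^bsub>auto_semidirect G F H\<^esub> (y, b) = (x \<otimes> a y, a \<otimes>\<^bsub>AutoGroup G\<^esub> b)"
  "\<one>\<^bsub>auto_semidirect G F H\<^esub> = (\<one>, \<one>\<^bsub>AutoGroup G\<^esub>)"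
  by (simp_all add: auto_semidirect_def semidirect_product_def)

lemma semidirect_group:
  assumes H: "subgroup H (AutoGroup G)"
  shows "group (auto_semidirect G (carrier G) H)"
proof (rule groupI)
  interpret A: group "AutoGroup G" by (rule AutoGroup)
  have au: "a \<in> auto G" if "a \<in> H" for a using subgroup.mem_carrier[OF H that] by (simp add: AutoGroup_simps)
  note HD = subgroup.m_closed[OF H] subgroup.one_closed[OF H] subgroup.m_inv_closed[OF H]
  have aone: "a \<one> = \<one>" if "a \<in> H" for a
    using auto_props(2)[OF au[OF that], of \<one> \<one>] auto_props(1)[OF au[OF that], of \<one>] by (metis l_cancel_one' one_closed r_one)
  fix p assume p: "p \<in> carrier (auto_semidirect G (carrier G) H)"
  then obtain x a where pa: "p = (x, a)" "x \<in> carrier G" "a \<in> H" by (auto simp: semidirect_simps)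
  show "\<one>\<^bsub>auto_semidirect G (carrier G) H\<^esub> \<otimes>\<^bsub>auto_semidirect G (carrier G) H\<^esub> p = p"
    using pa subgroup.mem_carrier[OF H] by (simp add: semidirect_simps AutoGroup_simps)
  let ?i = "inv\<^bsub>AutoGroup G\<^esub> a"
  have i: "?i \<in> H" "?i \<otimes>\<^bsub>AutoGroup G\<^esub> a = \<one>\<^bsub>AutoGroup G\<^esub>"
    using HD pa subgroup.mem_carrier[OF H] by auto
  show "\<exists>q\<in>carrier (auto_semidirect G (carrier G) H). q \<otimes>\<^bsub>auto_semidirect G (carrier G) H\<^esub> p = \<one>\<^bsub>auto_semidirect G (carrier G) H\<^esub>"
  proof (rule bexI[of _ "(?i (inv x), ?i)"])
    have "?i (inv x) \<otimes> ?i x = \<one>"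
      using auto_props(2)[OF au[OF i(1)] inv_closed[OF pa(2)] pa(2)] l_inv[OF pa(2)] aone[OF i(1)] by simp
    then show "(?i (inv x), ?i) \<otimes>\<^bsub>auto_semidirect G (carrier G) H\<^esub> p = \<one>\<^bsub>auto_semidirect G (carrier G) H\<^esub>"
      using pa i aone by (simp add: semidirect_simps)
    show "(?i (inv x), ?i) \<in> carrier (auto_semidirect G (carrier G) H)"
      using pa i auto_props(1)[OF au[OF i(1)]] by (simp add: semidirect_simps)
  qed
  fix q assume q: "q \<in> carrier (auto_semidirect G (carrier G) H)"
  then obtain y b where qb: "q = (y, b)" "y \<in> carrier G" "b \<in> H" by (auto simp: semidirect_simps)
  show "p \<otimes>\<^bsub>auto_semidirect G (carrier G) H\<^esub> q \<in> carrier (auto_semidirect G (carrier G) H)"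
    using pa qb HD auto_props[OF au] by (simp add: semidirect_simps)
  fix r assume r: "r \<in> carrier (auto_semidirect G (carrier G) H)"
  then obtain z c where rc: "r = (z, c)" "z \<in> carrier G" "c \<in> H" by (auto simp: semidirect_simps)
  show "p \<otimes>\<^bsub>auto_semidirect G (carrier G) H\<^esub> q \<otimes>\<^bsub>auto_semidirect G (carrier G) H\<^esub> r =
      p \<otimes>\<^bsub>auto_semidirect G (carrier G) H\<^esub> (q \<otimes>\<^bsub>auto_semidirect G (carrier G) H\<^esub> r)"
    using pa qb rc auto_props[OF au] au subgroup.mem_carrier[OF H]
    by (simp add: semidirect_simps AutoGroup_simps(2) m_assoc A.m_assoc)
next
  show "\<one>\<^bsub>auto_semidirect G (carrier G) H\<^esub> \<in> carrier (auto_semidirect G (carrier G) H)"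
    using subgroup.one_closed[OF H] by (simp add: semidirect_simps)
qed

text \<open>If h fixes f, then (f, 1) commutes with (1, h), so (1, h) lies in the complement and in
  its conjugate by (f, 1). For nontrivial f the latter element is outside the complement.\<close>

lemma frobenius_fixed_point_free:
  assumes fr: "frobenius_group (auto_semidirect G F H) N ({\<one>} \<times> H)"
    and F: "F \<subseteq> carrier G" and H: "subgroup H (AutoGroup G)" and one: "\<one> \<in> F"
    and h: "h \<in> H" "h \<noteq> \<one>\<^bsub>AutoGroup G\<^esub>" and f: "f \<in> F" "h f = f"
  shows "f = \<one>"
proof (rule ccontr)
  assume f1: "f \<noteq> \<one>"
  interpret A: group "AutoGroup G" by (rule AutoGroup)
  let ?X = "auto_semidirect G F H" and ?f = "(f, \<one>\<^bsub>AutoGroup G\<^esub>)" and ?h = "(\<one>, h)"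
  interpret X: group ?X using fr by (simp add: frobenius_group_def)
  have hc: "h \<in> carrier (AutoGroup G)" using subgroup.mem_carrier[OF H h(1)] .
  have fX: "?f \<in> carrier ?X - {\<one>} \<times> H" "?f \<in> carrier ?X" "?h \<in> carrier ?X"
    using f f1 h subgroup.one_closed[OF H] one by (auto simp: semidirect_simps)
  have "?f \<otimes>\<^bsub>?X\<^esub> ?h = ?h \<otimes>\<^bsub>?X\<^esub> ?f"
    using f F hc by (auto simp: semidirect_simps AutoGroup_simps)
  then have "?h = ?f \<otimes>\<^bsub>?X\<^esub> ?h \<otimes>\<^bsub>?X\<^esub> inv\<^bsub>?X\<^esub> ?f"
    using fX by (simp add: X.m_assoc)
  moreover have "?h \<in> {\<one>} \<times> H" using h by simp
  ultimately have "?h \<in> ({\<one>} \<times> H) \<inter> (?f <#\<^bsub>?X\<^esub> ({\<one>} \<times> H) #>\<^bsub>?X\<^esub> inv\<^bsub>?X\<^esub> ?f)"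
    by (auto simp: l_coset_def r_coset_def)
  then have "?h = \<one>\<^bsub>?X\<^esub>" using fr fX(1) by (auto simp: frobenius_group_def)
  then show False using h by (simp add: semidirect_simps)
qed

text \<open>\<open>normalizer\<close> asks that the conjugate equal F; finiteness supplies this from
  the inclusion.\<close>

lemma carter_normalizer_mem:
  assumes c: "carter_subgroup F G" and fin: "finite (carrier G)"
    and g: "g \<in> carrier G" "\<And>f. f \<in> F \<Longrightarrow> g \<otimes> f \<otimes> inv g \<in> F"
  shows "g \<in> F"
proof -
  have F: "subgroup F G" "normalizer G F = F" using c by (auto simp: carter_subgroup_def)
  have FG: "F \<subseteq> carrier G" using subgroup.subset[OF F(1)] .
  let ?c = "\<lambda>f. g \<otimes> f \<otimes> inv g"
  have "?c ` F = F"
  proof (rule endo_inj_surj)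
    show "finite F" using FG fin finite_subset by blast
    show "?c ` F \<subseteq> F" using g(2) by blast
    show "inj_on ?c F" using FG g(1) by (auto intro!: inj_onI simp: subset_iff)
  qed
  moreover have "g <# F #> inv g = ?c ` F" by (auto simp: l_coset_def r_coset_def)
  ultimately have "g \<in> normalizer G F" using g(1) FG by (simp add: normalizer_def stabilizer_def)
  then show ?thesis using F by simp
qed

end

theorem theorem1p1:
  fixes G :: "('a, 'b) monoid_scheme" and H :: "('a \<Rightarrow> 'a) set" and F :: "'a set"
  assumes "group G" and "finite (carrier G)" and "solvable G"
    and "subgroup H (AutoGroup G)"
    and "carter_subgroup F G" and "invariant_under H F"
    and "frobenius_group (auto_semidirect G F H)
           (F \<times> {\<one>\<^bsub>AutoGroup G\<^esub>}) ({\<one>\<^bsub>G\<^esub>} \<times> H)"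
  shows "(\<forall>n. fitting_series (G\<lparr>carrier := fixed_points G H\<rparr>) n
              = fitting_series G n \<inter> fixed_points G H) \<and>
         fitting_height G \<le> fitting_height (G\<lparr>carrier := fixed_points G H\<rparr>) + 1 \<and>
         carrier G = F <#>\<^bsub>G\<^esub> fitting_series G (fitting_height (G\<lparr>carrier := fixed_points G H\<rparr>))"
proof -
  interpret group G by (rule assms(1))
  interpret A: group "AutoGroup G" by (rule AutoGroup)
  note fin = assms(2) and H = assms(4)
  have F: "subgroup F G" "nilpotent_group (G\<lparr>carrier := F\<rparr>)" using assms(5) by (auto simp: carter_subgroup_def)
  have FG: "F \<subseteq> carrier G" using subgroup.subset[OF F(1)] .
  let ?X = "auto_semidirect G (carrier G) H" and ?e = "\<one>\<^bsub>AutoGroup G\<^esub>"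
  have au: "a \<in> auto G" "a \<in> carrier (AutoGroup G)" if "a \<in> H" for a
    using subgroup.mem_carrier[OF H that] by (auto simp: AutoGroup_simps)
  have oneH: "?e \<in> H" using subgroup.one_closed[OF H] .
  have finH: "finite H" using finite_subset[OF _ finite_auto[OF fin]] au by blast
  obtain \<iota> :: "'a \<times> ('a \<Rightarrow> 'a) \<Rightarrow> ('a \<times> ('a \<Rightarrow> 'a)) sym" where "embedding ?X \<iota>"
    by (rule cayley_embedding[OF semidirect_group[OF H]])
  then interpret X: embedding ?X \<iota> .
  \<comment> \<open>The two factors of the embedded semidirect product: inside it an automorphism h
    of G becomes conjugation by \<open>k h\<close>.\<close>
  define j where "j x = \<iota> (x, ?e)" for x
  define k where "k h = \<iota> (\<one>\<^bsub>G\<^esub>, h)" for h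
  have aone: "a \<one>\<^bsub>G\<^esub> = \<one>\<^bsub>G\<^esub>" if "a \<in> H" for a
    using auto_props(2)[OF au(1)[OF that], of "\<one>\<^bsub>G\<^esub>" "\<one>\<^bsub>G\<^esub>"] auto_props(1)[OF au(1)[OF that], of "\<one>\<^bsub>G\<^esub>"]
    by (metis l_cancel_one' one_closed r_one)
  have jk: "\<iota> (x, h) = j x + k h" if "x \<in> carrier G" "h \<in> H" for x h
    using that X.emb_mult[of "(x, ?e)" "(\<one>\<^bsub>G\<^esub>, h)"] oneH au
    by (simp add: j_def k_def semidirect_simps AutoGroup_simps(3))
  have kj: "k h + j x = \<iota> (h x, h)" if "x \<in> carrier G" "h \<in> H" for x h
    using that X.emb_mult[of "(\<one>\<^bsub>G\<^esub>, h)" "(x, ?e)"] oneH au auto_props(1)[OF au(1)]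
    by (simp add: j_def k_def semidirect_simps)
  have cjk: "cj (k h) (j x) = j (h x)" if "x \<in> carrier G" "h \<in> H" for x h
    using kj[OF that] jk[OF auto_props(1)[OF au(1)[OF that(2)] that(1)] that(2)] by (simp add: cj_def add.assoc)
  interpret j: embedding G j
  proof
    show "inj_on j (carrier G)"
      using X.inj oneH by (auto simp: j_def inj_on_def semidirect_simps)
    show "j (x \<otimes>\<^bsub>G\<^esub> y) = j x + j y" if "x \<in> carrier G" "y \<in> carrier G" for x y
      using that X.emb_mult[of "(x, ?e)" "(y, ?e)"] oneH by (simp add: j_def semidirect_simps AutoGroup_simps(3))
  qed
  have k: "embedding (AutoGroup G\<lparr>carrier := H\<rparr>) k"
  proof (intro embedding.intro embedding_axioms.intro)
    show "group (AutoGroup G\<lparr>carrier := H\<rparr>)" using A.subgroup_imp_group[OF H] .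
    show "inj_on k (carrier (AutoGroup G\<lparr>carrier := H\<rparr>))"
      using X.inj by (auto simp: k_def inj_on_def semidirect_simps)
    show "k (a \<otimes>\<^bsub>AutoGroup G\<lparr>carrier := H\<rparr>\<^esub> b) = k a + k b"
      if "a \<in> carrier (AutoGroup G\<lparr>carrier := H\<rparr>)" "b \<in> carrier (AutoGroup G\<lparr>carrier := H\<rparr>)" for a b
      using that X.emb_mult[of "(\<one>\<^bsub>G\<^esub>, a)" "(\<one>\<^bsub>G\<^esub>, b)"] aone[of a] by (simp add: k_def semidirect_simps)
  qed
  let ?X' = "\<iota> ` carrier ?X" and ?G = "j ` carrier G" and ?H = "k ` H" and ?F = "j ` F"
  have k1: "k ?e = 0" using embedding.emb_one[OF k] by simp
  have k0: "k h = 0 \<longleftrightarrow> h = ?e" if "h \<in> H" for h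
    using embedding.emb_eq_iff[OF k, of h ?e] that oneH k1 by simp
  have GX: "?G \<subseteq> ?X'" using oneH by (auto simp: j_def semidirect_simps)
  have HX: "?H \<subseteq> ?X'" by (auto simp: k_def semidirect_simps)
  have sG: "sgrp ?G" by (rule j.sgrp_carrier)
  have nXG: "nmz ?X' ?G"
    unfolding nmz_def
  proof clarify
    fix y a x assume y: "(y, a) \<in> carrier ?X" and x: "x \<in> carrier G"
    then have ya: "y \<in> carrier G" "a \<in> H" by (auto simp: semidirect_simps)
    have "cj (\<iota> (y, a)) (j x) = cj (j y) (j (a x))" using jk[OF ya] cjk[OF x ya(2)] by (simp add: cj_cj[symmetric])
    moreover have "j (a x) \<in> ?G" using auto_props(1)[OF au(1)[OF ya(2)] x] by blast
    ultimately show "cj (\<iota> (y, a)) (j x) \<in> ?G" using sG ya(1) by (simp add: sgrp_cj)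
  qed
  have GH: "?G \<inter> ?H = {0}"
  proof
    show "?G \<inter> ?H \<subseteq> {0}"
    proof
      fix z assume "z \<in> ?G \<inter> ?H"
      then obtain x h where xh: "x \<in> carrier G" "h \<in> H" "z = j x" "z = k h" by blast
      then have "(x, ?e) = (\<one>\<^bsub>G\<^esub>, h)"
        using X.emb_eq_iff[of "(x, ?e)" "(\<one>\<^bsub>G\<^esub>, h)"] oneH by (simp add: j_def k_def semidirect_simps)
      then show "z \<in> {0}" using xh k1 by simp
    qed
    show "{0} \<subseteq> ?G \<inter> ?H" using j.emb_one k1 oneH by (force intro: rev_image_eqI)
  qed
  have sH: "sgrp ?H" using embedding.sgrp_carrier[OF k] by simp
  have Hne: "?H \<noteq> {0}"
  proof
    assume "?H = {0}"
    then have "H \<subseteq> {?e}" using k0 by blast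
    then have "H = {?e}" using oneH by blast
    then show False using assms(7) by (auto simp: frobenius_group_def semidirect_simps)
  qed
  have car: "carter ?G ?F"
    unfolding carter_def
  proof (intro conjI ballI impI)
    show "sgrp ?F" using j.sgrp_image_iff[OF FG] F(1) by simp
    show "nil ?F" using embedding.nilpotent_emb[OF j.embedding_subgroup[OF F(1)]] F(2) by simp
    fix g assume "g \<in> ?G" and g: "\<forall>f\<in>?F. cj g f \<in> ?F"
    then obtain x where x: "x \<in> carrier G" "g = j x" by blast
    have "x \<otimes>\<^bsub>G\<^esub> f \<otimes>\<^bsub>G\<^esub> inv\<^bsub>G\<^esub> x \<in> F" if "f \<in> F" for f
      using g x that FG j.emb_conj[of x f] j.emb_mem_image[of "x \<otimes>\<^bsub>G\<^esub> f \<otimes>\<^bsub>G\<^esub> inv\<^bsub>G\<^esub> x" F] by (auto simp: subset_iff)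
    then show "g \<in> ?F" using carter_normalizer_mem[OF assms(5) fin x(1)] x(2) by blast
  qed (use FG in auto)
  have nHF: "nmz ?H ?F"
    unfolding nmz_def
  proof clarify
    fix h f assume hf: "h \<in> H" "f \<in> F"
    then have "h f \<in> F" using assms(6) by (auto simp: invariant_under_def)
    then show "cj (k h) (j f) \<in> ?F" using cjk[of f h] hf FG by auto
  qed
  have fpf: "f' = 0" if h': "h' \<in> ?H" "h' \<noteq> 0" and f': "f' \<in> ?F" "h' + f' = f' + h'" for h' f'
  proof -
    obtain h where h: "h \<in> H" "h' = k h" "h \<noteq> ?e" using h' k1 by blast
    obtain f where f: "f \<in> F" "f' = j f" using f' by blast
    have fG: "f \<in> carrier G" using f FG by blast
    have "cj (k h) (j f) = j f" using f'(2) h f by (simp add: cj_eq_self)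
    then have "h f = f" using cjk[OF fG h(1)] j.emb_eq_iff[OF auto_props(1)[OF au(1)[OF h(1)] fG] fG] by simp
    then have "f = \<one>\<^bsub>G\<^esub>"
      using frobenius_fixed_point_free[OF assms(7) FG H subgroup.one_closed[OF F(1)] h(1,3) f(1)] by blast
    then show ?thesis using f by simp
  qed
  have fc: "frobcar ?X' ?G ?H ?F"
    unfolding frobcar_def
    using X.sgrp_carrier sG GX nXG j.solv_emb[OF assms(3)] sH HX GH Hne car nHF fpf fin finH
    by (auto simp: semidirect_simps)
  let ?C = "fixed_points G H"
  have CG: "?C \<subseteq> carrier G" by (auto simp: fixed_points_def)
  have jC: "j ` ?C = cent ?G ?H"
  proof -
    have "j x \<in> cent ?G ?H \<longleftrightarrow> x \<in> ?C" if x: "x \<in> carrier G" for x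
      using cjk[OF x] j.emb_eq_iff[OF auto_props(1)[OF au(1) x] x] x by (auto simp: cent_def fixed_points_def)
    then show ?thesis using CG cent_subset[of ?G ?H] by blast
  qed
  have "subgroup ?C G" using j.sgrp_image_iff[OF CG] jC sgrp_cent[OF sG] by simp
  then interpret C: embedding "G\<lparr>carrier := ?C\<rparr>" j by (rule j.embedding_subgroup)
  have finC: "finite (carrier (G\<lparr>carrier := ?C\<rparr>))" using CG fin finite_subset by auto
  have Gs: "fitting_series G n \<subseteq> carrier G" "j ` fitting_series G n = fs ?G n" for n
    using j.fitting_series_emb[OF fin, of n] by auto
  have Cs: "fitting_series (G\<lparr>carrier := ?C\<rparr>) n \<subseteq> ?C"
    "j ` fitting_series (G\<lparr>carrier := ?C\<rparr>) n = fs (cent ?G ?H) n" for n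
    using C.fitting_series_emb[OF finC, of n] jC by auto
  have a: "fitting_series (G\<lparr>carrier := ?C\<rparr>) n = fitting_series G n \<inter> ?C" for n
  proof -
    have "j ` fitting_series (G\<lparr>carrier := ?C\<rparr>) n = j ` fitting_series G n \<inter> j ` ?C"
      using fs_cent[OF fc, of n] Cs(2) Gs(2) jC by simp
    also have "\<dots> = j ` (fitting_series G n \<inter> ?C)"
      using inj_on_image_Int[OF j.inj Gs(1) CG] by simp
    finally show ?thesis
      using j.emb_image_eq[of "fitting_series (G\<lparr>carrier := ?C\<rparr>) n" "fitting_series G n \<inter> ?C"] Cs(1)[of n] CG by blast
  qed
  define m where "m = fitting_height (G\<lparr>carrier := ?C\<rparr>)"
  have sC: "sgrp (cent ?G ?H)" "finite (cent ?G ?H)" "solv (cent ?G ?H)"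
    using sgrp_cent[OF sG] finite_subset[OF cent_subset, of ?G] fin
      solv_subset[OF j.solv_emb[OF assms(3)] cent_subset] by auto
  \<comment> \<open>Some term of the series is all of C_G(H); therefore the least such index, the
    height, has this property too.\<close>
  obtain n where "fs (cent ?G ?H) n = cent ?G ?H" using fs_reaches[OF sC] by blast
  then have "fitting_series (G\<lparr>carrier := ?C\<rparr>) n = carrier (G\<lparr>carrier := ?C\<rparr>)"
    using j.emb_image_eq[of "fitting_series (G\<lparr>carrier := ?C\<rparr>) n" ?C] Cs[of n] CG jC by auto
  then have "fitting_series (G\<lparr>carrier := ?C\<rparr>) m = carrier (G\<lparr>carrier := ?C\<rparr>)"
    unfolding m_def fitting_height_def by (rule LeastI)
  then have m: "fs (cent ?G ?H) m = cent ?G ?H" using Cs(2)[of m] jC by simp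
  have "fitting_series G (Suc m) = carrier G"
    using carter_fs(2)[OF fc m] j.emb_image_eq[OF Gs(1) order_refl, of "Suc m"] Gs(2)[of "Suc m"] by simp
  then have b: "fitting_height G \<le> m + 1" unfolding fitting_height_def by (simp add: Least_le)
  have "carrier G = F <#>\<^bsub>G\<^esub> fitting_series G m"
  proof -
    have sub: "F <#>\<^bsub>G\<^esub> fitting_series G m \<subseteq> carrier G" using set_mult_closed[OF FG Gs(1)] .
    have "j (f \<otimes>\<^bsub>G\<^esub> y) = j f + j y" if "f \<in> F" "y \<in> fitting_series G m" for f y
      using that FG Gs(1)[of m] by (intro j.emb_mult) auto
    then have "j ` (F <#>\<^bsub>G\<^esub> fitting_series G m) = splus ?F (j ` fitting_series G m)"
      unfolding set_mult_def splus_def by (fastforce simp: image_iff)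
    then have "j ` carrier G = j ` (F <#>\<^bsub>G\<^esub> fitting_series G m)" using carter_fs(1)[OF fc m] Gs(2)[of m] by simp
    then show ?thesis using j.emb_image_eq[OF order_refl sub] by simp
  qed
  then show ?thesis using a b by (simp add: m_def)
qed

end
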